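(* Let $n \geq 7$ be an integer with $n \equiv 1$ or $5 \pmod 6$. Then $$D(4n) \;\geq\; 2n + \min\{ D(2n),\, 2n-7 \}.$$
   Context: A Steiner quadruple system of order $m$, SQS$(m)$, is a pair $(Q,B)$ where $Q$ is a set of $m$ points and $B$ is a collection of $4$-subsets (blocks) of $Q$ such that every $3$-subset of $Q$ is contained in exactly one block of $B$; such systems exist iff $m \equiv 2$ or $4 \pmod 6$. Several SQS$(m)$ on the same point set $Q$ are pairwise disjoint if no $4$-subset of $Q$ is a block of two of them. $D(m)$ denotes the largest number of pairwise disjoint SQS$(m)$ on a common $m$-point set. *)

theory Defs
  imports Main
begin

definition is_SQS :: "'a set \<Rightarrow> 'a set set \<Rightarrow> bool" where
  "is_SQS Q B \<longleftrightarrow> finite Q \<and>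
     (\<forall>b\<in>B. b \<subseteq> Q \<and> card b = 4) \<and>
     (\<forall>T. T \<subseteq> Q \<and> card T = 3 \<longrightarrow> (\<exists>!b. b \<in> B \<and> T \<subseteq> b))"

definition disjoint_SQS_family :: "'a set \<Rightarrow> 'a set set set \<Rightarrow> bool" where
  "disjoint_SQS_family Q F \<longleftrightarrow>
     (\<forall>B\<in>F. is_SQS Q B) \<and> (\<forall>B1\<in>F. \<forall>B2\<in>F. B1 \<noteq> B2 \<longrightarrow> B1 \<inter> B2 = {})"

definition D :: "nat \<Rightarrow> nat" where
  "D m = Max {card F | F. disjoint_SQS_family {..<m} F}"

end

theory Submission
  imports Defs "HOL-Library.Ramsey" "HOL-Library.Disjoint_Sets"
begin

text \<open>
  Take two copies, left and right, of \<open>Q = \<int>\<^sub>n \<times> {0, 1}\<close>. There are two sources of quadruple systems on the \<open>4 n\<close>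
  points. Lindner's construction twists one \<open>SQS(2n)\<close> on \<open>Q\<close> by a permutation \<open>\<alpha>\<close> of \<open>Q\<close>: three points of one side are
  completed on the other side, and \<open>x, y\<close> on the left form a block with \<open>\<alpha> x, \<alpha> y\<close> on the right. The \<open>2 n\<close>
  permutations \<open>\<alpha>\<close> form a Latin square in which, moreover, the images of every pair are distinct, so the resulting
  systems are disjoint. The doubling construction puts a system \<open>A\<^sub>j\<close> on both sides and joins the pairs of colour \<open>c\<close> on
  the left with those of colour \<open>c + j\<close> on the right, for a one-factorization of the complete graph on \<open>Q\<close> with colours
  modulo \<open>2 n - 1\<close>; disjoint \<open>A\<^sub>j\<close> and distinct \<open>j\<close> give disjoint systems. The one-factorization is chosen such that
  the permutations \<open>\<alpha>\<close> change the colour of a pair only by \<open>-2, \<dots>, 3\<close>. Hence a doubling system whose \<open>j\<close> avoids these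
  six shifts has no block in common with the Lindner systems, which leaves \<open>2 n - 7\<close> values of \<open>j\<close>.

  Lindner's construction needs some \<open>SQS(2n)\<close>, which Hanani's theorem provides by recursions through candelabra systems.
  All systems are verified by counting: at most \<open>m / 4\<close> quadruples that cover \<open>m\<close> triples cover each of them once.
\<close>

section \<open>Exact covers of triples by quadruples\<close>

definition exact_cover :: "'a set set \<Rightarrow> 'a set set \<Rightarrow> bool" where
  "exact_cover \<T> \<B> \<longleftrightarrow> (\<forall>b\<in>\<B>. card b = 4) \<and> disjoint_family_on (\<lambda>b. [b]\<^bsup>3\<^esup>) \<B> \<and> (\<Union>b\<in>\<B>. [b]\<^bsup>3\<^esup>) = \<T>"

lemma Union_nsets:
  assumes "0 < n" "n \<le> card A"
  shows "\<Union>([A]\<^bsup>n\<^esup>) = A"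
proof
  show "A \<subseteq> \<Union>([A]\<^bsup>n\<^esup>)"
  proof
    fix x assume "x \<in> A"
    then have "n - 1 \<le> card (A - {x})" using assms by simp
    then obtain N where N: "N \<subseteq> A - {x}" "card N = n - 1" "finite N"
      by (rule obtain_subset_with_card_n)
    then have "card (insert x N) = n" using assms(1) by (subst card_insert_disjoint) auto
    then have "insert x N \<in> [A]\<^bsup>n\<^esup>" using N \<open>x \<in> A\<close> by (auto simp: nsets_def)
    then show "x \<in> \<Union>([A]\<^bsup>n\<^esup>)" by blast
  qed
qed (auto simp: nsets_def)

lemma nsets_image:
  assumes "inj_on h A"
  shows "[h ` A]\<^bsup>n\<^esup> = (`) h ` [A]\<^bsup>n\<^esup>"
  using bij_betw_nsets[OF inj_on_imp_bij_betw[OF assms], of n] by (simp add: bij_betw_def)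

lemma doubleton_of_nsets_2:
  assumes "E \<in> [A]\<^bsup>2\<^esup>"
  obtains x y where "E = {x, y}" "x \<in> A" "y \<in> A" "x \<noteq> y"
  using assms by (auto simp: nsets_2_eq)

lemma nsets_3E:
  assumes "T \<in> [A]\<^bsup>3\<^esup>"
  obtains x y z where "T = {x, y, z}" "x \<in> A" "y \<in> A" "z \<in> A" "x \<noteq> y" "x \<noteq> z" "y \<noteq> z"
  using assms by (auto simp: nsets_3_eq)

lemma tripleton_in_nsets_3 [simp]:
  "{x, y, z} \<in> [A]\<^bsup>3\<^esup> \<longleftrightarrow> x \<in> A \<and> y \<in> A \<and> z \<in> A \<and> x \<noteq> y \<and> x \<noteq> z \<and> y \<noteq> z"
  by (auto simp: nsets_def card_insert_if)

lemma two_times_choose_two: "2 * int (n choose 2) = int n * (int n - 1)"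
  by (induction n) (simp_all add: numeral_2_eq_2 algebra_simps)

lemma six_times_choose_three: "6 * int (n choose 3) = int n * (int n - 1) * (int n - 2)"
proof (induction n)
  case (Suc n)
  then show ?case using two_times_choose_two[of n] by (simp add: numeral_3_eq_3 numeral_2_eq_2 algebra_simps)
qed simp

lemma exact_coverI:
  assumes "\<And>b. b \<in> \<B> \<Longrightarrow> card b = 4"
    and "\<And>b c. b \<in> \<B> \<Longrightarrow> c \<in> \<B> \<Longrightarrow> b \<noteq> c \<Longrightarrow> [b]\<^bsup>3\<^esup> \<inter> [c]\<^bsup>3\<^esup> = {}"
    and "(\<Union>b\<in>\<B>. [b]\<^bsup>3\<^esup>) = \<T>"
  shows "exact_cover \<T> \<B>"
  using assms by (simp add: exact_cover_def disjoint_family_on_def)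

lemma exact_coverD:
  assumes "exact_cover \<T> \<B>"
  shows "b \<in> \<B> \<Longrightarrow> card b = 4"
    and "b \<in> \<B> \<Longrightarrow> c \<in> \<B> \<Longrightarrow> b \<noteq> c \<Longrightarrow> [b]\<^bsup>3\<^esup> \<inter> [c]\<^bsup>3\<^esup> = {}"
    and "(\<Union>b\<in>\<B>. [b]\<^bsup>3\<^esup>) = \<T>"
  using assms by (simp_all add: exact_cover_def disjoint_family_on_def)

lemma exact_coverD_subset:
  assumes "exact_cover \<T> \<B>" "b \<in> \<B>"
  shows "b \<subseteq> \<Union>\<T>"
proof -
  have "b = \<Union>([b]\<^bsup>3\<^esup>)" using assms by (intro Union_nsets[symmetric]) (auto simp: exact_cover_def)
  then show ?thesis using assms unfolding exact_cover_def by blast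
qed

lemma exact_coverD_unique:
  assumes "exact_cover \<T> \<B>" "b \<in> \<B>" "c \<in> \<B>" "T \<in> [b]\<^bsup>3\<^esup>" "T \<in> [c]\<^bsup>3\<^esup>"
  shows "b = c"
  using exact_coverD(2)[OF assms(1-3)] assms(4,5) by blast

lemma exact_cover_if_is_SQS:
  assumes "is_SQS Q B"
  shows "exact_cover ([Q]\<^bsup>3\<^esup>) B"
proof -
  have block: "b \<subseteq> Q \<and> card b = 4" if "b \<in> B" for b using assms that by (simp add: is_SQS_def)
  have unique: "\<exists>!b. b \<in> B \<and> T \<subseteq> b" if "T \<in> [Q]\<^bsup>3\<^esup>" for T
    using assms that unfolding is_SQS_def nsets_def by blast
  have triples: "[b]\<^bsup>3\<^esup> \<subseteq> [Q]\<^bsup>3\<^esup>" if "b \<in> B" for b using block[OF that] by (simp add: nsets_mono)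
  have "[b]\<^bsup>3\<^esup> \<inter> [c]\<^bsup>3\<^esup> = {}" if bc: "b \<in> B" "c \<in> B" "b \<noteq> c" for b c
  proof (rule ccontr)
    assume "[b]\<^bsup>3\<^esup> \<inter> [c]\<^bsup>3\<^esup> \<noteq> {}"
    then obtain T where T: "T \<in> [b]\<^bsup>3\<^esup>" "T \<in> [c]\<^bsup>3\<^esup>" by blast
    then have "T \<subseteq> b" "T \<subseteq> c" by (auto simp: nsets_def)
    moreover have "T \<in> [Q]\<^bsup>3\<^esup>" using T(1) triples[OF bc(1)] by blast
    ultimately show False using unique[of T] bc by blast
  qed
  moreover have "T \<in> (\<Union>b\<in>B. [b]\<^bsup>3\<^esup>)" if T: "T \<in> [Q]\<^bsup>3\<^esup>" for T
  proof -
    obtain b where "b \<in> B" "T \<subseteq> b" using unique[OF T] by blast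
    then show ?thesis using T by (auto simp: nsets_def)
  qed
  then have "[Q]\<^bsup>3\<^esup> \<subseteq> (\<Union>b\<in>B. [b]\<^bsup>3\<^esup>)" by (rule subsetI)
  moreover have "(\<Union>b\<in>B. [b]\<^bsup>3\<^esup>) \<subseteq> [Q]\<^bsup>3\<^esup>" using triples by (rule UN_least)
  ultimately show ?thesis using block by (intro exact_coverI subset_antisym) simp_all
qed

lemma is_SQS_if_exact_cover:
  assumes Q: "finite Q" and cover: "exact_cover ([Q]\<^bsup>3\<^esup>) B"
  shows "is_SQS Q B"
proof -
  have "b \<subseteq> Q \<and> card b = 4" if "b \<in> B" for b
    using exact_coverD_subset[OF cover that] cover that by (auto simp: exact_cover_def nsets_def)
  moreover have "\<exists>!b. b \<in> B \<and> T \<subseteq> b" if "T \<subseteq> Q" "card T = 3" for T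
  proof -
    have T: "finite T" using that(2) by (simp add: card_ge_0_finite)
    then have "T \<in> [Q]\<^bsup>3\<^esup>" using that by (simp add: nsets_def)
    then obtain b where b: "b \<in> B" "T \<in> [b]\<^bsup>3\<^esup>" using cover unfolding exact_cover_def by blast
    have "c = b" if "c \<in> B" "T \<subseteq> c" for c
      by (rule exact_coverD_unique[OF cover that(1) b(1) _ b(2)])
        (use T that \<open>card T = 3\<close> in \<open>simp add: nsets_def\<close>)
    moreover have "T \<subseteq> b" using b(2) by (simp add: nsets_def)
    ultimately show ?thesis using b(1) by blast
  qed
  ultimately show ?thesis using Q by (simp add: is_SQS_def)
qed

lemma is_SQS_iff_exact_cover: "is_SQS Q B \<longleftrightarrow> finite Q \<and> exact_cover ([Q]\<^bsup>3\<^esup>) B"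
proof
  assume "is_SQS Q B"
  then show "finite Q \<and> exact_cover ([Q]\<^bsup>3\<^esup>) B" by (intro conjI exact_cover_if_is_SQS) (simp add: is_SQS_def)
qed (simp add: is_SQS_if_exact_cover)

lemma card_exact_cover:
  assumes "exact_cover \<T> \<B>" "finite \<B>"
  shows "card \<T> = 4 * card \<B>"
proof -
  have "\<forall>b\<in>\<B>. finite ([b]\<^bsup>3\<^esup>) \<and> card ([b]\<^bsup>3\<^esup>) = 4"
    using assms by (auto simp: exact_cover_def eval_nat_numeral intro!: finite_imp_finite_nsets card_ge_0_finite)
  moreover have "card \<T> = (\<Sum>b\<in>\<B>. card ([b]\<^bsup>3\<^esup>))"
    using assms calculation card_UN_disjoint'[of "\<lambda>b. [b]\<^bsup>3\<^esup>" \<B>] by (simp add: exact_cover_def)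
  ultimately show ?thesis by simp
qed

lemma card_is_SQS:
  assumes "is_SQS Q B"
  shows "4 * card B = card Q choose 3"
proof -
  have "B \<subseteq> Pow Q" "finite Q" using assms by (auto simp: is_SQS_def)
  then have "finite B" using finite_subset by blast
  then show ?thesis using card_exact_cover[of "[Q]\<^bsup>3\<^esup>" B] assms by (simp add: is_SQS_iff_exact_cover)
qed

lemma disjoint_family_on_if_sum_card_le:
  assumes "finite I" "\<And>i. i \<in> I \<Longrightarrow> finite (A i)" "(\<Sum>i\<in>I. card (A i)) \<le> card (\<Union>i\<in>I. A i)"
  shows "disjoint_family_on A I"
  using assms
proof (induction I rule: finite_induct)
  case (insert i I)
  let ?U = "\<Union>i\<in>I. A i"
  have fin: "finite (A i)" "finite ?U" using insert by auto
  have "card ?U \<le> (\<Sum>i\<in>I. card (A i))" using insert.hyps(1) by (rule card_UN_le)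
  moreover have "card (A i) + card ?U = card (A i \<union> ?U) + card (A i \<inter> ?U)" using fin by (rule card_Un_Int)
  moreover have "card (A i) + (\<Sum>i\<in>I. card (A i)) \<le> card (A i \<union> ?U)" using insert by simp
  ultimately have "card (A i \<inter> ?U) = 0" "(\<Sum>i\<in>I. card (A i)) \<le> card ?U" by linarith+
  then have "A i \<inter> ?U = {}" "disjoint_family_on A I" using insert fin by auto
  then show ?case using insert.hyps(2) by (simp add: disjoint_family_on_insert)
qed (simp add: disjoint_family_on_def)

text \<open>A family that covers \<open>\<T>\<close> and is not larger than an exact cover would be is one, so no triple has to be
  shown to lie in only one block.\<close>

lemma exact_cover_by_counting:
  assumes fin: "finite \<B>" and blocks: "\<And>b. b \<in> \<B> \<Longrightarrow> finite b \<and> card b \<le> 4"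
    and triples: "\<T> \<subseteq> [X]\<^bsup>3\<^esup>" and covered: "\<And>T. T \<in> \<T> \<Longrightarrow> \<exists>b\<in>\<B>. T \<subseteq> b"
    and count: "4 * card \<B> \<le> card \<T>"
  shows "exact_cover \<T> \<B>"
proof -
  let ?U = "\<Union>b\<in>\<B>. [b]\<^bsup>3\<^esup>"
  have subset_U: "\<T> \<subseteq> ?U" using triples covered by (fastforce simp: nsets_def)
  have finite_U: "finite ?U" using fin blocks by (auto intro: finite_imp_finite_nsets)
  have card_triples: "card ([b]\<^bsup>3\<^esup>) \<le> 4 \<and> (card ([b]\<^bsup>3\<^esup>) = 4 \<longrightarrow> card b = 4)" if "b \<in> \<B>" for b
  proof -
    have "card b = 0 \<or> card b = 1 \<or> card b = 2 \<or> card b = 3 \<or> card b = 4" using blocks[OF that] by linarith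
    then show ?thesis by (elim disjE) (simp_all add: eval_nat_numeral)
  qed
  have "card \<T> \<le> card ?U" using subset_U finite_U by (rule card_mono[rotated])
  moreover have "card ?U \<le> (\<Sum>b\<in>\<B>. card ([b]\<^bsup>3\<^esup>))" using fin by (rule card_UN_le)
  moreover have "(\<Sum>b\<in>\<B>. card ([b]\<^bsup>3\<^esup>)) \<le> 4 * card \<B>"
    using sum_bounded_above[of \<B> "\<lambda>b. card ([b]\<^bsup>3\<^esup>)" 4] card_triples by simp
  ultimately have eq: "card \<T> = card ?U" "(\<Sum>b\<in>\<B>. card ([b]\<^bsup>3\<^esup>)) = (\<Sum>b\<in>\<B>. 4)"
    "(\<Sum>b\<in>\<B>. card ([b]\<^bsup>3\<^esup>)) = card ?U" using count by simp_all
  have "card ([b]\<^bsup>3\<^esup>) = 4" if "b \<in> \<B>" for b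
    by (rule sum_mono_inv[OF eq(2) _ that fin]) (use card_triples in blast)
  then have "\<forall>b\<in>\<B>. card b = 4" using card_triples by blast
  moreover have "disjoint_family_on (\<lambda>b. [b]\<^bsup>3\<^esup>) \<B>"
    by (rule disjoint_family_on_if_sum_card_le) (use fin blocks eq(3) in \<open>auto intro: finite_imp_finite_nsets\<close>)
  moreover have "?U = \<T>" using card_subset_eq[OF finite_U subset_U eq(1)] by simp
  ultimately show ?thesis by (simp add: exact_cover_def)
qed

lemma is_SQS_by_counting:
  assumes "finite Q" "finite B" "\<And>b. b \<in> B \<Longrightarrow> finite b \<and> card b \<le> 4"
    and "\<And>T. T \<in> [Q]\<^bsup>3\<^esup> \<Longrightarrow> \<exists>b\<in>B. T \<subseteq> b" and "4 * card B \<le> card Q choose 3"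
  shows "is_SQS Q B"
  using assms exact_cover_by_counting[of B "[Q]\<^bsup>3\<^esup>" Q] by (simp add: is_SQS_iff_exact_cover)

lemma is_SQS_obtain_fourth:
  assumes "is_SQS Q B" "T \<in> [Q]\<^bsup>3\<^esup>"
  obtains w where "w \<in> Q" "w \<notin> T" "insert w T \<in> B"
proof -
  obtain b where b: "b \<in> B" "T \<in> [b]\<^bsup>3\<^esup>"
    using assms exact_coverD(3)[of "[Q]\<^bsup>3\<^esup>" B] by (auto simp: is_SQS_iff_exact_cover)
  then have "card b = 4" "b \<subseteq> Q" "T \<subseteq> b" "finite T" "card T = 3"
    using assms(1) by (auto simp: is_SQS_def nsets_def)
  then have "card (b - T) = 1" by (simp add: card_Diff_subset)
  then obtain w where "b - T = {w}" by (rule card_1_singletonE)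
  then have "b = insert w T" "w \<notin> T" using \<open>T \<subseteq> b\<close> by auto
  then show thesis using that b(1) \<open>b \<subseteq> Q\<close> by blast
qed

lemma exact_cover_UN:
  assumes cover: "\<And>i. i \<in> I \<Longrightarrow> exact_cover (\<T> i) (\<B> i)" and disj: "disjoint_family_on \<T> I"
  shows "exact_cover (\<Union>i\<in>I. \<T> i) (\<Union>i\<in>I. \<B> i)"
proof (rule exact_coverI)
  fix b c assume b: "b \<in> (\<Union>i\<in>I. \<B> i)" and c: "c \<in> (\<Union>i\<in>I. \<B> i)" and ne: "b \<noteq> c"
  from b obtain i where i: "i \<in> I" "b \<in> \<B> i" by blast
  from c obtain j where j: "j \<in> I" "c \<in> \<B> j" by blast
  show "[b]\<^bsup>3\<^esup> \<inter> [c]\<^bsup>3\<^esup> = {}"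
  proof (cases "i = j")
    case True
    then show ?thesis using exact_coverD(2)[OF cover[OF i(1)] i(2)] j(2) ne by simp
  next
    case False
    then have "\<T> i \<inter> \<T> j = {}" using disj i(1) j(1) by (simp add: disjoint_family_on_def)
    then show ?thesis using exact_coverD(3)[OF cover[OF i(1)]] exact_coverD(3)[OF cover[OF j(1)]] i(2) j(2) by blast
  qed
next
  fix b assume "b \<in> (\<Union>i\<in>I. \<B> i)"
  then show "card b = 4" using exact_coverD(1)[OF cover] by blast
next
  show "(\<Union>b\<in>(\<Union>i\<in>I. \<B> i). [b]\<^bsup>3\<^esup>) = (\<Union>i\<in>I. \<T> i)"
    using exact_coverD(3)[OF cover] by simp
qed

lemma exact_cover_Un:
  assumes "exact_cover \<T>\<^sub>1 \<B>\<^sub>1" "exact_cover \<T>\<^sub>2 \<B>\<^sub>2" "\<T>\<^sub>1 \<inter> \<T>\<^sub>2 = {}"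
  shows "exact_cover (\<T>\<^sub>1 \<union> \<T>\<^sub>2) (\<B>\<^sub>1 \<union> \<B>\<^sub>2)"
proof -
  have "exact_cover (\<Union>i\<in>UNIV. if i then \<T>\<^sub>1 else \<T>\<^sub>2) (\<Union>i\<in>UNIV. if i then \<B>\<^sub>1 else \<B>\<^sub>2)"
    using assms by (intro exact_cover_UN) (auto simp: disjoint_family_on_def)
  then show ?thesis by (simp add: UNIV_bool Un_commute)
qed

lemma exact_cover_Diff_block:
  assumes "exact_cover \<T> \<B>" "b \<in> \<B>"
  shows "exact_cover (\<T> - [b]\<^bsup>3\<^esup>) (\<B> - {b})"
  using exact_coverD[OF assms(1)] assms(2) by (intro exact_coverI) blast+

lemma exact_cover_image:
  assumes cover: "exact_cover \<T> \<B>" and inj: "inj_on h (\<Union>\<T>)"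
  shows "exact_cover ((`) h ` \<T>) ((`) h ` \<B>)"
proof -
  have block_subset: "b \<subseteq> \<Union>\<T>" if "b \<in> \<B>" for b using exact_coverD_subset[OF cover that] .
  have inj_block: "inj_on h b" if "b \<in> \<B>" for b by (rule inj_on_subset[OF inj block_subset[OF that]])
  have image_triples: "[h ` b]\<^bsup>3\<^esup> = (`) h ` [b]\<^bsup>3\<^esup>" if "b \<in> \<B>" for b by (rule nsets_image[OF inj_block[OF that]])
  have disj: "[h ` b]\<^bsup>3\<^esup> \<inter> [h ` c]\<^bsup>3\<^esup> = {}" if bc: "b \<in> \<B>" "c \<in> \<B>" "h ` b \<noteq> h ` c" for b c
  proof -
    have "[b]\<^bsup>3\<^esup> \<union> [c]\<^bsup>3\<^esup> \<subseteq> Pow (\<Union>\<T>)"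
      using block_subset[OF bc(1)] block_subset[OF bc(2)] unfolding nsets_def by blast
    then have "(`) h ` [b]\<^bsup>3\<^esup> \<inter> (`) h ` [c]\<^bsup>3\<^esup> = (`) h ` ([b]\<^bsup>3\<^esup> \<inter> [c]\<^bsup>3\<^esup>)"
      by (intro inj_on_image_Int[symmetric, OF inj_on_image_Pow[OF inj]]) auto
    moreover have "[b]\<^bsup>3\<^esup> \<inter> [c]\<^bsup>3\<^esup> = {}"
      using exact_coverD(2)[OF cover bc(1,2)] bc(3) by blast
    ultimately show ?thesis using image_triples bc by simp
  qed
  have card: "card (h ` b) = 4" if "b \<in> \<B>" for b
    using card_image[OF inj_block[OF that]] cover that by (simp add: exact_cover_def)
  have "(\<Union>b\<in>(`) h ` \<B>. [b]\<^bsup>3\<^esup>) = (`) h ` \<T>"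
    using image_triples by (simp add: exact_coverD(3)[OF cover, symmetric] image_UN)
  then show ?thesis
  proof (rule exact_coverI[rotated 2])
    fix b' c' assume "b' \<in> (`) h ` \<B>" "c' \<in> (`) h ` \<B>" "b' \<noteq> c'"
    then show "[b']\<^bsup>3\<^esup> \<inter> [c']\<^bsup>3\<^esup> = {}" using disj by (elim imageE) simp
  qed (use card in auto)
qed

lemma exact_cover_pullback:
  assumes cover: "exact_cover \<S> \<C>" and type: "\<And>T. T \<in> \<T> \<Longrightarrow> e T \<in> \<S>"
    and fibre: "\<And>c. c \<in> \<C> \<Longrightarrow> \<exists>\<B>. exact_cover {T \<in> \<T>. e T \<subseteq> c} \<B>"
  shows "\<exists>\<B>. exact_cover \<T> \<B>"
proof -
  obtain \<B> where \<B>: "\<And>c. c \<in> \<C> \<Longrightarrow> exact_cover {T \<in> \<T>. e T \<subseteq> c} (\<B> c)" using fibre by metis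
  have image_triple: "finite (e T) \<and> card (e T) = 3" if "T \<in> \<T>" for T
    using type[OF that] cover unfolding exact_cover_def nsets_def by blast
  have "disjoint_family_on (\<lambda>c. {T \<in> \<T>. e T \<subseteq> c}) \<C>"
    unfolding disjoint_family_on_def
  proof (intro ballI impI, rule ccontr)
    fix c d assume cd: "c \<in> \<C>" "d \<in> \<C>" "c \<noteq> d" "{T \<in> \<T>. e T \<subseteq> c} \<inter> {T \<in> \<T>. e T \<subseteq> d} \<noteq> {}"
    then obtain T where "T \<in> \<T>" "e T \<in> [c]\<^bsup>3\<^esup>" "e T \<in> [d]\<^bsup>3\<^esup>" using image_triple by (auto simp: nsets_def)
    then show False using exact_coverD_unique[OF cover cd(1,2)] cd(3) by blast
  qed
  from exact_cover_UN[of \<C>, OF \<B> this]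
  have "exact_cover (\<Union>c\<in>\<C>. {T \<in> \<T>. e T \<subseteq> c}) (\<Union>c\<in>\<C>. \<B> c)" .
  moreover have "(\<Union>c\<in>\<C>. {T \<in> \<T>. e T \<subseteq> c}) = \<T>"
    using type cover unfolding exact_cover_def by (fastforce simp: nsets_def)
  ultimately show ?thesis by auto
qed

section \<open>Orders of Steiner quadruple systems\<close>

definition has_SQS :: "nat \<Rightarrow> bool" where
  "has_SQS v \<longleftrightarrow> (\<exists>B. is_SQS {..<v} B)"

lemma is_SQS_image:
  assumes "is_SQS Q B" "inj_on h Q"
  shows "is_SQS (h ` Q) ((`) h ` B)"
proof -
  have "\<Union>([Q]\<^bsup>3\<^esup>) \<subseteq> Q" by (auto simp: nsets_def)
  then show ?thesis
    using exact_cover_image[of "[Q]\<^bsup>3\<^esup>" B h] assms by (auto simp: is_SQS_iff_exact_cover nsets_image inj_on_subset)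
qed

lemma has_SQS_iff:
  assumes "finite Q" "card Q = v"
  shows "has_SQS v \<longleftrightarrow> (\<exists>B. is_SQS Q B)"
proof -
  obtain h where h: "bij_betw h {..<v} Q"
    using ex_bij_betw_nat_finite[OF assms(1)] assms(2) by (auto simp: atLeast0LessThan)
  have "bij_betw (inv_into {..<v} h) Q {..<v}" by (rule bij_betw_inv_into[OF h])
  then show ?thesis using h is_SQS_image unfolding has_SQS_def bij_betw_def by metis
qed

lemma has_SQS_2: "has_SQS 2"
proof -
  have "[{..<2 :: nat}]\<^bsup>3\<^esup> = {}" by (simp add: nsets_eq_empty_iff)
  then have "is_SQS {..<2 :: nat} {}"
    by (simp add: is_SQS_iff_exact_cover exact_cover_def disjoint_family_on_def)
  then show ?thesis unfolding has_SQS_def by blast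
qed

lemma has_SQS_4: "has_SQS 4"
proof -
  have "is_SQS {..<4 :: nat} {{..<4}}"
    by (simp add: is_SQS_iff_exact_cover exact_cover_def disjoint_family_on_def)
  then show ?thesis unfolding has_SQS_def by blast
qed

text \<open>Any two quadruples of points are exchanged by some permutation of the points.\<close>

lemma has_SQS_obtain_block:
  assumes "has_SQS v" "finite Q" "card Q = v" "S \<subseteq> Q" "card S = 4"
  obtains B where "is_SQS Q B" "S \<in> B"
proof -
  obtain B where B: "is_SQS Q B" using assms has_SQS_iff by blast
  have "4 \<le> v" using assms card_mono[of Q S] by simp
  then have "[Q]\<^bsup>3\<^esup> \<noteq> {}" using assms by (simp add: nsets_eq_empty_iff)
  then obtain b where "b \<in> B" using B unfolding is_SQS_iff_exact_cover exact_cover_def by blast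
  then have b: "b \<in> B" "b \<subseteq> Q" "card b = 4" using B by (auto simp: is_SQS_def)
  have fin: "finite b" "finite S" using assms b by (auto intro: finite_subset)
  obtain f where f: "bij_betw f b S" using finite_same_card_bij[OF fin] b assms by auto
  have "card (Q - b) = card (Q - S)" using assms b fin by (simp add: card_Diff_subset)
  then obtain f' where f': "bij_betw f' (Q - b) (Q - S)"
    using finite_same_card_bij[of "Q - b" "Q - S"] assms(2) by auto
  define h where "h = (\<lambda>x. if x \<in> b then f x else f' x)"
  have "bij_betw h (b \<union> (Q - b)) (S \<union> (Q - S))"
    unfolding h_def by (rule bij_betw_disjoint_Un[OF f f']) auto
  then have "bij_betw h Q Q" using assms(4) b(2) by (simp add: Un_absorb1)
  then have "is_SQS Q ((`) h ` B)" using is_SQS_image[OF B, of h] by (simp add: bij_betw_def)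
  moreover have "h ` b = S" using f by (auto simp: h_def bij_betw_def)
  ultimately show thesis using that b(1) by blast
qed

section \<open>One-factorizations\<close>

definition one_factorization :: "'a set \<Rightarrow> ('a \<Rightarrow> 'a \<Rightarrow> bool) \<Rightarrow> 'c set \<Rightarrow> ('a \<Rightarrow> 'a \<Rightarrow> 'c) \<Rightarrow> bool" where
  "one_factorization V E C \<kappa> \<longleftrightarrow>
     (\<forall>x\<in>V. \<forall>y\<in>V. E x y \<longrightarrow> x \<noteq> y \<and> E y x \<and> \<kappa> y x = \<kappa> x y) \<and>
     (\<forall>x\<in>V. bij_betw (\<kappa> x) {y \<in> V. E x y} C)"

definition colour_class :: "'a set \<Rightarrow> ('a \<Rightarrow> 'a \<Rightarrow> bool) \<Rightarrow> ('a \<Rightarrow> 'a \<Rightarrow> 'c) \<Rightarrow> 'c \<Rightarrow> 'a set set" where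
  "colour_class V E \<kappa> c = {{x, y} | x y. x \<in> V \<and> y \<in> V \<and> E x y \<and> \<kappa> x y = c}"

lemma one_factorizationD:
  assumes "one_factorization V E C \<kappa>" "x \<in> V"
  shows "y \<in> V \<Longrightarrow> E x y \<Longrightarrow> x \<noteq> y" "y \<in> V \<Longrightarrow> E x y \<Longrightarrow> E y x"
    "y \<in> V \<Longrightarrow> E x y \<Longrightarrow> \<kappa> y x = \<kappa> x y" "bij_betw (\<kappa> x) {y \<in> V. E x y} C"
  using assms unfolding one_factorization_def by blast+

lemma one_factorization_colour:
  assumes "one_factorization V E C \<kappa>" "x \<in> V" "y \<in> V" "E x y"
  shows "\<kappa> x y \<in> C"
  using one_factorizationD(4)[OF assms(1,2)] assms(3,4) by (auto simp: bij_betw_def)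

lemma one_factorization_obtain_mate:
  assumes "one_factorization V E C \<kappa>" "x \<in> V" "c \<in> C"
  obtains y where "y \<in> V" "E x y" "\<kappa> x y = c"
proof -
  have "c \<in> \<kappa> x ` {y \<in> V. E x y}"
    using one_factorizationD(4)[OF assms(1,2)] assms(3) by (simp add: bij_betw_def)
  then show thesis using that by auto
qed

lemma one_factorization_mate_unique:
  assumes "one_factorization V E C \<kappa>" "x \<in> V" "y \<in> V" "E x y" "z \<in> V" "E x z" "\<kappa> x y = \<kappa> x z"
  shows "y = z"
  using one_factorizationD(4)[OF assms(1,2)] assms(3-) by (auto simp: bij_betw_def inj_on_def)

lemma one_factorization_cong:
  assumes "one_factorization V E C \<kappa>" "\<And>x y. x \<in> V \<Longrightarrow> y \<in> V \<Longrightarrow> E x y \<longleftrightarrow> E' x y"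
  shows "one_factorization V E' C \<kappa>"
proof -
  have "{y \<in> V. E x y} = {y \<in> V. E' x y}" if "x \<in> V" for x using assms(2) that by blast
  then show ?thesis using assms unfolding one_factorization_def by simp
qed

lemma one_factorization_recolour:
  assumes "one_factorization V E C \<kappa>" "bij_betw f C C'"
  shows "one_factorization V E C' (\<lambda>x y. f (\<kappa> x y))"
  using assms bij_betw_trans[of "\<kappa> x" _ C f C' for x]
  unfolding one_factorization_def comp_def by simp

lemma colour_class_subset_nsets:
  assumes "one_factorization V E C \<kappa>"
  shows "colour_class V E \<kappa> c \<subseteq> [V]\<^bsup>2\<^esup>"
  using one_factorizationD(1)[OF assms] by (auto simp: colour_class_def)

lemma finite_colour_class:
  assumes "finite V"
  shows "finite (colour_class V E \<kappa> c)"
  by (rule finite_subset[of _ "Pow V"]) (use assms in \<open>auto simp: colour_class_def\<close>)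

lemma colour_class_completeE:
  assumes "one_factorization Q (\<noteq>) C \<kappa>" "E \<in> [Q]\<^bsup>2\<^esup>"
  obtains c where "c \<in> C" "E \<in> colour_class Q (\<noteq>) \<kappa> c"
proof -
  obtain x y where E: "E = {x, y}" "x \<in> Q" "y \<in> Q" "x \<noteq> y" using assms(2) by (rule doubleton_of_nsets_2)
  then have "E \<in> colour_class Q (\<noteq>) \<kappa> (\<kappa> x y)" unfolding colour_class_def by blast
  then show thesis using that one_factorization_colour[OF assms(1) E(2-4)] by blast
qed

lemma colour_class_obtain_mate:
  assumes "one_factorization V E C \<kappa>" "x \<in> V" "c \<in> C"
  obtains e where "e \<in> colour_class V E \<kappa> c" "x \<in> e"
proof -
  obtain y where "y \<in> V" "E x y" "\<kappa> x y = c" by (rule one_factorization_obtain_mate[OF assms])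
  then have "{x, y} \<in> colour_class V E \<kappa> c" using assms(2) unfolding colour_class_def by blast
  then show thesis using that by blast
qed

lemma card_colours_complete:
  assumes "one_factorization Q (\<noteq>) C \<kappa>" "Q \<noteq> {}"
  shows "card C = card Q - 1"
proof -
  obtain x where "x \<in> Q" using assms(2) by blast
  moreover have "{y \<in> Q. x \<noteq> y} = Q - {x}" by blast
  ultimately show ?thesis using bij_betw_same_card[OF one_factorizationD(4)[OF assms(1), of x]] by simp
qed

lemma card_colour_class:
  assumes fac: "one_factorization V E C \<kappa>" and fin: "finite V" and c: "c \<in> C"
  shows "2 * card (colour_class V E \<kappa> c) = card V"
proof -
  let ?F = "colour_class V E \<kappa> c"
  have "\<Union>?F = V"
  proof
    show "V \<subseteq> \<Union>?F"
    proof
      fix x assume "x \<in> V"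
      moreover from this obtain y where "y \<in> V" "E x y" "\<kappa> x y = c"
        by (rule one_factorization_obtain_mate[OF fac _ c])
      ultimately show "x \<in> \<Union>?F" unfolding colour_class_def by blast
    qed
  qed (auto simp: colour_class_def)
  moreover have "card e = 2" if "e \<in> ?F" for e
    using that colour_class_subset_nsets[OF fac] by (auto simp: nsets_def)
  moreover have "e \<inter> e' = {}" if e: "e \<in> ?F" "e' \<in> ?F" and ne: "e \<noteq> e'" for e e'
  proof (rule ccontr)
    have edge: "\<exists>y\<in>V. e = {x, y} \<and> E x y \<and> \<kappa> x y = c" if "e \<in> ?F" "x \<in> e" for e x
      using that one_factorizationD(2,3)[OF fac] unfolding colour_class_def by fastforce
    assume "e \<inter> e' \<noteq> {}"
    then obtain x where x: "x \<in> e" "x \<in> e'" by blast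
    obtain y where y: "y \<in> V" "e = {x, y}" "E x y" "\<kappa> x y = c" using edge[OF e(1) x(1)] by blast
    obtain z where z: "z \<in> V" "e' = {x, z}" "E x z" "\<kappa> x z = c" using edge[OF e(2) x(2)] by blast
    have "x \<in> V" using e(1) x(1) unfolding colour_class_def by blast
    then show False using one_factorization_mate_unique[OF fac, of x y z] y z ne by simp
  qed
  ultimately show ?thesis using card_partition[OF finite_colour_class[OF fin, of E \<kappa> c], of 2] fin by simp
qed

lemma card_same_colour_le:
  assumes "finite C" "\<And>c. c \<in> C \<Longrightarrow> 2 * card (F c) = v" "\<And>c. c \<in> C \<Longrightarrow> 2 * card (G c) = v"
  shows "4 * card (\<Union>c\<in>C. F c \<times> G c) \<le> card C * v\<^sup>2"
proof -
  have "4 * card (\<Union>c\<in>C. F c \<times> G c) \<le> 4 * (\<Sum>c\<in>C. card (F c \<times> G c))" using assms(1) by (simp add: card_UN_le)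
  also have "\<dots> = (\<Sum>c\<in>C. (2 * card (F c)) * (2 * card (G c)))"
    by (simp add: card_cartesian_product sum_distrib_left algebra_simps)
  also have "\<dots> = card C * v\<^sup>2" using assms(2,3) by (simp add: power2_eq_square)
  finally show ?thesis .
qed

lemma one_factorization_matching:
  assumes "\<And>x. x \<in> V \<Longrightarrow> \<pi> x \<in> V \<and> \<pi> (\<pi> x) = x \<and> \<pi> x \<noteq> x"
  shows "one_factorization V (\<lambda>x y. y = \<pi> x) {c} (\<lambda>_ _. c)"
proof -
  have "{y \<in> V. y = \<pi> x} = {\<pi> x}" if "x \<in> V" for x using assms[OF that] by blast
  then show ?thesis using assms unfolding one_factorization_def bij_betw_def by force
qed

lemma bij_betw_if_image_eq:
  assumes "finite A" "f ` A = B" "card A = card B"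
  shows "bij_betw f A B"
  using assms eq_card_imp_inj_on[of A f] by (simp add: bij_betw_def)

lemma one_factorization_even_cycles:
  fixes c :: "'a \<Rightarrow> int"
  assumes \<sigma>: "bij_betw \<sigma> V V" "\<And>x. x \<in> V \<Longrightarrow> \<sigma> (\<sigma> x) \<noteq> x" and c: "\<And>x. x \<in> V \<Longrightarrow> {c x, c (\<sigma> x)} = {0, 1}"
  shows "one_factorization V (\<lambda>x y. y = \<sigma> x \<or> x = \<sigma> y) {0, 1} (\<lambda>x y. if y = \<sigma> x then c x else c y)"
    (is "one_factorization V ?E _ ?\<kappa>")
  unfolding one_factorization_def
proof (intro conjI ballI impI)
  fix x y assume xy: "x \<in> V" "y \<in> V" "?E x y"
  show "x \<noteq> y" using xy \<sigma>(2) by metis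
  show "?E y x" using xy(3) by blast
  show "?\<kappa> y x = ?\<kappa> x y" using xy \<sigma>(2)[OF xy(1)] \<sigma>(2)[OF xy(2)] by auto
next
  fix x assume x: "x \<in> V"
  obtain w where w: "w \<in> V" "x = \<sigma> w" using x \<sigma>(1) by (auto simp: bij_betw_def)
  have V: "\<sigma> x \<in> V" using x \<sigma>(1) by (auto simp: bij_betw_def)
  have "w \<noteq> \<sigma> x" using w \<sigma>(2)[OF w(1)] by metis
  have E: "{y \<in> V. ?E x y} = {w, \<sigma> x}" using w V x \<sigma>(1) by (auto simp: bij_betw_def inj_on_eq_iff)
  have "?\<kappa> x ` {w, \<sigma> x} = {0, 1}" using \<open>w \<noteq> \<sigma> x\<close> c[OF w(1)] w(2) by auto
  then show "bij_betw (?\<kappa> x) {y \<in> V. ?E x y} {0, 1}"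
    unfolding E using \<open>w \<noteq> \<sigma> x\<close> by (intro bij_betw_if_image_eq) auto
qed

definition cyclic_colour :: "int \<Rightarrow> int \<Rightarrow> int \<Rightarrow> int" where
  "cyclic_colour n d x = (if x \<ge> n - d then 2 else (x div d) mod 2)"

lemma cyclic_colour_range: "cyclic_colour n d x \<in> {0, 1, 2}"
  by (auto simp: cyclic_colour_def)

lemma cyclic_colour_proper:
  assumes "0 < d" "2 * d \<le> n" "0 \<le> x" "x < n"
  shows "cyclic_colour n d ((x + d) mod n) \<noteq> cyclic_colour n d x"
proof (cases "x \<ge> n - d")
  case True
  have "(x + d) mod n = (x + d - n) mod n" by simp
  also have "\<dots> = x + d - n" using True assms by (intro mod_pos_pos_trivial) auto
  finally have m: "(x + d) mod n = x + d - n" .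
  have "(x + d - n) div d = 0" using True assms by (intro div_pos_pos_trivial) auto
  then show ?thesis using True assms unfolding m by (simp add: cyclic_colour_def)
next
  case False
  then have m: "(x + d) mod n = x + d" using assms by simp
  have "(x + d) div d = x div d + 1" using div_add_self2[of d x] assms by simp
  moreover have "(k + 1) mod 2 \<noteq> k mod 2" for k :: int by presburger
  ultimately have "((x + d) div d) mod 2 \<noteq> (x div d) mod 2" by metis
  moreover have "(x div d) mod 2 \<noteq> 2" using pos_mod_bound[of 2 "x div d"] by linarith
  ultimately show ?thesis using False unfolding m by (simp add: cyclic_colour_def)
qed

lemma one_factorization_prism:
  fixes c :: "'a \<Rightarrow> int"
  assumes \<sigma>: "bij_betw \<sigma> V V" "\<And>x. x \<in> V \<Longrightarrow> \<sigma> (\<sigma> x) \<noteq> x"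
    and \<pi>: "\<And>x. x \<in> V \<Longrightarrow> \<pi> x \<in> V \<and> \<pi> (\<pi> x) = x \<and> \<pi> x \<noteq> x \<and> \<pi> x \<noteq> \<sigma> x \<and> \<sigma> (\<pi> x) \<noteq> x"
    and colours: "\<And>x. x \<in> V \<Longrightarrow> {c x, c (\<sigma> x), r (\<sigma> x)} = {0, 1, 2}"
    and rung: "\<And>x. x \<in> V \<Longrightarrow> r (\<pi> x) = r x"
  shows "one_factorization V (\<lambda>x y. y = \<sigma> x \<or> x = \<sigma> y \<or> y = \<pi> x) {0, 1, 2}
    (\<lambda>x y. if y = \<sigma> x then c x else if x = \<sigma> y then c y else r x)"
    (is "one_factorization V ?E _ ?\<kappa>")
  unfolding one_factorization_def
proof (intro conjI ballI impI)
  fix x y assume xy: "x \<in> V" "y \<in> V" "?E x y"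
  show "x \<noteq> y" using xy \<sigma>(2) \<pi> by metis
  show "?E y x" using xy(3) \<pi>[OF xy(1)] by metis
  show "?\<kappa> y x = ?\<kappa> x y"
    using xy(3) \<sigma>(2)[OF xy(1)] \<sigma>(2)[OF xy(2)] \<pi>[OF xy(1)] rung[OF xy(1)] by auto
next
  fix x assume x: "x \<in> V"
  obtain w where w: "w \<in> V" "x = \<sigma> w" using x \<sigma>(1) by (auto simp: bij_betw_def)
  have V: "\<sigma> x \<in> V" using x \<sigma>(1) by (auto simp: bij_betw_def)
  have dist: "w \<noteq> \<sigma> x" "\<pi> x \<noteq> w" using w \<sigma>(2)[OF x] \<pi>[OF x] by metis+
  have E: "{y \<in> V. ?E x y} = {w, \<sigma> x, \<pi> x}"
    using w V \<pi>[OF x] x \<sigma>(1) by (auto simp: bij_betw_def inj_on_eq_iff)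
  have "?\<kappa> x w = c w" "?\<kappa> x (\<sigma> x) = c x" "?\<kappa> x (\<pi> x) = r x" using dist \<pi>[OF x] w(2) by auto
  then have "?\<kappa> x ` {w, \<sigma> x, \<pi> x} = {0, 1, 2}"
    using colours[OF w(1), folded w(2)] by (simp only: image_insert image_empty)
  then show "bij_betw (?\<kappa> x) {y \<in> V. ?E x y} {0, 1, 2}"
    unfolding E using dist \<pi>[OF x] by (intro bij_betw_if_image_eq) auto
qed

lemma mod_shift_twice: "((x + a) mod g + a) mod g = (x + 2 * a) mod g" for x a g :: int
proof -
  have "x + a + a = x + 2 * a" by simp
  then show ?thesis unfolding mod_add_left_eq by (simp only:)
qed

lemma mod_add_neq:
  fixes n x k :: int
  assumes "x \<in> {0..<n}" "0 < k" "k < n"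
  shows "(x + k) mod n \<noteq> x"
proof
  assume "(x + k) mod n = x"
  then have "(x + k) mod n = x mod n" using assms(1) by simp
  then have "n dvd k" by (simp add: mod_eq_dvd_iff)
  then show False using assms(2,3) zdvd_imp_le by fastforce
qed

text \<open>Two copies of the cycles \<open>x, x + d, x + 2 d, \<dots>\<close> modulo \<open>n\<close> are coloured alike, so that the colour missing at
  the two ends of a rung is the same.\<close>

lemma one_factorization_cyclic_prism:
  fixes pos :: "'a \<Rightarrow> int"
  assumes d: "0 < d" "2 * d < n" and pos: "\<And>x. x \<in> V \<Longrightarrow> pos x \<in> {0..<n}"
    and \<sigma>: "bij_betw \<sigma> V V" "\<And>x. x \<in> V \<Longrightarrow> pos (\<sigma> x) = (pos x + d) mod n"
    and \<pi>: "\<And>x. x \<in> V \<Longrightarrow> \<pi> x \<in> V \<and> \<pi> (\<pi> x) = x \<and> \<pi> x \<noteq> x \<and> pos (\<pi> x) = pos x"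
  shows "\<exists>\<kappa>. one_factorization V (\<lambda>x y. y = \<sigma> x \<or> x = \<sigma> y \<or> y = \<pi> x) {0, 1, 2 :: int} \<kappa>"
proof -
  define c where "c x = cyclic_colour n d (pos x)" for x
  define r where "r x = 3 - c x - cyclic_colour n d ((pos x - d) mod n)" for x
  have V: "\<sigma> x \<in> V" if "x \<in> V" for x using that \<sigma>(1) by (auto simp: bij_betw_def)
  have shift: "pos (\<sigma> x) \<noteq> pos x" "pos (\<sigma> (\<sigma> x)) \<noteq> pos x" if x: "x \<in> V" for x
  proof -
    have "pos (\<sigma> (\<sigma> x)) = (pos x + 2 * d) mod n"
      using \<sigma>(2)[OF V[OF x]] \<sigma>(2)[OF x] mod_shift_twice by simp
    then show "pos (\<sigma> x) \<noteq> pos x" "pos (\<sigma> (\<sigma> x)) \<noteq> pos x"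
      using mod_add_neq[OF pos[OF x]] d \<sigma>(2)[OF x] by auto
  qed
  have colours: "{c x, c (\<sigma> x), r (\<sigma> x)} = {0, 1, 2}" if x: "x \<in> V" for x
  proof -
    have "(pos (\<sigma> x) - d) mod n = pos x" using \<sigma>(2)[OF x] pos[OF x] by (simp add: mod_diff_left_eq)
    then have "r (\<sigma> x) = 3 - c (\<sigma> x) - c x" by (simp add: r_def c_def)
    moreover have "c (\<sigma> x) \<noteq> c x"
      using cyclic_colour_proper[of d n "pos x"] d pos[OF x] \<sigma>(2)[OF x] by (simp add: c_def)
    moreover have "c x \<in> {0, 1, 2}" "c (\<sigma> x) \<in> {0, 1, 2}" unfolding c_def by (rule cyclic_colour_range)+
    ultimately show ?thesis by auto
  qed
  have "\<pi> x \<noteq> \<sigma> x \<and> \<sigma> (\<pi> x) \<noteq> x" if "x \<in> V" for x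
    using shift(1)[OF that] shift(1)[of "\<pi> x"] \<pi>[OF that] by metis
  moreover have "\<sigma> (\<sigma> x) \<noteq> x" if "x \<in> V" for x using shift(2)[OF that] by metis
  moreover have "r (\<pi> x) = r x" if "x \<in> V" for x using \<pi>[OF that] by (simp add: r_def c_def)
  ultimately show ?thesis using one_factorization_prism[of \<sigma> V \<pi> c r] \<sigma>(1) \<pi> colours by blast
qed

lemma one_factorization_UN:
  assumes fac: "\<And>a. a \<in> A \<Longrightarrow> one_factorization V (E a) (C a) (K a)"
    and edges: "\<And>a b x y. a \<in> A \<Longrightarrow> b \<in> A \<Longrightarrow> x \<in> V \<Longrightarrow> y \<in> V \<Longrightarrow> E a x y \<Longrightarrow> E b x y \<Longrightarrow> a = b"
    and colours: "disjoint_family_on C A"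
  obtains \<kappa> where "one_factorization V (\<lambda>x y. \<exists>a\<in>A. E a x y) (\<Union>a\<in>A. C a) \<kappa>"
    "\<And>a x y. a \<in> A \<Longrightarrow> x \<in> V \<Longrightarrow> y \<in> V \<Longrightarrow> E a x y \<Longrightarrow> \<kappa> x y \<in> C a"
proof -
  define \<kappa> where "\<kappa> x y = K (THE a. a \<in> A \<and> E a x y) x y" for x y
  have \<kappa>: "\<kappa> x y = K a x y" if "a \<in> A" "x \<in> V" "y \<in> V" "E a x y" for a x y
  proof -
    have "(THE a. a \<in> A \<and> E a x y) = a" using edges that by (intro the_equality) blast+
    then show ?thesis by (simp add: \<kappa>_def)
  qed
  have bij: "bij_betw (\<kappa> x) {y \<in> V. \<exists>a\<in>A. E a x y} (\<Union>a\<in>A. C a)" if x: "x \<in> V" for x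
  proof -
    have "bij_betw (\<kappa> x) {y \<in> V. E a x y} (C a)" if "a \<in> A" for a
      using one_factorizationD(4)[OF fac[OF that] x] \<kappa>[OF that x]
      by (subst bij_betw_cong[of _ _ "K a x"]) auto
    with colours have "bij_betw (\<kappa> x) (\<Union>a\<in>A. {y \<in> V. E a x y}) (\<Union>a\<in>A. C a)"
      by (rule bij_betw_UNION_disjoint)
    moreover have "(\<Union>a\<in>A. {y \<in> V. E a x y}) = {y \<in> V. \<exists>a\<in>A. E a x y}" by blast
    ultimately show ?thesis by simp
  qed
  have "one_factorization V (\<lambda>x y. \<exists>a\<in>A. E a x y) (\<Union>a\<in>A. C a) \<kappa>"
    unfolding one_factorization_def
  proof (intro conjI ballI impI bij)
    fix x y assume xy: "x \<in> V" "y \<in> V" "\<exists>a\<in>A. E a x y"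
    then obtain a where a: "a \<in> A" "E a x y" by blast
    note D = one_factorizationD(1-3)[OF fac[OF a(1)] xy(1,2) a(2)]
    show "x \<noteq> y" by (rule D)
    show "\<exists>a\<in>A. E a y x" using a(1) D(2) by blast
    show "\<kappa> y x = \<kappa> x y" using \<kappa>[OF a(1) xy(1,2) a(2)] \<kappa>[OF a(1) xy(2,1)] D(2,3) by simp
  qed
  moreover have "\<kappa> x y \<in> C a" if "a \<in> A" "x \<in> V" "y \<in> V" "E a x y" for a x y
    using \<kappa>[OF that] one_factorization_colour[OF fac[OF that(1)] that(2-4)] by simp
  ultimately show thesis by (rule that)
qed


section \<open>Circulant graphs\<close>

lemma shift_mod_bij:
  fixes g a :: int
  shows "bij_betw (\<lambda>x. (x + a) mod g) {0..<g} {0..<g}"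
proof (rule bij_betw_byWitness[where f' = "\<lambda>x. (x - a) mod g"])
  show "\<forall>x\<in>{0..<g}. ((x + a) mod g - a) mod g = x" by (simp add: mod_diff_left_eq)
  show "\<forall>x\<in>{0..<g}. ((x - a) mod g + a) mod g = x" by (simp add: mod_add_left_eq)
qed auto

lemma mod_diff_eq_iff:
  fixes g x y k :: int
  assumes "x \<in> {0..<g}" "y \<in> {0..<g}" "0 < k" "k < g"
  shows "(y - x) mod g = k \<longleftrightarrow> y = (x + k) mod g"
proof
  assume "(y - x) mod g = k"
  then have "(x + k) mod g = (x + (y - x)) mod g" by (metis mod_add_right_eq)
  then show "y = (x + k) mod g" using assms(2) by simp
next
  assume "y = (x + k) mod g"
  then have "(y - x) mod g = (x + k - x) mod g" by (simp add: mod_diff_left_eq)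
  then show "(y - x) mod g = k" using assms(3,4) by simp
qed

lemma mod_diff_eq_0_iff:
  fixes x y g :: int
  assumes "x \<in> {0..<g}" "y \<in> {0..<g}"
  shows "(y - x) mod g = 0 \<longleftrightarrow> x = y"
proof -
  have "x mod g = x" "y mod g = y" using assms by simp_all
  then show ?thesis by (metis mod_eq_dvd_iff mod_eq_0_iff_dvd)
qed

lemma mod_diff_flip:
  fixes g x y k :: int
  assumes "0 < k" "k < g"
  shows "(y - x) mod g = g - k \<longleftrightarrow> (x - y) mod g = k"
proof -
  have "(x - y) mod g = (- (y - x)) mod g" by simp
  then show ?thesis using assms unfolding zmod_zminus1_eq_if by auto
qed

definition rung :: "int \<Rightarrow> int \<Rightarrow> int \<Rightarrow> int" where
  "rung g f x = (if even x then x + f else x - f) mod g"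

lemma rung_involution:
  assumes "even g" "odd f" "x \<in> {0..<g}"
  shows "rung g f x \<in> {0..<g}" "rung g f (rung g f x) = x" "rung g f x \<noteq> x" "even (rung g f x) \<longleftrightarrow> odd x"
proof -
  show par: "even (rung g f x) \<longleftrightarrow> odd x"
    using assms(1,2) by (simp add: rung_def dvd_mod_iff)
  then show "rung g f x \<noteq> x" by metis
  show "rung g f x \<in> {0..<g}" using assms(3) by (simp add: rung_def)
  show "rung g f (rung g f x) = x"
  proof (cases "even x")
    case True
    then have "rung g f (rung g f x) = (rung g f x - f) mod g" using par by (simp add: rung_def)
    then show ?thesis using True assms(3) by (simp add: rung_def mod_diff_left_eq)
  next
    case False
    then have "rung g f (rung g f x) = (rung g f x + f) mod g" using par by (simp add: rung_def)
    then show ?thesis using False assms(3) by (simp add: rung_def mod_add_left_eq)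
  qed
qed

lemma eq_rung_iff:
  assumes "x \<in> {0..<g}" "y \<in> {0..<g}" "0 < f" "f < g"
  shows "y = rung g f x \<longleftrightarrow> (y - x) mod g = (if even x then f else g - f)"
proof (cases "even x")
  case True
  then show ?thesis using mod_diff_eq_iff[OF assms] by (simp add: rung_def)
next
  case False
  have "(x - f) mod g = (x + (g - f)) mod g" by (metis add_diff_eq diff_add_eq mod_add_self2)
  then show ?thesis using False mod_diff_eq_iff[of x g y "g - f"] assms by (simp add: rung_def)
qed

text \<open>The edges of difference \<open>a\<close> of the circulant graph, and for even \<open>a\<close> in \<open>P\<close> also the rungs of difference \<open>\<phi> a\<close>,
  written in terms of the difference \<open>d = y - x\<close> modulo \<open>g\<close> and the parity of \<open>x\<close>.\<close>

definition circulant_part :: "int \<Rightarrow> int set \<Rightarrow> (int \<Rightarrow> int) \<Rightarrow> int \<Rightarrow> int \<Rightarrow> int \<Rightarrow> bool" where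
  "circulant_part g P \<phi> a x y = (let d = (y - x) mod g; rung_diff = (\<lambda>f. if even x then f else g - f) in
     if even a then d = a \<or> d = g - a \<or> a \<in> P \<and> d = rung_diff (\<phi> a) else d = rung_diff a)"

locale circulant_pairing =
  fixes g :: int and W P :: "int set" and \<phi> :: "int \<Rightarrow> int"
  assumes even_g: "even g" and pos_g: "g > 0"
    and W: "\<And>d. d \<in> W \<Longrightarrow> 0 < d \<and> d < g \<and> g - d \<in> W"
    and P: "\<And>e. e \<in> P \<Longrightarrow> e \<in> W \<and> even e \<and> 2 * e < g \<and> \<phi> e \<in> W \<and> odd (\<phi> e)"
    and inj: "inj_on \<phi> P"
    and unpaired: "\<And>e. e \<in> W \<Longrightarrow> even e \<Longrightarrow> 2 * e < g \<Longrightarrow> e \<notin> P \<Longrightarrow> e mod 4 = 2 \<and> 4 dvd g"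
begin

definition parts :: "int set" where
  "parts = {a \<in> W. if even a then 2 * a \<le> g else a \<notin> \<phi> ` P}"

lemma circulant_iff_part:
  assumes "x \<in> {0..<g}" "y \<in> {0..<g}"
  shows "(y - x) mod g \<in> W \<longleftrightarrow> (\<exists>a\<in>parts. circulant_part g P \<phi> a x y)"
proof
  define d where "d = (y - x) mod g"
  assume "(y - x) mod g \<in> W"
  then have d: "d \<in> W" "g - d \<in> W" using W by (auto simp: d_def)
  show "\<exists>a\<in>parts. circulant_part g P \<phi> a x y"
  proof (cases "even d")
    case True
    then have "min d (g - d) \<in> parts" using d even_g by (auto simp: parts_def min_def)
    moreover have "circulant_part g P \<phi> (min d (g - d)) x y"
      using True even_g by (auto simp: circulant_part_def Let_def d_def min_def)
    ultimately show ?thesis by blast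
  next
    case False
    define f where "f = (if even x then d else g - d)"
    have f: "f \<in> W" "odd f" "d = (if even x then f else g - f)" using d False even_g by (auto simp: f_def)
    show ?thesis
    proof (cases "f \<in> \<phi> ` P")
      case True
      then obtain a where a: "a \<in> P" "f = \<phi> a" by blast
      then have "a \<in> parts" using P[OF a(1)] by (simp add: parts_def)
      moreover have "circulant_part g P \<phi> a x y"
        using a P[OF a(1)] f(3) by (simp add: circulant_part_def Let_def d_def)
      ultimately show ?thesis by blast
    next
      case False
      then have "f \<in> parts" using f by (simp add: parts_def)
      moreover have "circulant_part g P \<phi> f x y" using f by (simp add: circulant_part_def Let_def d_def)
      ultimately show ?thesis by blast
    qed
  qed
next
  assume "\<exists>a\<in>parts. circulant_part g P \<phi> a x y"
  then show "(y - x) mod g \<in> W"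
    using W P by (fastforce simp: parts_def circulant_part_def Let_def split: if_splits)
qed

lemma circulant_part_unique:
  assumes "a \<in> parts" "b \<in> parts" "circulant_part g P \<phi> a x y" "circulant_part g P \<phi> b x y"
  shows "a = b"
proof -
  define d where "d = (y - x) mod g"
  define f where "f = (if even x then d else g - d)"
  have part: "if even d then a = min d (g - d) else if f \<in> \<phi> ` P then a = the_inv_into P \<phi> f else a = f"
    if a: "a \<in> parts" "circulant_part g P \<phi> a x y" for a
  proof (cases "even d")
    case True
    then show ?thesis using a even_g P
      by (auto simp: parts_def circulant_part_def Let_def d_def[symmetric] min_def split: if_splits)
  next
    case False
    then have "a \<in> P \<and> f = \<phi> a \<or> a \<notin> \<phi> ` P \<and> a = f"
      using a even_g P by (auto simp: parts_def circulant_part_def Let_def d_def[symmetric] f_def split: if_splits)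
    then show ?thesis using False the_inv_into_f_f[OF inj] inj_onD[OF inj] by auto
  qed
  show ?thesis using part[OF assms(1,3)] part[OF assms(2,4)] by (simp split: if_splits)
qed

lemma odd_part_one_factorization:
  assumes "a \<in> parts" "odd a"
  shows "one_factorization {0..<g} (circulant_part g P \<phi> a) {0 :: int} (\<lambda>_ _. 0)"
proof -
  have a: "0 < a" "a < g" using assms W by (auto simp: parts_def)
  have "one_factorization {0..<g} (\<lambda>x y. y = rung g a x) {0 :: int} (\<lambda>_ _. 0)"
    by (rule one_factorization_matching) (use rung_involution[OF even_g assms(2)] in blast)
  then show ?thesis
    by (rule one_factorization_cong) (use assms(2) a in \<open>simp add: eq_rung_iff circulant_part_def Let_def\<close>)
qed

lemma step_edge_iff:
  assumes "a \<in> parts" "x \<in> {0..<g}" "y \<in> {0..<g}"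
  shows "(y - x) mod g = a \<longleftrightarrow> y = (x + a) mod g" "(y - x) mod g = g - a \<longleftrightarrow> x = (y + a) mod g"
proof -
  have a: "0 < a" "a < g" using assms W by (auto simp: parts_def)
  show "(y - x) mod g = a \<longleftrightarrow> y = (x + a) mod g" "(y - x) mod g = g - a \<longleftrightarrow> x = (y + a) mod g"
    using mod_diff_eq_iff[OF assms(2,3) a] mod_diff_eq_iff[OF assms(3,2) a] mod_diff_flip[OF a, of y x]
    by simp_all
qed

lemma half_part_one_factorization:
  assumes "a \<in> parts" "even a" "2 * a = g"
  shows "one_factorization {0..<g} (circulant_part g P \<phi> a) {0 :: int} (\<lambda>_ _. 0)"
proof -
  have a: "0 < a" "a < g" "g - a = a" "a \<notin> P" using assms W P by (auto simp: parts_def)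
  have "one_factorization {0..<g} (\<lambda>x y. y = (x + a) mod g) {0 :: int} (\<lambda>_ _. 0)"
    by (rule one_factorization_matching) (use mod_shift_twice[of _ a g] assms a mod_add_neq in auto)
  then show ?thesis
  proof (rule one_factorization_cong)
    fix x y assume xy: "x \<in> {0..<g}" "y \<in> {0..<g}"
    show "y = (x + a) mod g \<longleftrightarrow> circulant_part g P \<phi> a x y"
      unfolding circulant_part_def Let_def a(3) using step_edge_iff(1)[OF assms(1) xy] assms(2) a(4) by simp
  qed
qed

lemma paired_part_one_factorization:
  assumes "a \<in> parts" "a \<in> P"
  shows "\<exists>\<kappa>. one_factorization {0..<g} (circulant_part g P \<phi> a) {0, 1, 2 :: int} \<kappa>"
proof -
  define pos where "pos x = (if even x then x else (x - \<phi> a) mod g)" for x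
  have a: "even a" "2 * a < g" "0 < a" using P[OF assms(2)] W by auto
  have \<phi>: "odd (\<phi> a)" "0 < \<phi> a" "\<phi> a < g" using P[OF assms(2)] W by auto
  have "\<exists>\<kappa>. one_factorization {0..<g}
      (\<lambda>x y. y = (x + a) mod g \<or> x = (y + a) mod g \<or> y = rung g (\<phi> a) x) {0, 1, 2 :: int} \<kappa>"
  proof (rule one_factorization_cyclic_prism[where pos = pos])
    fix x assume x: "x \<in> {0..<g}"
    show "pos x \<in> {0..<g}" using x by (simp add: pos_def)
    have "(x + a - \<phi> a) mod g = (x - \<phi> a + a) mod g" by (simp only: diff_add_eq)
    then show "pos ((x + a) mod g) = (pos x + a) mod g"
      using a(1) even_g by (simp add: pos_def dvd_mod_iff mod_diff_left_eq mod_add_left_eq)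
    have "pos (rung g (\<phi> a) x) = pos x"
      using rung_involution(4)[OF even_g \<phi>(1) x] x by (auto simp: pos_def rung_def mod_diff_left_eq)
    then show "rung g (\<phi> a) x \<in> {0..<g} \<and> rung g (\<phi> a) (rung g (\<phi> a) x) = x \<and>
        rung g (\<phi> a) x \<noteq> x \<and> pos (rung g (\<phi> a) x) = pos x"
      using rung_involution[OF even_g \<phi>(1) x] by blast
  qed (use a shift_mod_bij in simp_all)
  then obtain \<kappa> where
    "one_factorization {0..<g} (\<lambda>x y. y = (x + a) mod g \<or> x = (y + a) mod g \<or> y = rung g (\<phi> a) x) {0, 1, 2 :: int} \<kappa>"
    by blast
  then have "one_factorization {0..<g} (circulant_part g P \<phi> a) {0, 1, 2 :: int} \<kappa>"
    by (rule one_factorization_cong)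
      (use assms a step_edge_iff \<phi> eq_rung_iff in \<open>simp add: circulant_part_def Let_def\<close>)
  then show ?thesis by blast
qed

lemma unpaired_part_one_factorization:
  assumes "a \<in> parts" "even a" "2 * a < g" "a \<notin> P"
  shows "\<exists>\<kappa>. one_factorization {0..<g} (circulant_part g P \<phi> a) {0, 1 :: int} \<kappa>"
proof -
  let ?\<sigma> = "\<lambda>x. (x + a) mod g"
  define c where "c x = (x div 2) mod 2" for x :: int
  have a: "0 < a" "a mod 4 = 2" "4 dvd g" using assms unpaired W by (auto simp: parts_def)
  have "{c x, c (?\<sigma> x)} = {0, 1}" for x
  proof -
    have "?\<sigma> x mod 4 = (x + a) mod 4" using a(3) by (rule mod_mod_cancel)
    also have "\<dots> = (x + 2) mod 4" using a(2) by (metis mod_add_right_eq)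
    finally have "?\<sigma> x mod 4 = (x + 2) mod 4" .
    moreover have "c y \<noteq> c x" if "y mod 4 = (x + 2) mod 4" for y using that unfolding c_def by presburger
    ultimately have "c (?\<sigma> x) \<noteq> c x" by blast
    then show ?thesis unfolding c_def by auto
  qed
  moreover have "?\<sigma> (?\<sigma> x) \<noteq> x" if "x \<in> {0..<g}" for x
    using mod_shift_twice[of x a g] mod_add_neq[OF that, of "2 * a"] a assms(3) by simp
  ultimately have "one_factorization {0..<g} (\<lambda>x y. y = ?\<sigma> x \<or> x = ?\<sigma> y) {0, 1} (\<lambda>x y. if y = ?\<sigma> x then c x else c y)"
    using shift_mod_bij by (intro one_factorization_even_cycles)
  then have "one_factorization {0..<g} (circulant_part g P \<phi> a) {0, 1} (\<lambda>x y. if y = ?\<sigma> x then c x else c y)"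
    by (rule one_factorization_cong) (use assms step_edge_iff in \<open>simp add: circulant_part_def Let_def\<close>)
  then show ?thesis by blast
qed

lemma part_one_factorization:
  assumes "a \<in> parts"
  shows "\<exists>C \<kappa>. one_factorization {0..<g} (circulant_part g P \<phi> a) (C :: int set) \<kappa>"
proof -
  consider "odd a" | "even a" "2 * a = g" | "a \<in> P" | "even a" "2 * a < g" "a \<notin> P"
    using assms by (fastforce simp: parts_def)
  then show ?thesis
    by cases (use assms odd_part_one_factorization half_part_one_factorization paired_part_one_factorization
      unpaired_part_one_factorization in blast)+
qed

theorem circulant_one_factorization:
  "\<exists>\<kappa>. one_factorization {0..<g} (\<lambda>x y. (y - x) mod g \<in> W) {..<card W} \<kappa>"
proof -
  obtain C K where CK: "\<And>a. a \<in> parts \<Longrightarrow> one_factorization {0..<g} (circulant_part g P \<phi> a) (C a :: int set) (K a)"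
    using part_one_factorization by metis
  have "one_factorization {0..<g} (circulant_part g P \<phi> a) (Pair a ` C a) (\<lambda>x y. (a, K a x y))" if "a \<in> parts" for a
    by (rule one_factorization_recolour[OF CK[OF that]]) (simp add: bij_betw_def inj_on_def)
  then obtain \<kappa> where "one_factorization {0..<g} (\<lambda>x y. \<exists>a\<in>parts. circulant_part g P \<phi> a x y) (\<Union>a\<in>parts. Pair a ` C a) \<kappa>"
    by (rule one_factorization_UN) (use circulant_part_unique in \<open>auto simp: disjoint_family_on_def\<close>)
  then have fac: "one_factorization {0..<g} (\<lambda>x y. (y - x) mod g \<in> W) (\<Union>a\<in>parts. Pair a ` C a) \<kappa>"
    (is "one_factorization _ _ ?C _")
    by (rule one_factorization_cong) (simp add: circulant_iff_part)
  have "{y \<in> {0..<g}. (y - 0) mod g \<in> W} = W" using W by force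
  then have "bij_betw (\<kappa> 0) W ?C" using one_factorizationD(4)[OF fac, of 0] pos_g by simp
  moreover have "finite W" by (rule finite_subset[of _ "{0..<g}"]) (use W in force)+
  ultimately have "finite ?C" "card ?C = card W" by (auto simp: bij_betw_finite bij_betw_same_card)
  then obtain f where "bij_betw f ?C {..<card W}" by (metis bij_betw_iff_card card_lessThan finite_lessThan)
  then show ?thesis using one_factorization_recolour[OF fac] by blast
qed

end

theorem complete_one_factorization:
  assumes "even g"
  shows "\<exists>\<kappa>. one_factorization {0..<int g} (\<noteq>) {..<g - 1} \<kappa>"
proof (cases "g = 0")
  case True
  then show ?thesis by (simp add: one_factorization_def)
next
  case False
  interpret circulant_pairing "int g" "{0<..<int g}" "{e. even e \<and> 0 < e \<and> 2 * e < int g}" "\<lambda>e. e + 1"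
    by unfold_locales (use assms False in auto)
  have card: "card {0<..<int g} = g - 1" by simp
  obtain \<kappa> where "one_factorization {0..<int g} (\<lambda>x y. (y - x) mod int g \<in> {0<..<int g}) {..<g - 1} \<kappa>"
    using circulant_one_factorization by (auto simp only: card)
  then have "one_factorization {0..<int g} (\<noteq>) {..<g - 1} \<kappa>"
  proof (rule one_factorization_cong)
    fix x y assume xy: "x \<in> {0..<int g}" "y \<in> {0..<int g}"
    have "(y - x) mod int g = 0 \<longleftrightarrow> x = y" using xy by (rule mod_diff_eq_0_iff)
    moreover have "0 \<le> (y - x) mod int g" "(y - x) mod int g < int g" using False by simp_all
    ultimately show "(y - x) mod int g \<in> {0<..<int g} \<longleftrightarrow> x \<noteq> y" by auto
  qed
  then show ?thesis by blast
qed

section \<open>Systems on two copies of a point set\<close>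

lemma Plus_subset_iff: "A <+> B \<subseteq> A' <+> B' \<longleftrightarrow> A \<subseteq> A' \<and> B \<subseteq> B'"
  by auto

lemma Plus_eq_iff: "A <+> B = A' <+> B' \<longleftrightarrow> A = A' \<and> B = B'"
  by (simp only: set_eq_subset Plus_subset_iff) blast

lemma nsets_3_Plus_cases:
  assumes "T \<in> [P <+> Q]\<^bsup>3\<^esup>"
  obtains (left) A where "A \<in> [P]\<^bsup>3\<^esup>" "T = A <+> {}"
  | (left_pair) E v where "E \<in> [P]\<^bsup>2\<^esup>" "v \<in> Q" "T = E <+> {v}"
  | (right_pair) u E where "u \<in> P" "E \<in> [Q]\<^bsup>2\<^esup>" "T = {u} <+> E"
  | (right) A where "A \<in> [Q]\<^bsup>3\<^esup>" "T = {} <+> A"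
proof -
  define A B where "A = Inl -` T" and "B = Inr -` T"
  have T: "T = A <+> B"
  proof (rule set_eqI)
    fix p show "p \<in> T \<longleftrightarrow> p \<in> A <+> B" by (cases p) (auto simp: A_def B_def)
  qed
  have fin: "finite A" "finite B" using assms T by (auto simp: nsets_def finite_Plus_iff)
  have sub: "A \<subseteq> P" "B \<subseteq> Q" using assms by (auto simp: nsets_def A_def B_def)
  have "card A + card B = 3" using assms T fin by (simp add: nsets_def card_Plus)
  then have "card A = 3 \<and> card B = 0 \<or> card A = 2 \<and> card B = 1 \<or> card A = 1 \<and> card B = 2 \<or> card A = 0 \<and> card B = 3"
    by presburger
  then consider "card A = 3" "B = {}" | v where "card A = 2" "B = {v}" | u where "A = {u}" "card B = 2"
    | "A = {}" "card B = 3"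
    using fin by (auto simp: card_1_singleton_iff)
  then show thesis
  proof cases
    case 1
    then show ?thesis using left[of A] fin sub T by (simp add: nsets_def)
  next
    case (2 v)
    then show ?thesis using left_pair[of A v] fin sub T by (simp add: nsets_def)
  next
    case (3 u)
    then show ?thesis using right_pair[of u B] fin sub T by (simp add: nsets_def)
  next
    case 4
    then show ?thesis using right[of B] fin sub T by (simp add: nsets_def)
  qed
qed

definition lindner :: "'a set \<Rightarrow> 'a set set \<Rightarrow> ('a \<Rightarrow> 'a) \<Rightarrow> ('a + 'a) set set" where
  "lindner Q B \<alpha> = {(b - {w}) <+> {\<alpha> w} | b w. b \<in> B \<and> w \<in> b} \<union>
     {{u} <+> (b - {\<alpha> u}) | b u. b \<in> B \<and> u \<in> Q \<and> \<alpha> u \<in> b} \<union> {E <+> \<alpha> ` E | E. E \<in> [Q]\<^bsup>2\<^esup>}"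

lemma card_lindner_le:
  assumes B: "is_SQS Q B" and \<alpha>: "bij_betw \<alpha> Q Q"
  shows "finite (lindner Q B \<alpha>)" "card (lindner Q B \<alpha>) \<le> 8 * card B + (card Q choose 2)"
proof -
  have fin: "finite Q" "B \<subseteq> Pow Q" and b4: "\<And>b. b \<in> B \<Longrightarrow> b \<subseteq> Q \<and> card b = 4"
    using B by (auto simp: is_SQS_def)
  have finB: "finite B" using finite_subset[OF fin(2)] fin(1) by simp
  have finb: "finite b" if "b \<in> B" for b using b4[OF that] fin(1) finite_subset by blast
  let ?P = "SIGMA b:B. b"
  let ?L = "(\<lambda>(b, w). (b - {w}) <+> {\<alpha> w}) ` ?P"
  let ?R = "(\<lambda>(b, w). {inv_into Q \<alpha> w} <+> (b - {w})) ` ?P"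
  let ?E = "(\<lambda>E. E <+> \<alpha> ` E) ` [Q]\<^bsup>2\<^esup>"
  have "lindner Q B \<alpha> \<subseteq> ?L \<union> ?R \<union> ?E"
  proof -
    have "{u} <+> (b - {\<alpha> u}) \<in> ?R" if "b \<in> B" "u \<in> Q" "\<alpha> u \<in> b" for b u
      using that \<alpha> by (intro image_eqI[of _ _ "(b, \<alpha> u)"]) (auto simp: bij_betw_def)
    then show ?thesis unfolding lindner_def by force
  qed
  moreover have P: "finite ?P" "card ?P = 4 * card B"
    using finB finb b4 by (simp_all add: card_SigmaI)
  moreover have "finite (?L \<union> ?R \<union> ?E)" using P fin by (simp add: finite_imp_finite_nsets)
  moreover have "card (?L \<union> ?R \<union> ?E) \<le> card ?L + card ?R + card ?E"
    using card_Un_le[of "?L \<union> ?R" ?E] card_Un_le[of ?L ?R] by linarith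
  moreover have "card ?L \<le> 4 * card B" "card ?R \<le> 4 * card B" "card ?E \<le> card Q choose 2"
    using card_image_le[OF P(1)] P(2) card_image_le[of "[Q]\<^bsup>2\<^esup>"] fin(1)
    by (metis, metis, simp add: finite_imp_finite_nsets)
  ultimately show "finite (lindner Q B \<alpha>)" "card (lindner Q B \<alpha>) \<le> 8 * card B + (card Q choose 2)"
    using finite_subset card_mono[of "?L \<union> ?R \<union> ?E" "lindner Q B \<alpha>"] by (blast, linarith)
qed

lemma lindner_blockI:
  shows "b \<in> B \<Longrightarrow> w \<in> b \<Longrightarrow> (b - {w}) <+> {\<alpha> w} \<in> lindner Q B \<alpha>"
    and "b \<in> B \<Longrightarrow> u \<in> Q \<Longrightarrow> \<alpha> u \<in> b \<Longrightarrow> {u} <+> (b - {\<alpha> u}) \<in> lindner Q B \<alpha>"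
    and "E \<in> [Q]\<^bsup>2\<^esup> \<Longrightarrow> E <+> \<alpha> ` E \<in> lindner Q B \<alpha>"
  unfolding lindner_def by blast+

lemma lindner_covers_left_pair:
  assumes B: "is_SQS Q B" and z: "z \<in> Q" and E: "E \<in> [Q]\<^bsup>2\<^esup>"
  shows "\<exists>b\<in>lindner Q B \<alpha>. E <+> {\<alpha> z} \<subseteq> b"
proof (cases "z \<in> E")
  case True
  then show ?thesis using lindner_blockI(3)[OF E, of \<alpha> B] by (intro bexI) auto
next
  case False
  obtain x y where "E = {x, y}" "x \<in> Q" "y \<in> Q" "x \<noteq> y" using E by (rule doubleton_of_nsets_2)
  then have "insert z E \<in> [Q]\<^bsup>3\<^esup>" using False z by simp
  then obtain w where w: "w \<notin> insert z E" "insert w (insert z E) \<in> B" by (rule is_SQS_obtain_fourth[OF B])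
  show ?thesis using lindner_blockI(1)[OF w(2), of z \<alpha> Q] w False by (intro bexI) auto
qed

lemma lindner_covers_right_pair:
  assumes B: "is_SQS Q B" and \<alpha>: "bij_betw \<alpha> Q Q" and u: "u \<in> Q" and E: "E \<in> [Q]\<^bsup>2\<^esup>"
  shows "\<exists>b\<in>lindner Q B \<alpha>. {u} <+> E \<subseteq> b"
proof -
  obtain x y where xy: "E = {x, y}" "x \<in> Q" "y \<in> Q" "x \<noteq> y" using E by (rule doubleton_of_nsets_2)
  show ?thesis
  proof (cases "\<alpha> u \<in> E")
    case True
    then obtain y' where y': "E = {\<alpha> u, y'}" "y' \<in> Q" "y' \<noteq> \<alpha> u" using xy by auto
    then obtain u' where u': "u' \<in> Q" "y' = \<alpha> u'" using \<alpha> by (auto simp: bij_betw_def)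
    then have "{u, u'} \<in> [Q]\<^bsup>2\<^esup>" using u y'(3) by auto
    then have "{u, u'} <+> \<alpha> ` {u, u'} \<in> lindner Q B \<alpha>" by (rule lindner_blockI(3))
    then show ?thesis using y'(1) u'(2) by (intro bexI) auto
  next
    case False
    moreover have "\<alpha> u \<in> Q" using \<alpha> u by (auto simp: bij_betw_def)
    ultimately have "insert (\<alpha> u) E \<in> [Q]\<^bsup>3\<^esup>" using xy by simp
    then obtain w where w: "w \<notin> insert (\<alpha> u) E" "insert w (insert (\<alpha> u) E) \<in> B" by (rule is_SQS_obtain_fourth[OF B])
    show ?thesis using lindner_blockI(2)[OF w(2) u, of \<alpha>] w False by (intro bexI) auto
  qed
qed

lemma lindner_covers:
  assumes B: "is_SQS Q B" and \<alpha>: "bij_betw \<alpha> Q Q" and T: "T \<in> [Q <+> Q]\<^bsup>3\<^esup>"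
  shows "\<exists>b\<in>lindner Q B \<alpha>. T \<subseteq> b"
proof -
  have preimage: "\<exists>u\<in>Q. v = \<alpha> u" if "v \<in> Q" for v using \<alpha> that by (auto simp: bij_betw_def)
  from T show ?thesis
  proof (cases rule: nsets_3_Plus_cases)
    case (left A)
    obtain w where w: "w \<notin> A" "insert w A \<in> B" using left(1) by (rule is_SQS_obtain_fourth[OF B])
    show ?thesis using lindner_blockI(1)[OF w(2), of w \<alpha> Q] w left(2) by (intro bexI) auto
  next
    case (left_pair E v)
    obtain z where z: "z \<in> Q" "v = \<alpha> z" using preimage left_pair(2) by blast
    show ?thesis unfolding left_pair(3) z(2) by (rule lindner_covers_left_pair[OF B z(1) left_pair(1)])
  next
    case (right_pair u E)
    show ?thesis unfolding right_pair(3) by (rule lindner_covers_right_pair[OF B \<alpha> right_pair(1,2)])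
  next
    case (right A)
    obtain w where w: "w \<in> Q" "w \<notin> A" "insert w A \<in> B" using right(1) by (rule is_SQS_obtain_fourth[OF B])
    obtain u where u: "u \<in> Q" "w = \<alpha> u" using preimage w(1) by blast
    then show ?thesis using lindner_blockI(2)[OF w(3) u(1), of \<alpha>] u(2) w(2) right(2) by (intro bexI) auto
  qed
qed

lemma is_SQS_lindner:
  assumes B: "is_SQS Q B" and \<alpha>: "bij_betw \<alpha> Q Q"
  shows "is_SQS (Q <+> Q) (lindner Q B \<alpha>)"
proof (rule is_SQS_by_counting)
  have fin: "finite Q" and b4: "\<And>b. b \<in> B \<Longrightarrow> b \<subseteq> Q \<and> card b = 4" using B by (auto simp: is_SQS_def)
  show "finite (Q <+> Q)" using fin by simp
  show "finite (lindner Q B \<alpha>)" by (rule card_lindner_le[OF B \<alpha>])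
  show "\<exists>b\<in>lindner Q B \<alpha>. T \<subseteq> b" if "T \<in> [Q <+> Q]\<^bsup>3\<^esup>" for T by (rule lindner_covers[OF B \<alpha> that])
  have finb: "finite b" if "b \<in> B" for b using b4[OF that] fin finite_subset by blast
  show "finite b \<and> card b \<le> 4" if "b \<in> lindner Q B \<alpha>" for b
  proof -
    have "card (E <+> \<alpha> ` E) \<le> 4 \<and> finite (E <+> \<alpha> ` E)" if "E \<in> [Q]\<^bsup>2\<^esup>" for E
      using that card_image_le[of E \<alpha>] by (auto simp: nsets_def card_Plus)
    then show ?thesis using that finb b4 unfolding lindner_def by (auto simp: card_Plus)
  qed
  have "4 * card (lindner Q B \<alpha>) \<le> 8 * (card Q choose 3) + 4 * (card Q choose 2)"
    using card_lindner_le(2)[OF B \<alpha>] card_is_SQS[OF B] by linarith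
  moreover have "8 * (card Q choose 3) + 4 * (card Q choose 2) = 2 * card Q choose 3"
    using six_times_choose_three[of "card Q"] six_times_choose_three[of "2 * card Q"] two_times_choose_two[of "card Q"]
    by (simp add: algebra_simps)
  moreover have "card (Q <+> Q) = 2 * card Q" using fin by (simp add: card_Plus)
  ultimately show "4 * card (lindner Q B \<alpha>) \<le> card (Q <+> Q) choose 3" by simp
qed

lemma Plus_vimage: "Inl -` (A <+> B) = A"
  by auto

lemma lindner_cases:
  assumes B: "is_SQS Q B" and c: "c \<in> lindner Q B \<alpha>"
  obtains (left) b w where "b \<in> B" "w \<in> b" "c = (b - {w}) <+> {\<alpha> w}" "card (Inl -` c) = 3" "b - {w} \<in> [b]\<^bsup>3\<^esup>"
  | (right) b u where "b \<in> B" "u \<in> Q" "\<alpha> u \<in> b" "c = {u} <+> (b - {\<alpha> u})" "card (Inl -` c) = 1"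
      "b - {\<alpha> u} \<in> [b]\<^bsup>3\<^esup>"
  | (pair) E where "E \<in> [Q]\<^bsup>2\<^esup>" "c = E <+> \<alpha> ` E" "card (Inl -` c) = 2"
proof -
  have triple: "b - {w} \<in> [b]\<^bsup>3\<^esup>" if "b \<in> B" "w \<in> b" for b w
    using B that by (auto simp: is_SQS_def nsets_def card_ge_0_finite)
  from c show thesis unfolding lindner_def
  proof (elim UnE CollectE exE conjE)
    fix b w assume "c = (b - {w}) <+> {\<alpha> w}" "b \<in> B" "w \<in> b"
    then show thesis using left triple by (simp add: Plus_vimage nsets_def)
  next
    fix b u assume "c = {u} <+> (b - {\<alpha> u})" "b \<in> B" "u \<in> Q" "\<alpha> u \<in> b"
    then show thesis using right triple by (simp add: Plus_vimage)
  next
    fix E assume "c = E <+> \<alpha> ` E" "E \<in> [Q]\<^bsup>2\<^esup>"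
    then show thesis using pair by (simp add: Plus_vimage nsets_def)
  qed
qed

lemma lindner_disjoint:
  assumes B: "is_SQS Q B"
    and points: "\<And>x. x \<in> Q \<Longrightarrow> \<alpha> x \<noteq> \<beta> x" and pairs: "\<And>E. E \<in> [Q]\<^bsup>2\<^esup> \<Longrightarrow> \<alpha> ` E \<noteq> \<beta> ` E"
  shows "lindner Q B \<alpha> \<inter> lindner Q B \<beta> = {}"
proof -
  have same: "b = b'" if "b \<in> B" "b' \<in> B" "b - {w} \<in> [b]\<^bsup>3\<^esup>" "b' - {w'} \<in> [b']\<^bsup>3\<^esup>" "b - {w} = b' - {w'}" for b w b' w'
    using exact_coverD_unique[of _ B b b'] B that unfolding is_SQS_iff_exact_cover by metis
  have bQ: "b \<subseteq> Q" if "b \<in> B" for b using B that by (simp add: is_SQS_def)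
  have False if c: "c \<in> lindner Q B \<alpha>" "c \<in> lindner Q B \<beta>" for c
    using B c(1)
  proof (cases rule: lindner_cases)
    case l: (left b w)
    show ?thesis
      using B c(2)
    proof (cases rule: lindner_cases)
      case (left b' w')
      then have eq: "b - {w} = b' - {w'}" "\<alpha> w = \<beta> w'" using l(3) by (auto simp: Plus_eq_iff)
      then have "b = b'" using same[OF l(1) left(1) l(5) left(5)] by simp
      then have "w = w'" using eq(1) l(2) left(2) by blast
      then show ?thesis using eq(2) points[of w] bQ[OF l(1)] l(2) by blast
    qed (use l(4) in simp_all)
  next
    case r: (right b u)
    show ?thesis
      using B c(2)
    proof (cases rule: lindner_cases)
      case (right b' u')
      then have eq: "b - {\<alpha> u} = b' - {\<beta> u'}" "u = u'" using r(4) by (auto simp: Plus_eq_iff)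
      then have "b = b'" using same[OF r(1) right(1) r(6) right(6)] by simp
      then have "\<alpha> u = \<beta> u" using eq r(3) right(3) by blast
      then show ?thesis using points r(2) by blast
    qed (use r(5) in simp_all)
  next
    case p: (pair E)
    show ?thesis
      using B c(2)
    proof (cases rule: lindner_cases)
      case (pair E')
      then show ?thesis using p pairs by (auto simp: Plus_eq_iff)
    qed (use p(3) in simp_all)
  qed
  then show ?thesis by blast
qed

definition doubling :: "'a set \<Rightarrow> 'a set set \<Rightarrow> 'c set \<Rightarrow> ('a \<Rightarrow> 'a \<Rightarrow> 'c) \<Rightarrow> ('c \<Rightarrow> 'c) \<Rightarrow> ('a + 'a) set set" where
  "doubling Q B C \<kappa> \<rho> = (\<lambda>b. b <+> {}) ` B \<union> (\<lambda>b. {} <+> b) ` B \<union>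
     (\<lambda>(E, E'). E <+> E') ` (\<Union>c\<in>C. colour_class Q (\<noteq>) \<kappa> c \<times> colour_class Q (\<noteq>) \<kappa> (\<rho> c))"

lemma card_doubling_le:
  fixes Q :: "'a set"
  assumes B: "is_SQS Q B" and fac: "one_factorization Q (\<noteq>) C \<kappa>" and C: "finite C" and \<rho>: "bij_betw \<rho> C C"
  shows "finite (doubling Q B C \<kappa> \<rho>)" "4 * card (doubling Q B C \<kappa> \<rho>) \<le> 8 * card B + (card Q - 1) * (card Q)\<^sup>2"
proof -
  have fin: "finite Q" "finite B" using B finite_subset[of B "Pow Q"] by (auto simp: is_SQS_def)
  let ?F = "colour_class Q (\<noteq>) \<kappa>"
  let ?X = "\<Union>c\<in>C. ?F c \<times> ?F (\<rho> c)"
  let ?J = "(\<lambda>(E, E'). E <+> E') ` ?X"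
  let ?L = "(\<lambda>b. b <+> {}) ` B :: ('a + 'a) set set" and ?R = "(\<lambda>b. {} <+> b) ` B :: ('a + 'a) set set"
  have finX: "finite ?X" using C fin(1) by (simp add: finite_colour_class)
  then show "finite (doubling Q B C \<kappa> \<rho>)" using fin(2) by (simp add: doubling_def)
  have "4 * card ?X \<le> card C * (card Q)\<^sup>2"
    by (rule card_same_colour_le[OF C]) (use card_colour_class[OF fac fin(1)] \<rho> in \<open>auto simp: bij_betw_def\<close>)
  also have "\<dots> \<le> (card Q - 1) * (card Q)\<^sup>2"
    using card_colours_complete[OF fac] by (cases "Q = {}") simp_all
  finally have "4 * card ?J \<le> (card Q - 1) * (card Q)\<^sup>2" 
    using card_image_le[OF finX, of "\<lambda>(E, E'). E <+> E'"] by linarith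
  moreover have "card ?L \<le> card B" "card ?R \<le> card B" using card_image_le[OF fin(2)] by blast+
  moreover have "card (doubling Q B C \<kappa> \<rho>) \<le> card ?L + card ?R + card ?J"
    using card_Un_le[of "?L \<union> ?R" ?J] card_Un_le[of ?L ?R] unfolding doubling_def by linarith
  ultimately show "4 * card (doubling Q B C \<kappa> \<rho>) \<le> 8 * card B + (card Q - 1) * (card Q)\<^sup>2" by linarith
qed

lemma doubling_covers:
  assumes B: "is_SQS Q B" and fac: "one_factorization Q (\<noteq>) C \<kappa>" and \<rho>: "bij_betw \<rho> C C"
    and T: "T \<in> [Q <+> Q]\<^bsup>3\<^esup>"
  shows "\<exists>b\<in>doubling Q B C \<kappa> \<rho>. T \<subseteq> b"
proof -
  have mixed: "E <+> E' \<in> doubling Q B C \<kappa> \<rho>"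
    if "c \<in> C" "E \<in> colour_class Q (\<noteq>) \<kappa> c" "E' \<in> colour_class Q (\<noteq>) \<kappa> (\<rho> c)" for c E E'
    using that unfolding doubling_def by force
  from T show ?thesis
  proof (cases rule: nsets_3_Plus_cases)
    case (left A)
    then obtain w where "insert w A \<in> B" using is_SQS_obtain_fourth[OF B] by blast
    then have "insert w A <+> {} \<in> doubling Q B C \<kappa> \<rho>" by (simp add: doubling_def)
    then show ?thesis using left(2) by (intro bexI) auto
  next
    case (left_pair E v)
    obtain c where c: "c \<in> C" "E \<in> colour_class Q (\<noteq>) \<kappa> c" by (rule colour_class_completeE[OF fac left_pair(1)])
    moreover have "\<rho> c \<in> C" using \<rho> c(1) by (auto simp: bij_betw_def)
    then obtain e where "e \<in> colour_class Q (\<noteq>) \<kappa> (\<rho> c)" "v \<in> e"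
      by (rule colour_class_obtain_mate[OF fac left_pair(2)])
    ultimately show ?thesis using mixed[of c E e] left_pair(3) by (intro bexI) auto
  next
    case (right_pair u E)
    obtain c' where c': "c' \<in> C" "E \<in> colour_class Q (\<noteq>) \<kappa> c'" by (rule colour_class_completeE[OF fac right_pair(2)])
    then obtain c where c: "c \<in> C" "c' = \<rho> c" using \<rho> by (auto simp: bij_betw_def)
    obtain e where "e \<in> colour_class Q (\<noteq>) \<kappa> c" "u \<in> e"
      by (rule colour_class_obtain_mate[OF fac right_pair(1) c(1)])
    then show ?thesis using mixed[of c e E] c c' right_pair(3) by (intro bexI) auto
  next
    case (right A)
    then obtain w where "insert w A \<in> B" using is_SQS_obtain_fourth[OF B] by blast
    then have "{} <+> insert w A \<in> doubling Q B C \<kappa> \<rho>" by (simp add: doubling_def)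
    then show ?thesis using right(2) by (intro bexI) auto
  qed
qed

lemma doubling_cases:
  assumes B: "is_SQS Q B" and c: "c \<in> doubling Q B C \<kappa> \<rho>"
  obtains (left) b where "b \<in> B" "c = b <+> {}" "card (Inl -` c) = 4"
  | (right) b where "b \<in> B" "c = {} <+> b" "card (Inl -` c) = 0"
  | (mixed) x y u v where "c = {x, y} <+> {u, v}" "{x, y, u, v} \<subseteq> Q" "x \<noteq> y" "u \<noteq> v"
      "\<kappa> x y \<in> C" "\<kappa> u v = \<rho> (\<kappa> x y)" "card (Inl -` c) = 2"
proof -
  have b4: "card b = 4" if "b \<in> B" for b using B that by (simp add: is_SQS_def)
  from c consider b where "b \<in> B" "c = b <+> {}" | b where "b \<in> B" "c = {} <+> b"
    | k E E' where "k \<in> C" "E \<in> colour_class Q (\<noteq>) \<kappa> k" "E' \<in> colour_class Q (\<noteq>) \<kappa> (\<rho> k)" "c = E <+> E'"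
    unfolding doubling_def by (elim UnE imageE; clarsimp)
  then show thesis
  proof cases
    case (1 b)
    then show ?thesis using left[of b] b4 by (simp add: Plus_vimage)
  next
    case (2 b)
    then show ?thesis using right[of b] by (simp add: Plus_vimage)
  next
    case (3 k E E')
    obtain x y where "E = {x, y}" "x \<in> Q" "y \<in> Q" "x \<noteq> y" "\<kappa> x y = k"
      using 3(2) unfolding colour_class_def by blast
    moreover obtain u v where "E' = {u, v}" "u \<in> Q" "v \<in> Q" "u \<noteq> v" "\<kappa> u v = \<rho> k"
      using 3(3) unfolding colour_class_def by blast
    ultimately show ?thesis using mixed[of x y u v] 3(1,4) by (simp add: Plus_vimage)
  qed
qed

lemma is_SQS_doubling:
  assumes B: "is_SQS Q B" and fac: "one_factorization Q (\<noteq>) C \<kappa>" and C: "finite C" and \<rho>: "bij_betw \<rho> C C"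
  shows "is_SQS (Q <+> Q) (doubling Q B C \<kappa> \<rho>)"
proof (rule is_SQS_by_counting)
  let ?v = "card Q"
  have fin: "finite Q" using B by (simp add: is_SQS_def)
  show "finite (Q <+> Q)" using fin by simp
  show "finite (doubling Q B C \<kappa> \<rho>)" by (rule card_doubling_le[OF assms])
  show "\<exists>b\<in>doubling Q B C \<kappa> \<rho>. T \<subseteq> b" if "T \<in> [Q <+> Q]\<^bsup>3\<^esup>" for T by (rule doubling_covers[OF B fac \<rho> that])
  show "finite b \<and> card b \<le> 4" if "b \<in> doubling Q B C \<kappa> \<rho>" for b
    using B that
  proof (cases rule: doubling_cases)
    case (mixed x y u v)
    then show ?thesis by (simp add: card_Plus card_insert_if)
  qed (use B in \<open>auto simp: is_SQS_def card_Plus card_ge_0_finite\<close>)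
  have "4 * card (doubling Q B C \<kappa> \<rho>) \<le> 2 * (?v choose 3) + (?v - 1) * ?v\<^sup>2"
    using card_doubling_le(2)[OF assms] card_is_SQS[OF B] by linarith
  also have "\<dots> = 2 * ?v choose 3"
  proof (cases "?v = 0")
    case False
    have "6 * (2 * int (?v choose 3) + (int ?v - 1) * (int ?v)\<^sup>2) = 6 * int (2 * ?v choose 3)"
      using six_times_choose_three[of ?v] six_times_choose_three[of "2 * ?v"]
      by (simp add: power2_eq_square algebra_simps)
    then have "int (2 * (?v choose 3) + (?v - 1) * ?v\<^sup>2) = int (2 * ?v choose 3)"
      using False by (simp add: of_nat_diff)
    then show ?thesis by (simp only: of_nat_eq_iff)
  qed simp
  finally show "4 * card (doubling Q B C \<kappa> \<rho>) \<le> card (Q <+> Q) choose 3" using fin by (simp add: card_Plus mult_2)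
qed

lemma lindner_doubling_disjoint:
  assumes B: "is_SQS Q B" and A: "is_SQS Q A" and \<alpha>: "bij_betw \<alpha> Q Q" and fac: "one_factorization Q (\<noteq>) C \<kappa>"
    and shift: "\<And>x y. x \<in> Q \<Longrightarrow> y \<in> Q \<Longrightarrow> x \<noteq> y \<Longrightarrow> \<kappa> (\<alpha> x) (\<alpha> y) \<noteq> \<rho> (\<kappa> x y)"
  shows "lindner Q B \<alpha> \<inter> doubling Q A C \<kappa> \<rho> = {}"
proof -
  have False if c: "c \<in> lindner Q B \<alpha>" "c \<in> doubling Q A C \<kappa> \<rho>" for c
    using B c(1)
  proof (cases rule: lindner_cases)
    case (pair E)
    show ?thesis
      using A c(2)
    proof (cases rule: doubling_cases)
      case (mixed x y u v)
      have "E <+> \<alpha> ` E = {x, y} <+> {u, v}" using pair(2) mixed(1) by (simp only:)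
      then have "E = {x, y}" "\<alpha> ` E = {u, v}" unfolding Plus_eq_iff by blast+
      then have "{u, v} = {\<alpha> x, \<alpha> y}" by (metis image_insert image_empty)
      then have "\<kappa> u v = \<kappa> (\<alpha> x) (\<alpha> y)"
        using mixed(2,4) one_factorizationD(3)[OF fac, of u v] by (auto simp: doubleton_eq_iff)
      then show ?thesis using shift[of x y] mixed(2,3,6) by simp
    qed (use pair(3) in simp_all)
  qed (use A c(2) in \<open>cases rule: doubling_cases; simp\<close>)+
  then show ?thesis by blast
qed

lemma doubling_disjoint:
  assumes A: "is_SQS Q A" and A': "is_SQS Q A'" and fac: "one_factorization Q (\<noteq>) C \<kappa>"
    and disj: "A \<inter> A' = {}" and shift: "\<And>c. c \<in> C \<Longrightarrow> \<rho> c \<noteq> \<rho>' c"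
  shows "doubling Q A C \<kappa> \<rho> \<inter> doubling Q A' C \<kappa> \<rho>' = {}"
proof -
  have sym: "\<kappa> x y = \<kappa> x' y'" if "{x, y} = {x', y'}" "x \<in> Q" "y \<in> Q" "x \<noteq> y" for x y x' y'
    using that one_factorizationD(3)[OF fac, of x y] by (auto simp: doubleton_eq_iff)
  have False if c: "c \<in> doubling Q A C \<kappa> \<rho>" "c \<in> doubling Q A' C \<kappa> \<rho>'" for c
    using A c(1)
  proof (cases rule: doubling_cases)
    case l: (left b)
    show ?thesis
      using A' c(2) by (cases rule: doubling_cases) (use l disj in \<open>auto simp: Plus_eq_iff\<close>)
  next
    case r: (right b)
    show ?thesis
      using A' c(2) by (cases rule: doubling_cases) (use r disj in \<open>auto simp: Plus_eq_iff\<close>)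
  next
    case m: (mixed x y u v)
    show ?thesis
      using A' c(2)
    proof (cases rule: doubling_cases)
      case (mixed x' y' u' v')
      then have "{x, y} = {x', y'}" "{u, v} = {u', v'}" using m(1) by (simp_all add: Plus_eq_iff)
      then have "\<kappa> x y = \<kappa> x' y'" "\<kappa> u v = \<kappa> u' v'" using m(2-4) by (auto intro!: sym)
      then show ?thesis using m(5,6) mixed(6) shift by metis
    qed (use m(7) in simp_all)
  qed
  then show ?thesis by blast
qed

lemma has_SQS_double:
  assumes "has_SQS v" "even v"
  shows "has_SQS (2 * v)"
proof -
  let ?Q = "{0..<int v}"
  obtain B where B: "is_SQS ?Q B" using assms(1) has_SQS_iff[of ?Q v] by auto
  obtain \<kappa> where "one_factorization ?Q (\<noteq>) {..<v - 1} \<kappa>" using complete_one_factorization[OF assms(2)] by blast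
  then have "is_SQS (?Q <+> ?Q) (doubling ?Q B {..<v - 1} \<kappa> id)" using B by (intro is_SQS_doubling) simp_all
  then show ?thesis using has_SQS_iff[of "?Q <+> ?Q" "2 * v"] by (auto simp: card_Plus)
qed

section \<open>Candelabra systems\<close>

text \<open>The points \<open>(Some i, x)\<close> form the group \<open>i\<close>, and the points \<open>(None, a)\<close> form the stem. A candelabra system of
  type \<open>(g\<^sup>k : s)\<close> covers exactly the triples that are not contained in the union of a group and the stem.\<close>

definition candelabrum :: "'i set \<Rightarrow> nat \<Rightarrow> nat \<Rightarrow> ('i option \<times> int) set" where
  "candelabrum I g s = Some ` I \<times> {0..<int g} \<union> {None} \<times> {0..<int s}"

definition two_groups :: "'i option set \<Rightarrow> bool" where
  "two_groups L \<longleftrightarrow> (\<exists>i j. i \<noteq> j \<and> Some i \<in> L \<and> Some j \<in> L)"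

definition crossing :: "('i option \<times> int) set \<Rightarrow> ('i option \<times> int) set set" where
  "crossing X = {T \<in> [X]\<^bsup>3\<^esup>. two_groups (fst ` T)}"

definition has_CQS :: "nat \<Rightarrow> nat \<Rightarrow> nat \<Rightarrow> bool" where
  "has_CQS g k s \<longleftrightarrow> (\<exists>\<B>. exact_cover (crossing (candelabrum {..<k} g s)) \<B>)"

lemma crossing_iff:
  "T \<in> crossing X \<longleftrightarrow> T \<subseteq> X \<and> finite T \<and> card T = 3 \<and> two_groups (fst ` T)"
  by (simp add: crossing_def nsets_def)

lemma finite_candelabrum: "finite I \<Longrightarrow> finite (candelabrum I g s)"
  by (simp add: candelabrum_def)

lemma card_candelabrum:
  assumes "finite I"
  shows "card (candelabrum I g s) = card I * g + s"
proof -
  have "card (candelabrum I g s) = card (Some ` I \<times> {0..<int g}) + card ({None :: 'a option} \<times> {0..<int s})"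
    unfolding candelabrum_def using assms by (intro card_Un_disjoint) auto
  then show ?thesis by (simp add: card_cartesian_product card_image)
qed

lemma candelabrum_mono: "I \<subseteq> J \<Longrightarrow> candelabrum I g s \<subseteq> candelabrum J g s"
  by (auto simp: candelabrum_def)

lemma two_groups_map_option:
  assumes "inj_on \<phi> I" "L \<subseteq> insert None (Some ` I)"
  shows "two_groups (map_option \<phi> ` L) \<longleftrightarrow> two_groups L"
proof
  assume "two_groups L"
  then obtain i j where ij: "i \<noteq> j" "Some i \<in> L" "Some j \<in> L" by (auto simp: two_groups_def)
  then have "\<phi> i \<noteq> \<phi> j" using inj_onD[OF assms(1)] assms(2) by auto
  moreover have "Some (\<phi> i) \<in> map_option \<phi> ` L" "Some (\<phi> j) \<in> map_option \<phi> ` L"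
    using imageI[OF ij(2), of "map_option \<phi>"] imageI[OF ij(3), of "map_option \<phi>"] by simp_all
  ultimately show "two_groups (map_option \<phi> ` L)" unfolding two_groups_def by blast
next
  assume "two_groups (map_option \<phi> ` L)"
  then obtain l l' i j where "l \<in> L" "Some i = map_option \<phi> l" "l' \<in> L" "Some j = map_option \<phi> l'" "i \<noteq> j"
    unfolding two_groups_def by blast
  then show "two_groups L" by (cases l; cases l'; simp add: two_groups_def) metis
qed

lemma crossing_image:
  assumes "inj_on \<phi> I"
  defines "h \<equiv> map_prod (map_option \<phi>) id"
  shows "inj_on h (candelabrum I g s)" "(`) h ` crossing (candelabrum I g s) = crossing (candelabrum (\<phi> ` I) g s)"
proof -
  let ?X = "candelabrum I g s"
  show inj: "inj_on h ?X"
  proof (rule inj_onI)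
    fix p q assume "p \<in> ?X" "q \<in> ?X" "h p = h q"
    then show "p = q"
      using inj_onD[OF assms(1)] by (cases "fst p"; cases "fst q") (auto simp: h_def candelabrum_def)
  qed
  have "map_option \<phi> ` Some ` I = Some ` \<phi> ` I" by (simp add: image_image)
  then have im: "h ` ?X = candelabrum (\<phi> ` I) g s"
    by (simp add: h_def candelabrum_def image_Un map_prod_surj_on[OF refl refl])
  have "two_groups (fst ` h ` T) = two_groups (fst ` T)" if "T \<in> [?X]\<^bsup>3\<^esup>" for T
  proof -
    have "fst ` h ` T = map_option \<phi> ` fst ` T" by (simp add: h_def image_image)
    moreover have "fst ` T \<subseteq> insert None (Some ` I)" using that by (auto simp: nsets_def candelabrum_def)
    ultimately show ?thesis using two_groups_map_option[OF assms(1)] by simp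
  qed
  then show "(`) h ` crossing ?X = crossing (candelabrum (\<phi> ` I) g s)"
    unfolding crossing_def im[symmetric] nsets_image[OF inj] by auto
qed

lemma has_CQS_iff:
  assumes "finite I" "card I = k"
  shows "has_CQS g k s \<longleftrightarrow> (\<exists>\<B>. exact_cover (crossing (candelabrum I g s)) \<B>)"
proof -
  have transport: "\<exists>\<B>. exact_cover (crossing (candelabrum (\<phi> ` J) g s)) \<B>"
    if "exact_cover (crossing (candelabrum J g s)) \<B>" "inj_on \<phi> J" for \<B> and J :: "'x set" and \<phi> :: "'x \<Rightarrow> 'y"
  proof -
    have "\<Union>(crossing (candelabrum J g s)) \<subseteq> candelabrum J g s" by (auto simp: crossing_def nsets_def)
    then show ?thesis
      using exact_cover_image[OF that(1) inj_on_subset[OF crossing_image(1)[OF that(2)]]] crossing_image(2)[OF that(2)]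
      by metis
  qed
  obtain \<phi> where \<phi>: "bij_betw \<phi> {..<k} I"
    using ex_bij_betw_nat_finite[OF assms(1)] assms(2) by (auto simp: atLeast0LessThan)
  have \<psi>: "bij_betw (inv_into {..<k} \<phi>) I {..<k}" by (rule bij_betw_inv_into[OF \<phi>])
  show ?thesis unfolding has_CQS_def
  proof
    assume "\<exists>\<B>. exact_cover (crossing (candelabrum {..<k} g s)) \<B>"
    then show "\<exists>\<B>. exact_cover (crossing (candelabrum I g s)) \<B>"
      using transport[of "{..<k}" _ \<phi>] \<phi> by (auto simp: bij_betw_def)
  next
    assume "\<exists>\<B>. exact_cover (crossing (candelabrum I g s)) \<B>"
    then show "\<exists>\<B>. exact_cover (crossing (candelabrum {..<k} g s)) \<B>"
      using transport[of I _ "inv_into {..<k} \<phi>"] \<psi> by (auto simp: bij_betw_def)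
  qed
qed

lemma crossing_cases:
  assumes "T \<in> crossing (candelabrum I g s)"
  obtains (stem) a i x j y where "T = {(None, a), (Some i, x), (Some j, y)}" "{i, j} \<subseteq> I" "i \<noteq> j"
      "a \<in> {0..<int s}" "{x, y} \<subseteq> {0..<int g}"
  | (pair) i x x' j y where "T = {(Some i, x), (Some i, x'), (Some j, y)}" "{i, j} \<subseteq> I" "i \<noteq> j" "x \<noteq> x'"
      "{x, x', y} \<subseteq> {0..<int g}"
  | (transversal) i x j y k z where "T = {(Some i, x), (Some j, y), (Some k, z)}" "{i, j, k} \<subseteq> I" "distinct [i, j, k]"
      "{x, y, z} \<subseteq> {0..<int g}"
proof -
  from assms obtain i x j y where ij: "(Some i, x) \<in> T" "(Some j, y) \<in> T" "i \<noteq> j"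
    by (fastforce simp: crossing_def two_groups_def)
  have T: "card T = 3" "finite T" "T \<subseteq> candelabrum I g s" using assms by (auto simp: crossing_def nsets_def)
  have "card (T - {(Some i, x), (Some j, y)}) = 1" using T(1,2) ij by (simp add: card_Diff_subset)
  then obtain l z where lz: "T - {(Some i, x), (Some j, y)} = {(l, z)}" by (auto simp: card_1_singleton_iff)
  have "T = insert (Some i, x) (insert (Some j, y) (T - {(Some i, x), (Some j, y)}))" using ij(1,2) by blast
  then have eq: "T = {(Some i, x), (Some j, y), (l, z)}" unfolding lz .
  have ne: "(l, z) \<noteq> (Some i, x)" "(l, z) \<noteq> (Some j, y)" using lz by blast+
  have range: "{i, j} \<subseteq> I" "{x, y} \<subseteq> {0..<int g}" using T(3) unfolding eq by (auto simp: candelabrum_def)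
  show thesis
  proof (cases l)
    case None
    then have "z \<in> {0..<int s}" using T(3) unfolding eq by (auto simp: candelabrum_def)
    then show ?thesis using stem[of z i x j y] None eq ij(3) range by (simp add: insert_commute)
  next
    case (Some k)
    then have k: "k \<in> I" "z \<in> {0..<int g}" using T(3) unfolding eq by (auto simp: candelabrum_def)
    consider "k = i" | "k = j" | "distinct [i, j, k]" using ij(3) by auto
    then show ?thesis
    proof cases
      case 1
      then show ?thesis using pair[of i x z j y] Some eq ne ij(3) range k by (simp add: insert_commute)
    next
      case 2
      then show ?thesis using pair[of j y z i x] Some eq ne ij(3) range k by (simp add: insert_commute)
    next
      case 3
      then show ?thesis using transversal[of i x j y k z] Some eq range k by simp
    qed
  qed
qed

lemma nsets_3_candelabrum:
  assumes "I \<noteq> {}"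
  shows "[candelabrum I g s]\<^bsup>3\<^esup> = crossing (candelabrum I g s) \<union>
    ((\<Union>i\<in>I. [candelabrum {i} g s]\<^bsup>3\<^esup> - [{None} \<times> {0..<int s}]\<^bsup>3\<^esup>) \<union> [{None} \<times> {0..<int s}]\<^bsup>3\<^esup>)"
    (is "?L = ?R")
proof
  show "?L \<subseteq> ?R"
  proof
    fix T assume T: "T \<in> ?L"
    show "T \<in> ?R"
    proof (cases "T \<in> crossing (candelabrum I g s)")
      case False
      then have one: "i = j" if "Some i \<in> fst ` T" "Some j \<in> fst ` T" for i j
        using T that by (auto simp: crossing_def two_groups_def)
      have sub: "T \<subseteq> candelabrum I g s" using T by (auto simp: nsets_def)
      obtain i where i: "i \<in> I" "\<And>j. Some j \<in> fst ` T \<Longrightarrow> j = i"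
      proof (cases "\<exists>i. Some i \<in> fst ` T")
        case True
        then obtain i where i: "Some i \<in> fst ` T" by blast
        then have "i \<in> I" using sub by (auto simp: candelabrum_def)
        then show ?thesis using that i one by blast
      qed (use assms that in blast)
      have "T \<subseteq> candelabrum {i} g s"
      proof
        fix p assume "p \<in> T"
        then have "fst p = None \<or> fst p = Some i" "p \<in> candelabrum I g s"
          using i(2) sub by (cases "fst p"; force)+
        then show "p \<in> candelabrum {i} g s" by (cases p) (auto simp: candelabrum_def)
      qed
      then show ?thesis using T i(1) by (auto simp: nsets_def)
    qed simp
  qed
  have "[candelabrum {i} g s]\<^bsup>3\<^esup> \<subseteq> ?L" if "i \<in> I" for i using that by (intro nsets_mono candelabrum_mono) simp
  moreover have "[{None} \<times> {0..<int s}]\<^bsup>3\<^esup> \<subseteq> ?L" by (intro nsets_mono) (auto simp: candelabrum_def)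
  ultimately show "?R \<subseteq> ?L" by (auto simp: crossing_def)
qed

lemma crossing_not_in_group:
  assumes "T \<in> crossing X"
  shows "T \<notin> [candelabrum {i} g s]\<^bsup>3\<^esup>" "T \<notin> [{None} \<times> {0..<int s}]\<^bsup>3\<^esup>"
proof -
  have "i' = i" if "T \<subseteq> candelabrum {i} g s" "Some i' \<in> fst ` T" for i' using that by (auto simp: candelabrum_def)
  then show "T \<notin> [candelabrum {i} g s]\<^bsup>3\<^esup>" using assms unfolding crossing_iff nsets_def two_groups_def by blast
  show "T \<notin> [{None} \<times> {0..<int s}]\<^bsup>3\<^esup>" using assms by (auto simp: crossing_def nsets_def two_groups_def)
qed

lemma card_crossing_ge:
  fixes I :: "'i set"
  assumes "finite I" "card I = k" "k > 0"
  shows "int k * (int k - 1) * (int g)\<^sup>2 * ((int k + 1) * int g + 3 * int s - 3) \<le> 6 * int (card (crossing (candelabrum I g s)))"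
proof -
  let ?S = "{None} \<times> {0..<int s} :: ('i option \<times> int) set" and ?X = "candelabrum I g s"
  let ?H = "\<lambda>i. [candelabrum {i} g s]\<^bsup>3\<^esup> - [?S]\<^bsup>3\<^esup>"
  have "I \<noteq> {}" using assms(2,3) by auto
  have "card (?H i) = (g + s choose 3) - (s choose 3)" for i :: 'i
  proof -
    have "[?S]\<^bsup>3\<^esup> \<subseteq> [candelabrum {i} g s]\<^bsup>3\<^esup>" by (intro nsets_mono) (auto simp: candelabrum_def)
    then show ?thesis
      by (simp add: card_Diff_subset finite_imp_finite_nsets card_candelabrum card_cartesian_product)
  qed
  then have "card (\<Union>i\<in>I. ?H i) \<le> k * ((g + s choose 3) - (s choose 3))"
    using card_UN_le[OF assms(1), of ?H] assms(2) by simp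
  moreover have "card ([?S]\<^bsup>3\<^esup>) = s choose 3" by (simp add: card_cartesian_product)
  moreover have "card ([?X]\<^bsup>3\<^esup>) = k * g + s choose 3" using assms by (simp add: card_candelabrum)
  moreover have "card ([?X]\<^bsup>3\<^esup>) \<le> card (crossing ?X) + (card (\<Union>i\<in>I. ?H i) + card ([?S]\<^bsup>3\<^esup>))"
    unfolding nsets_3_candelabrum[OF \<open>I \<noteq> {}\<close>]
    using card_Un_le[of "crossing ?X" "(\<Union>i\<in>I. ?H i) \<union> [?S]\<^bsup>3\<^esup>"] card_Un_le[of "\<Union>i\<in>I. ?H i" "[?S]\<^bsup>3\<^esup>"]
    by linarith
  ultimately have "k * g + s choose 3 \<le> card (crossing ?X) + k * ((g + s choose 3) - (s choose 3)) + (s choose 3)"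
    by linarith
  moreover have "(s choose 3) \<le> (g + s choose 3)" by (rule binomial_right_mono) simp
  ultimately have "int (k * g + s choose 3) \<le>
      int (card (crossing ?X)) + int k * (int (g + s choose 3) - int (s choose 3)) + int (s choose 3)"
    by (simp flip: of_nat_diff of_nat_add of_nat_mult)
  then have "6 * int (k * g + s choose 3) \<le>
      6 * int (card (crossing ?X)) + int k * (6 * int (g + s choose 3) - 6 * int (s choose 3)) + 6 * int (s choose 3)"
    by (simp add: algebra_simps)
  then show ?thesis unfolding six_times_choose_three by (simp add: power2_eq_square algebra_simps)
qed

lemma has_CQS_by_counting:
  assumes I: "finite I" "card I = k" "k > 0" and "finite \<B>" "\<And>b. b \<in> \<B> \<Longrightarrow> finite b \<and> card b \<le> 4"
    and "\<And>T. T \<in> crossing (candelabrum I g s) \<Longrightarrow> \<exists>b\<in>\<B>. T \<subseteq> b"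
    and count: "24 * int (card \<B>) \<le> int k * (int k - 1) * (int g)\<^sup>2 * ((int k + 1) * int g + 3 * int s - 3)"
  shows "has_CQS g k s"
proof -
  have "4 * card \<B> \<le> card (crossing (candelabrum I g s))" using card_crossing_ge[OF I, of g s] count by linarith
  moreover have "crossing (candelabrum I g s) \<subseteq> [candelabrum I g s]\<^bsup>3\<^esup>" by (auto simp: crossing_def)
  ultimately have "exact_cover (crossing (candelabrum I g s)) \<B>" using assms by (intro exact_cover_by_counting)
  then show ?thesis using has_CQS_iff[OF I(1,2)] by blast
qed

lemma exact_cover_group_Diff_stem:
  fixes i :: 'i
  assumes "has_SQS (g + s)" "s = 2 \<or> s = 4"
  shows "\<exists>\<B>. exact_cover ([candelabrum {i} g s]\<^bsup>3\<^esup> - [{None} \<times> {0..<int s}]\<^bsup>3\<^esup>) \<B>"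
proof -
  let ?S = "{None} \<times> {0..<int s} :: ('i option \<times> int) set"
  have S: "finite ?S" "card ?S = s" by (simp_all add: card_cartesian_product)
  have group: "finite (candelabrum {i} g s)" "card (candelabrum {i} g s) = g + s" "?S \<subseteq> candelabrum {i} g s"
    by (simp_all add: finite_candelabrum card_candelabrum) (auto simp: candelabrum_def)
  from assms(2) show ?thesis
  proof
    assume "s = 2"
    then have "[?S]\<^bsup>3\<^esup> = {}" using S by (intro nsets_eq_empty) simp_all
    then show ?thesis using assms(1) has_SQS_iff[OF group(1,2)] is_SQS_iff_exact_cover by auto
  next
    assume "s = 4"
    then have "card ?S = 4" using S by simp
    then obtain B where "is_SQS (candelabrum {i} g s) B" "?S \<in> B"
      using has_SQS_obtain_block[OF assms(1) group] by blast
    then show ?thesis using exact_cover_Diff_block is_SQS_iff_exact_cover by blast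
  qed
qed

theorem has_CQS_fill:
  assumes "has_CQS g k s" "has_SQS (g + s)" "s = 2 \<or> s = 4" "k > 0"
  shows "has_SQS (k * g + s)"
proof -
  let ?S = "{None} \<times> {0..<int s} :: (nat option \<times> int) set" and ?X = "candelabrum {..<k} g s"
  let ?H = "\<lambda>i. [candelabrum {i} g s]\<^bsup>3\<^esup> - [?S]\<^bsup>3\<^esup>"
  obtain B\<^sub>0 where B\<^sub>0: "exact_cover (crossing ?X) B\<^sub>0" using assms(1) has_CQS_def by blast
  have "finite ?S" "card ?S = s" "has_SQS s"
    using assms(3) has_SQS_2 has_SQS_4 by (auto simp: card_cartesian_product)
  then obtain B\<^sub>2 where B\<^sub>2: "exact_cover ([?S]\<^bsup>3\<^esup>) B\<^sub>2"
    using has_SQS_iff is_SQS_iff_exact_cover by blast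
  have "\<forall>i. \<exists>\<B>. exact_cover (?H i) \<B>" by (intro allI exact_cover_group_Diff_stem assms(2,3))
  then obtain B\<^sub>1 where B\<^sub>1: "\<forall>i. exact_cover (?H i) (B\<^sub>1 i)" by (rule choice[THEN exE])
  have "disjoint_family_on ?H {..<k}"
  proof -
    have "candelabrum {i} g s \<inter> candelabrum {j} g s \<subseteq> ?S" if "i \<noteq> j" for i j
      using that by (auto simp: candelabrum_def)
    then show ?thesis unfolding disjoint_family_on_def nsets_def by blast
  qed
  then have "exact_cover (\<Union>i<k. ?H i) (\<Union>i<k. B\<^sub>1 i)" by (rule exact_cover_UN[OF spec[OF B\<^sub>1]])
  then have "exact_cover ((\<Union>i<k. ?H i) \<union> [?S]\<^bsup>3\<^esup>) ((\<Union>i<k. B\<^sub>1 i) \<union> B\<^sub>2)" using B\<^sub>2 by (rule exact_cover_Un) blast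
  with B\<^sub>0 have "exact_cover (crossing ?X \<union> ((\<Union>i<k. ?H i) \<union> [?S]\<^bsup>3\<^esup>)) (B\<^sub>0 \<union> ((\<Union>i<k. B\<^sub>1 i) \<union> B\<^sub>2))"
    by (rule exact_cover_Un) (auto dest: crossing_not_in_group)
  moreover have "[?X]\<^bsup>3\<^esup> = crossing ?X \<union> ((\<Union>i<k. ?H i) \<union> [?S]\<^bsup>3\<^esup>)"
    by (rule nsets_3_candelabrum) (use assms(4) in auto)
  ultimately have "is_SQS ?X (B\<^sub>0 \<union> ((\<Union>i<k. B\<^sub>1 i) \<union> B\<^sub>2))"
    by (simp only: is_SQS_iff_exact_cover finite_candelabrum finite_lessThan simp_thms)
  then show ?thesis using has_SQS_iff[of ?X "k * g + s"] by (auto simp: card_candelabrum finite_candelabrum)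
qed

definition transversals :: "'a set \<Rightarrow> nat \<Rightarrow> ('a \<times> int) set set" where
  "transversals b g = {T \<in> [b \<times> {0..<int g}]\<^bsup>3\<^esup>. card (fst ` T) = 3}"

lemma graph_in_transversals:
  assumes "t \<in> [b]\<^bsup>3\<^esup>" "f \<in> t \<rightarrow> {0..<int g}"
  shows "(\<lambda>x. (x, f x)) ` t \<in> transversals b g"
proof -
  have "inj_on (\<lambda>x. (x, f x)) t" by (simp add: inj_on_def)
  moreover have "fst ` (\<lambda>x. (x, f x)) ` t = t" by force
  ultimately show ?thesis using assms by (auto simp: transversals_def nsets_def card_image)
qed

lemma card_transversals_ge:
  assumes "card b = 4"
  shows "4 * g ^ 3 \<le> card (transversals b g)"
proof -
  have fb: "finite b" using assms by (simp add: card_ge_0_finite)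
  let ?D = "SIGMA t:[b]\<^bsup>3\<^esup>. t \<rightarrow>\<^sub>E {0..<int g}" and ?graph = "\<lambda>(t, f). (\<lambda>x. (x, f x)) ` t"
  have "inj_on ?graph ?D"
  proof (rule inj_onI, clarify)
    fix t f t' f' assume f: "f \<in> t \<rightarrow>\<^sub>E {0..<int g}" "f' \<in> t' \<rightarrow>\<^sub>E {0..<int g}"
      and eq: "(\<lambda>x. (x, f x)) ` t = (\<lambda>x. (x, f' x)) ` t'"
    have "fst ` (\<lambda>x. (x, f x)) ` t = t" "fst ` (\<lambda>x. (x, f' x)) ` t' = t'" by force+
    then have t: "t = t'" using eq by simp
    have "f x = f' x" if "x \<in> t" for x
    proof -
      have "(x, f x) \<in> (\<lambda>x. (x, f' x)) ` t'" using that eq by blast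
      then show ?thesis by auto
    qed
    then show "t = t' \<and> f = f'" using t f PiE_ext by blast
  qed
  moreover have "?graph ` ?D \<subseteq> transversals b g"
  proof (rule image_subsetI)
    fix p assume "p \<in> ?D"
    then have "fst p \<in> [b]\<^bsup>3\<^esup>" "snd p \<in> fst p \<rightarrow> {0..<int g}" by (auto simp: PiE_def)
    then show "?graph p \<in> transversals b g" using graph_in_transversals by (simp add: case_prod_beta)
  qed
  moreover have "finite (transversals b g)" using fb by (simp add: transversals_def finite_imp_finite_nsets)
  ultimately have "card ?D \<le> card (transversals b g)" by (rule card_inj_on_le)
  moreover have "finite t \<and> card (t \<rightarrow>\<^sub>E {0..<int g}) = g ^ 3" if "t \<in> [b]\<^bsup>3\<^esup>" for t
    using that by (simp add: nsets_def card_PiE)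
  then have "card ?D = (\<Sum>t\<in>[b]\<^bsup>3\<^esup>. g ^ 3)"
    using fb by (subst card_SigmaI) (simp_all add: finite_imp_finite_nsets finite_PiE)
  ultimately show ?thesis using assms by (simp add: eval_nat_numeral)
qed

text \<open>Any three coordinates determine the fourth, since all four sum to \<open>0\<close>.\<close>

lemma transversal_extend:
  assumes b: "card b = 4" and g: "g > 0" and T: "T \<in> transversals b g"
  obtains f where "f ` b \<subseteq> {0..<int g}" "int g dvd (\<Sum>x\<in>b. f x)" "T \<subseteq> (\<lambda>x. (x, f x)) ` b"
proof -
  have fb: "finite b" using b by (simp add: card_ge_0_finite)
  have T3: "T \<in> [b \<times> {0..<int g}]\<^bsup>3\<^esup>" "card (fst ` T) = 3" using T by (auto simp: transversals_def)
  obtain p\<^sub>1 p\<^sub>2 p\<^sub>3 where "T = {p\<^sub>1, p\<^sub>2, p\<^sub>3}" "{p\<^sub>1, p\<^sub>2, p\<^sub>3} \<subseteq> b \<times> {0..<int g}"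
    using T3(1) by (rule nsets_3E) auto
  then obtain x u y v z w where T_eq: "T = {(x, u), (y, v), (z, w)}" "{x, y, z} \<subseteq> b" "{u, v, w} \<subseteq> {0..<int g}"
    by (cases p\<^sub>1, cases p\<^sub>2, cases p\<^sub>3) auto
  then have "distinct [x, y, z]" using T3(2) by (auto simp: card_insert_if split: if_splits)
  then have "card (b - {x, y, z}) = 1" using T_eq(2) b fb by (simp add: card_Diff_subset)
  then obtain r where "b - {x, y, z} = {r}" by (rule card_1_singletonE)
  then have b_eq: "b = {x, y, z, r}" "distinct [x, y, z, r]" using \<open>distinct [x, y, z]\<close> T_eq(2) by auto
  define f where "f = (\<lambda>_. 0 :: int)(x := u, y := v, z := w, r := (- (u + v + w)) mod int g)"
  have "(\<Sum>x\<in>b. f x) = u + v + w + (- (u + v + w)) mod int g" using b_eq by (simp add: f_def)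
  then have "int g dvd (\<Sum>x\<in>b. f x)" by (simp add: dvd_eq_mod_eq_0 mod_add_right_eq)
  moreover have "f ` b \<subseteq> {0..<int g}" using b_eq T_eq(3) g by (auto simp: f_def)
  moreover have "T \<subseteq> (\<lambda>x. (x, f x)) ` b" using T_eq(1) b_eq by (auto simp: f_def)
  ultimately show thesis by (intro that)
qed

lemma exact_cover_transversals:
  fixes b :: "'a set"
  assumes b: "card b = 4" and g: "g > 0"
  shows "\<exists>\<B>. exact_cover (transversals b g) \<B>"
proof -
  have fb: "finite b" using b by (simp add: card_ge_0_finite)
  let ?Z = "{0..<int g}" and ?block = "\<lambda>f :: 'a \<Rightarrow> int. (\<lambda>x. (x, f x)) ` b"
  obtain r where r: "r \<in> b" using b by fastforce
  define t where "t = b - {r}"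
  have t: "finite t" "card t = 3" "b = insert r t" "r \<notin> t" using b fb r by (auto simp: t_def)
  define \<B> where "\<B> = (\<lambda>f. ?block (f(r := (- (\<Sum>x\<in>t. f x)) mod int g))) ` (t \<rightarrow>\<^sub>E ?Z)"
  have block: "?block f \<in> \<B>" if f: "f ` b \<subseteq> ?Z" "int g dvd (\<Sum>x\<in>b. f x)" for f
  proof -
    have "f r mod int g = (- (\<Sum>x\<in>t. f x)) mod int g" using f(2) t by (simp add: mod_eq_dvd_iff)
    then have "f r = (- (\<Sum>x\<in>t. restrict f t x)) mod int g" using f(1) r by auto
    then have "?block f = ?block ((restrict f t)(r := (- (\<Sum>x\<in>t. restrict f t x)) mod int g))"
      using t(3,4) by (intro image_cong) auto
    moreover have "restrict f t \<in> t \<rightarrow>\<^sub>E ?Z" using f(1) t(3) by auto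
    ultimately show ?thesis unfolding \<B>_def by blast
  qed
  have "exact_cover (transversals b g) \<B>"
  proof (rule exact_cover_by_counting)
    show "finite \<B>" unfolding \<B>_def using t(1) by (intro finite_imageI finite_PiE) simp_all
    show "transversals b g \<subseteq> [b \<times> ?Z]\<^bsup>3\<^esup>" by (auto simp: transversals_def)
    show "finite B \<and> card B \<le> 4" if "B \<in> \<B>" for B
      using that fb b card_image_le[OF fb] by (auto simp: \<B>_def)
    have "card \<B> \<le> card (t \<rightarrow>\<^sub>E ?Z)" unfolding \<B>_def using t(1) by (intro card_image_le finite_PiE) simp_all
    then show "4 * card \<B> \<le> card (transversals b g)"
      using card_transversals_ge[OF b, of g] t by (simp add: card_PiE)
    show "\<exists>B\<in>\<B>. T \<subseteq> B" if "T \<in> transversals b g" for T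
      using transversal_extend[OF b g that] block by metis
  qed
  then show ?thesis by blast
qed

definition block_type :: "('i option \<times> int) set \<Rightarrow> 'i option set" where
  "block_type T = (if card (fst ` T) = 3 then fst ` T else insert None (fst ` T))"

lemma block_type_in_nsets_3:
  assumes "T \<in> crossing (candelabrum I g s)"
  shows "block_type T \<in> [insert None (Some ` I)]\<^bsup>3\<^esup>"
proof -
  have "(card (fst ` T) = 3 \<or> card (fst ` T) = 2 \<and> None \<notin> fst ` T) \<and> fst ` T \<subseteq> insert None (Some ` I)"
    using assms by (cases rule: crossing_cases) (auto simp: card_insert_if)
  moreover have "finite (fst ` T)" using assms by (simp add: crossing_iff)
  ultimately show ?thesis by (auto simp: block_type_def nsets_def simp del: finite_imageI)
qed

lemma crossing_of_type_with_stem: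
  assumes "J \<subseteq> I"
  shows "{T \<in> crossing (candelabrum I g s). block_type T \<subseteq> insert None (Some ` J)} = crossing (candelabrum J g s)"
proof -
  have "candelabrum J g s = {p \<in> candelabrum I g s. fst p \<in> insert None (Some ` J)}"
    using assms by (auto simp: candelabrum_def)
  moreover have "block_type T \<subseteq> insert None (Some ` J) \<longleftrightarrow> fst ` T \<subseteq> insert None (Some ` J)" for T
    by (simp add: block_type_def)
  ultimately have "T \<subseteq> candelabrum I g s \<and> block_type T \<subseteq> insert None (Some ` J) \<longleftrightarrow> T \<subseteq> candelabrum J g s" for T
    by auto
  then show ?thesis by (intro set_eqI) (simp only: mem_Collect_eq crossing_iff, blast)
qed

lemma crossing_of_type_without_stem:
  assumes c: "c \<subseteq> Some ` I"
  shows "{T \<in> crossing (candelabrum I g s). block_type T \<subseteq> c} = transversals c g"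
proof (intro set_eqI iffI)
  fix T assume T: "T \<in> {T \<in> crossing (candelabrum I g s). block_type T \<subseteq> c}"
  have "None \<notin> c" using c by blast
  then have types: "card (fst ` T) = 3" "fst ` T \<subseteq> c" using T by (auto simp: block_type_def split: if_splits)
  have "p \<in> c \<times> {0..<int g}" if "p \<in> T" for p
  proof -
    have "p \<in> candelabrum I g s" "fst p \<in> c" using T that types(2) by (auto simp: crossing_iff)
    then show ?thesis using \<open>None \<notin> c\<close> by (cases p) (auto simp: candelabrum_def)
  qed
  then show "T \<in> transversals c g" using T types by (auto simp: transversals_def crossing_iff nsets_def)
next
  fix T assume T: "T \<in> transversals c g"
  then have types: "fst ` T \<subseteq> c" "card (fst ` T) = 3" by (auto simp: transversals_def nsets_def)
  then obtain l l' where l: "l \<in> fst ` T" "l' \<in> fst ` T" "l \<noteq> l'" by (metis card_3_iff insertCI)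
  then have "l \<in> Some ` I" "l' \<in> Some ` I" using types(1) c by (meson in_mono)+
  then obtain i j where "l = Some i" "l' = Some j" by blast
  then have "two_groups (fst ` T)" using l unfolding two_groups_def by blast
  then show "T \<in> {T \<in> crossing (candelabrum I g s). block_type T \<subseteq> c}"
    using T c types by (auto simp: transversals_def nsets_def crossing_iff candelabrum_def block_type_def)
qed

text \<open>The points of the quadruple system become the groups, except for the point \<open>None\<close>, which becomes the stem.\<close>

theorem has_CQS_inflate:
  assumes SQS: "has_SQS v" and CQS: "has_CQS g 3 s" and "g > 0" "v \<ge> 2"
  shows "has_CQS g (v - 1) s"
proof -
  let ?I = "{..<v - 1}" and ?Q = "insert None (Some ` {..<v - 1})" and ?X = "candelabrum {..<v - 1} g s"
  have "card ?Q = v" using assms(4) by (simp add: card_insert_if card_image)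
  then obtain B where B: "is_SQS ?Q B" using SQS has_SQS_iff[of ?Q v] by auto
  have "\<exists>\<B>. exact_cover {T \<in> crossing ?X. block_type T \<subseteq> c} \<B>" if c: "c \<in> B" for c
  proof (cases "None \<in> c")
    case True
    define J where "J = {i. Some i \<in> c}"
    have c_eq: "c = insert None (Some ` J)"
    proof (rule set_eqI)
      fix l show "l \<in> c \<longleftrightarrow> l \<in> insert None (Some ` J)" using True by (cases l) (auto simp: J_def)
    qed
    have J: "J \<subseteq> ?I" using B c by (auto simp: is_SQS_def J_def)
    then have "finite J" using finite_subset by blast
    moreover have "card c = 4" using B c by (simp add: is_SQS_def)
    ultimately have "card J = 3" by (simp add: c_eq card_image card_insert_if)
    then show ?thesis
      unfolding c_eq crossing_of_type_with_stem[OF J] using CQS has_CQS_iff[OF \<open>finite J\<close>] by simp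
  next
    case False
    then have "c \<subseteq> Some ` ?I" "card c = 4" using B c by (auto simp: is_SQS_def)
    then show ?thesis using exact_cover_transversals[OF _ assms(3)] by (simp add: crossing_of_type_without_stem)
  qed
  then show ?thesis
    using exact_cover_pullback[of "[?Q]\<^bsup>3\<^esup>" B "crossing ?X" block_type] B block_type_in_nsets_3[of _ ?I g s]
    by (simp add: is_SQS_iff_exact_cover has_CQS_def)
qed

section \<open>Quadrupling\<close>

lemma mod_diff_diff: "y \<in> {0..<g} \<Longrightarrow> (c - (c - y) mod g) mod g = y" for c y g :: int
  by (simp add: mod_diff_right_eq)

locale quadrupling =
  fixes g :: nat and m :: int and C :: "'c set" and \<kappa> :: "int \<Rightarrow> int \<Rightarrow> 'c"
  assumes m: "int g = 2 * m" "m > 0" and fac: "one_factorization {0..<int g} (\<noteq>) C \<kappa>" and fin: "finite C"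
begin

abbreviation "Z \<equiv> {0..<int g}"

text \<open>A permutation of the integers modulo \<open>g\<close> that maps the two numbers \<open>2 k\<close> and \<open>2 k + 1\<close> to the two
  solutions \<open>w\<close> of \<open>2 w = 2 k\<close>.\<close>

definition halve :: "int \<Rightarrow> int" where
  "halve z = z div 2 + (z mod 2) * m"

definition sister_blocks :: "((bool \<times> bool) option \<times> int) set set" where
  "sister_blocks = (\<lambda>(h, E, E'). {Some (h, False)} \<times> E \<union> {Some (h, True)} \<times> E') `
     (UNIV \<times> (\<Union>c\<in>C. colour_class Z (\<noteq>) \<kappa> c \<times> colour_class Z (\<noteq>) \<kappa> c))"

definition pair_blocks :: "((bool \<times> bool) option \<times> int) set set" where
  "pair_blocks = (\<lambda>(h, e, E, x). {(Some (h, False), x), (Some (h, True), ((\<Sum>z\<in>E. halve z) - of_bool e - x) mod int g)} \<union>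
     {Some (\<not> h, e)} \<times> E) ` (UNIV \<times> UNIV \<times> [Z]\<^bsup>2\<^esup> \<times> Z)"

definition stem_blocks :: "((bool \<times> bool) option \<times> int) set set" where
  "stem_blocks = (\<lambda>(h, e, z, x). {(None, of_bool (odd (x + z) \<noteq> h)), (Some (h, False), x),
     (Some (h, True), (2 * halve z - of_bool e - x) mod int g), (Some (\<not> h, e), z)}) ` (UNIV \<times> UNIV \<times> Z \<times> Z)"

lemma halve_surj:
  assumes "y \<in> Z"
  obtains z where "z \<in> Z" "halve z = y"
proof
  have "(2 * (y - m) + 1) div 2 = y - m" "(2 * (y - m) + 1) mod 2 = 1" by presburger+
  then show "halve (if y < m then 2 * y else 2 * (y - m) + 1) = y" by (simp add: halve_def)
  show "(if y < m then 2 * y else 2 * (y - m) + 1) \<in> Z" using assms m by auto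
qed

lemma double_halve_solve:
  assumes "even c"
  obtains z where "z \<in> Z" "(2 * halve z) mod int g = c mod int g" "odd z = b"
proof
  define k where "k = (c div 2) mod m"
  have k: "0 \<le> k" "k < m" using m(2) by (simp_all add: k_def)
  let ?z = "2 * k + of_bool b"
  show "?z \<in> Z" using k m(1) by (cases b) auto
  show "odd ?z = b" by simp
  have "2 * halve ?z = 2 * k + int g * of_bool b" using m(1) by (cases b) (simp_all add: halve_def algebra_simps)
  then have "(2 * halve ?z) mod int g = (2 * k) mod int g" by simp
  also have "\<dots> = (2 * (c div 2)) mod int g" unfolding m(1) k_def by (simp add: mod_mult_mult1)
  finally show "(2 * halve ?z) mod int g = c mod int g" using assms by simp
qed

lemma sister_covered:
  assumes "x \<in> Z" "x' \<in> Z" "x \<noteq> x'" "y \<in> Z"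
  shows "\<exists>b\<in>sister_blocks. {(Some (h, e), x), (Some (h, e), x'), (Some (h, \<not> e), y)} \<subseteq> b"
proof -
  have "{x, x'} \<in> [Z]\<^bsup>2\<^esup>" using assms by simp
  then obtain c where c: "c \<in> C" "{x, x'} \<in> colour_class Z (\<noteq>) \<kappa> c" by (rule colour_class_completeE[OF fac])
  obtain F where F: "F \<in> colour_class Z (\<noteq>) \<kappa> c" "y \<in> F" by (rule colour_class_obtain_mate[OF fac assms(4) c(1)])
  have block: "{Some (h, False)} \<times> E \<union> {Some (h, True)} \<times> E' \<in> sister_blocks"
    if "E \<in> colour_class Z (\<noteq>) \<kappa> c" "E' \<in> colour_class Z (\<noteq>) \<kappa> c" for E E'
    using that c(1) unfolding sister_blocks_def by (intro image_eqI[of _ _ "(h, E, E')"]) auto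
  show ?thesis
  proof (cases e)
    case True
    then show ?thesis using block[OF F(1) c(2)] F(2) by (intro bexI) auto
  next
    case False
    then show ?thesis using block[OF c(2) F(1)] F(2) by (intro bexI) auto
  qed
qed

lemma pair_blockI:
  assumes "z \<in> Z" "z' \<in> Z" "z \<noteq> z'" "x \<in> Z"
  shows "{(Some (h, False), x), (Some (h, True), (halve z + halve z' - of_bool e - x) mod int g),
    (Some (\<not> h, e), z), (Some (\<not> h, e), z')} \<in> pair_blocks"
  unfolding pair_blocks_def using assms by (intro image_eqI[of _ _ "(h, e, {z, z'}, x)"]) auto

lemma stem_blockI:
  assumes "z \<in> Z" "x \<in> Z"
  shows "{(None, of_bool (odd (x + z) \<noteq> h)), (Some (h, False), x),
    (Some (h, True), (2 * halve z - of_bool e - x) mod int g), (Some (\<not> h, e), z)} \<in> stem_blocks"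
  unfolding stem_blocks_def using assms by (intro image_eqI[of _ _ "(h, e, z, x)"]) auto

lemma pair_covered:
  assumes "z \<in> Z" "z' \<in> Z" "z \<noteq> z'" "y \<in> Z"
  shows "\<exists>b\<in>pair_blocks. {(Some (h, e), z), (Some (h, e), z'), (Some (\<not> h, e'), y)} \<subseteq> b"
proof (cases e')
  case True
  let ?x = "(halve z + halve z' - of_bool e - y) mod int g"
  have "?x \<in> Z" using m by simp
  moreover have "(halve z + halve z' - of_bool e - ?x) mod int g = y" using assms(4) by (rule mod_diff_diff)
  ultimately show ?thesis using pair_blockI[OF assms(1-3), of ?x "\<not> h" e] True by (intro bexI) auto
next
  case False
  then show ?thesis using pair_blockI[OF assms, of "\<not> h" e] by (intro bexI) auto
qed

lemma sisters_covered:
  assumes "x \<in> Z" "y \<in> Z" "z \<in> Z"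
  shows "\<exists>b\<in>pair_blocks \<union> stem_blocks. {(Some (h, False), x), (Some (h, True), y), (Some (\<not> h, e), z)} \<subseteq> b"
proof -
  have "(x + y + of_bool e - halve z) mod int g \<in> Z" using m by simp
  then obtain z' where z': "z' \<in> Z" "halve z' = (x + y + of_bool e - halve z) mod int g" by (rule halve_surj)
  have "(halve z + halve z' - of_bool e - x) mod int g = y mod int g"
  proof -
    have "(halve z + halve z' - of_bool e - x) mod int g
        = ((x + y + of_bool e - halve z) mod int g + (halve z - of_bool e - x)) mod int g"
      unfolding z'(2) by (simp add: algebra_simps)
    also have "\<dots> = y mod int g" unfolding mod_add_left_eq by simp
    finally show ?thesis .
  qed
  then have y: "(halve z + halve z' - of_bool e - x) mod int g = y" using assms(2) by simp
  show ?thesis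
  proof (cases "z = z'")
    case True
    then have "(2 * halve z - of_bool e - x) mod int g = y" using y by simp
    then show ?thesis using stem_blockI[OF assms(3,1), of h e] by (intro bexI[rotated, OF UnI2]) auto
  next
    case False
    then show ?thesis using pair_blockI[OF assms(3) z'(1) False assms(1), of h e] y by (intro bexI[rotated, OF UnI1]) auto
  qed
qed

lemma stem_sisters_covered:
  assumes "a \<in> {0, 1}" "x \<in> Z" "y \<in> Z"
  shows "\<exists>b\<in>stem_blocks. {(None, a), (Some (h, False), x), (Some (h, True), y)} \<subseteq> b"
proof -
  define e where "e = odd (x + y)"
  have "even (x + y + of_bool e)" by (simp add: e_def)
  then obtain z where z: "z \<in> Z" "(2 * halve z) mod int g = (x + y + of_bool e) mod int g"
    "odd z = ((odd x \<noteq> (a = 1)) \<noteq> h)" by (rule double_halve_solve)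
  have "(2 * halve z - of_bool e - x) mod int g = (x + y + of_bool e - of_bool e - x) mod int g"
    using z(2) by (metis mod_diff_left_eq)
  then have "(2 * halve z - of_bool e - x) mod int g = y" using assms(3) by simp
  moreover have "of_bool (odd (x + z) \<noteq> h) = a" using z(3) assms(1) by auto
  ultimately show ?thesis using stem_blockI[OF z(1) assms(2), of h e] by (intro bexI) auto
qed

lemma stem_halves_covered:
  assumes "a \<in> {0, 1}" "x \<in> Z" "z \<in> Z"
  shows "\<exists>b\<in>stem_blocks. {(None, a), (Some (h, e), x), (Some (\<not> h, e'), z)} \<subseteq> b"
proof -
  text \<open>The parity condition holds for exactly one of the two ways to order the two points.\<close>
  have covered: "\<exists>b\<in>stem_blocks. {(None, a), (Some (h, e), x), (Some (\<not> h, e'), z)} \<subseteq> b"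
    if "x \<in> Z" "z \<in> Z" "a = of_bool (((odd x \<noteq> odd z) \<noteq> (e \<and> e')) \<noteq> h)" for h e x e' z
  proof (cases e)
    case True
    let ?x = "(2 * halve z - of_bool e' - x) mod int g"
    have "?x \<in> Z" using m by simp
    moreover have "odd ?x = (odd x \<noteq> e')" using m by (simp add: dvd_mod_iff)
    then have "of_bool (odd (?x + z) \<noteq> h) = a" using that(3) True by auto
    moreover have "(2 * halve z - of_bool e' - ?x) mod int g = x" using that(1) by (rule mod_diff_diff)
    ultimately show ?thesis using stem_blockI[OF that(2), of ?x h e'] True by (intro bexI) auto
  next
    case False
    then have "of_bool (odd (x + z) \<noteq> h) = a" using that(3) by auto
    then show ?thesis using stem_blockI[OF that(2,1), of h e'] False by (intro bexI) auto
  qed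
  show ?thesis
  proof (cases "a = of_bool (((odd x \<noteq> odd z) \<noteq> (e \<and> e')) \<noteq> h)")
    case True
    show ?thesis by (rule covered[OF assms(2,3) True])
  next
    case False
    then have "a = of_bool (((odd z \<noteq> odd x) \<noteq> (e' \<and> e)) \<noteq> (\<not> h))" using assms(1) by auto
    then have "\<exists>b\<in>stem_blocks. {(None, a), (Some (\<not> h, e'), z), (Some (\<not> \<not> h, e), x)} \<subseteq> b"
      by (rule covered[OF assms(3,2)])
    then show ?thesis by (simp only: not_not insert_commute)
  qed
qed

lemma three_groups_covered:
  assumes "x \<in> Z" "y \<in> Z" "z \<in> Z" "distinct [i, j, k]"
  shows "\<exists>b\<in>pair_blocks \<union> stem_blocks. {(Some i, x), (Some j, y), (Some k, z)} \<subseteq> b"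
proof -
  have covered: "\<exists>b\<in>pair_blocks \<union> stem_blocks. {(Some (h, e), x), (Some (h, \<not> e), y), (Some (\<not> h, e'), z)} \<subseteq> b"
    if "x \<in> Z" "y \<in> Z" "z \<in> Z" for h e e' x y z
    using sisters_covered[OF that, of h e'] sisters_covered[OF that(2,1,3), of h e'] by (cases e) (simp_all add: insert_commute)
  obtain h e h' e' h'' e'' where ijk: "i = (h, e)" "j = (h', e')" "k = (h'', e'')" by (cases i, cases j, cases k)
  consider "h' = h" "e' = (\<not> e)" "h'' = (\<not> h)" | "h'' = h" "e'' = (\<not> e)" "h' = (\<not> h)"
    | "h'' = h'" "e'' = (\<not> e')" "h = (\<not> h')" using assms(4) ijk by auto
  then show ?thesis
  proof cases
    case 1
    then show ?thesis using covered[OF assms(1,2,3), of h e e''] ijk by simp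
  next
    case 2
    then show ?thesis using covered[OF assms(1,3,2), of h e e'] ijk by (simp add: insert_commute)
  next
    case 3
    then show ?thesis using covered[OF assms(2,3,1), of h' e' e] ijk by (simp add: insert_commute)
  qed
qed

lemma crossing_covered:
  assumes "T \<in> crossing (candelabrum UNIV g 2)"
  shows "\<exists>b\<in>sister_blocks \<union> pair_blocks \<union> stem_blocks. T \<subseteq> b"
  using assms
proof (cases rule: crossing_cases)
  case (stem a i x j y)
  obtain h e h' e' where ij: "i = (h, e)" "j = (h', e')" by (cases i, cases j)
  have r: "a \<in> {0, 1}" "x \<in> Z" "y \<in> Z" using stem by auto
  consider "h' = h" "e' = (\<not> e)" | "h' = (\<not> h)" using stem(3) ij by auto
  then show ?thesis
  proof cases
    case 1
    then show ?thesis
      using stem_sisters_covered[OF r, of h] stem_sisters_covered[OF r(1,3,2), of h] stem(1) ij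
      by (cases e) (auto simp: insert_commute)
  next
    case 2
    then show ?thesis using stem_halves_covered[OF r, of h e e'] stem(1) ij by auto
  qed
next
  case (pair i x x' j y)
  obtain h e h' e' where ij: "i = (h, e)" "j = (h', e')" by (cases i, cases j)
  consider "h' = h" "e' = (\<not> e)" | "h' = (\<not> h)" using pair(3) ij by auto
  then show ?thesis
    by cases (use sister_covered[of x x' y h e] pair_covered[of x x' y h e e'] pair ij in auto)
next
  case (transversal i x j y k z)
  then show ?thesis using three_groups_covered[of x y z i j k] by auto
qed

lemma blocks_card_le:
  assumes "b \<in> sister_blocks \<union> pair_blocks \<union> stem_blocks"
  shows "finite b \<and> card b \<le> 4"
proof -
  have product: "finite ({l} \<times> E) \<and> card ({l} \<times> E) = 2" if "E \<in> [Z]\<^bsup>2\<^esup>" for E and l :: "(bool \<times> bool) option"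
    using that by (simp add: nsets_def card_cartesian_product)
  have edges: "colour_class Z (\<noteq>) \<kappa> c \<subseteq> [Z]\<^bsup>2\<^esup>" for c by (rule colour_class_subset_nsets[OF fac])
  from assms show ?thesis
  proof (elim UnE)
    assume "b \<in> sister_blocks"
    then obtain h c E E' where "b = {Some (h, False)} \<times> E \<union> {Some (h, True)} \<times> E'"
      "E \<in> colour_class Z (\<noteq>) \<kappa> c" "E' \<in> colour_class Z (\<noteq>) \<kappa> c" unfolding sister_blocks_def by auto
    moreover from this have "E \<in> [Z]\<^bsup>2\<^esup>" "E' \<in> [Z]\<^bsup>2\<^esup>" using edges[of c] by (simp_all add: in_mono)
    ultimately show ?thesis using product[of E "Some (h, False)"] product[of E' "Some (h, True)"]
        card_Un_le[of "{Some (h, False)} \<times> E" "{Some (h, True)} \<times> E'"] by simp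
  next
    assume "b \<in> pair_blocks"
    then obtain h e E x y where b: "b = {(Some (h, False), x), (Some (h, True), y)} \<union> {Some (\<not> h, e)} \<times> E"
      "E \<in> [Z]\<^bsup>2\<^esup>" unfolding pair_blocks_def by auto
    then show ?thesis
      using product[of E "Some (\<not> h, e)"] card_Un_le[of "{(Some (h, False), x), (Some (h, True), y)}" "{Some (\<not> h, e)} \<times> E"] by simp
  next
    assume "b \<in> stem_blocks"
    then show ?thesis unfolding stem_blocks_def by (auto simp: card_insert_if)
  qed
qed

lemma card_blocks:
  shows "finite (sister_blocks \<union> pair_blocks \<union> stem_blocks)"
    "4 * int (card (sister_blocks \<union> pair_blocks \<union> stem_blocks)) \<le> (10 * int g + 6) * (int g)\<^sup>2"
proof -
  let ?P = "UNIV \<times> UNIV \<times> [Z]\<^bsup>2\<^esup> \<times> Z :: (bool \<times> bool \<times> int set \<times> int) set"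
  let ?M = "\<Union>c\<in>C. colour_class Z (\<noteq>) \<kappa> c \<times> colour_class Z (\<noteq>) \<kappa> c"
  have "Z \<noteq> {}" using m by simp
  then have C: "int (card C) = int g - 1" using card_colours_complete[OF fac] m by simp
  have finM: "finite ?M" using fin by (simp add: finite_colour_class)
  have finP: "finite ?P" by (simp add: finite_imp_finite_nsets)
  show "finite (sister_blocks \<union> pair_blocks \<union> stem_blocks)"
    unfolding sister_blocks_def pair_blocks_def stem_blocks_def
    by (intro finite_UnI finite_imageI finite_cartesian_product finM) (simp_all add: finite_imp_finite_nsets)
  have "card sister_blocks \<le> 2 * card ?M"
    unfolding sister_blocks_def using finM
    by (intro order_trans[OF card_image_le]) (simp_all add: card_cartesian_product card_UNIV_bool)
  moreover have "4 * card ?M \<le> card C * g\<^sup>2"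
    using card_same_colour_le[OF fin, of "colour_class Z (\<noteq>) \<kappa>" g "colour_class Z (\<noteq>) \<kappa>"] card_colour_class[OF fac] by simp
  ultimately have "4 * card sister_blocks \<le> 2 * (card C * g\<^sup>2)" by linarith
  then have "int (4 * card sister_blocks) \<le> int (2 * (card C * g\<^sup>2))" by (simp only: of_nat_le_iff)
  then have "4 * int (card sister_blocks) \<le> 2 * ((int g - 1) * (int g)\<^sup>2)" by (simp add: C)
  moreover have "4 * int (card pair_blocks) \<le> 8 * (int g - 1) * (int g)\<^sup>2"
  proof -
    have "card pair_blocks \<le> 4 * ((g choose 2) * g)"
      unfolding pair_blocks_def using card_image_le[OF finP] by (simp add: card_cartesian_product card_UNIV_bool)
    then have "4 * int (card pair_blocks) \<le> 8 * (2 * int (g choose 2)) * int g"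
      by (simp add: algebra_simps flip: of_nat_mult)
    then show ?thesis unfolding two_times_choose_two by (simp add: power2_eq_square algebra_simps)
  qed
  moreover have "card stem_blocks \<le> 4 * g\<^sup>2"
    unfolding stem_blocks_def
    by (intro order_trans[OF card_image_le]) (simp_all add: card_cartesian_product card_UNIV_bool power2_eq_square)
  then have "4 * int (card stem_blocks) \<le> 16 * (int g)\<^sup>2" by (simp flip: of_nat_power)
  moreover have "card (sister_blocks \<union> pair_blocks \<union> stem_blocks) \<le> card sister_blocks + card pair_blocks + card stem_blocks"
    using card_Un_le[of "sister_blocks \<union> pair_blocks" stem_blocks] card_Un_le[of sister_blocks pair_blocks] by linarith
  ultimately show "4 * int (card (sister_blocks \<union> pair_blocks \<union> stem_blocks)) \<le> (10 * int g + 6) * (int g)\<^sup>2"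
    by (simp add: algebra_simps)
qed

theorem has_CQS_4_2: "has_CQS g 4 2"
proof (rule has_CQS_by_counting[where I = "UNIV :: (bool \<times> bool) set"])
  show "card (UNIV :: (bool \<times> bool) set) = 4" by (simp add: card_cartesian_product card_UNIV_bool flip: UNIV_Times_UNIV)
  show "24 * int (card (sister_blocks \<union> pair_blocks \<union> stem_blocks))
      \<le> int 4 * (int 4 - 1) * (int g)\<^sup>2 * ((int 4 + 1) * int g + 3 * int 2 - 3)"
    using card_blocks(2) by (simp add: algebra_simps)
qed (use card_blocks(1) blocks_card_le crossing_covered in simp_all)

end

theorem has_CQS_quadruple:
  assumes "even g" "g > 0"
  shows "has_CQS g 4 2"
proof -
  obtain \<kappa> where "one_factorization {0..<int g} (\<noteq>) {..<g - 1} \<kappa>" using complete_one_factorization[OF assms(1)] by blast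
  then interpret quadrupling g "int g div 2" "{..<g - 1}" \<kappa> by unfold_locales (use assms in auto)
  show ?thesis by (rule has_CQS_4_2)
qed

section \<open>Tripling\<close>

definition graph :: "(nat \<Rightarrow> int) \<Rightarrow> (nat option \<times> int) set" where
  "graph c = (\<lambda>i. (Some i, c i)) ` {..<3}"

definition layer :: "nat \<Rightarrow> int \<Rightarrow> (nat \<Rightarrow> int) set" where
  "layer g \<sigma> = {c \<in> {..<3} \<rightarrow>\<^sub>E {0..<int g}. (\<Sum>i<3. c i) mod int g = \<sigma>}"

lemma lessThan_3: "{..<3 :: nat} = {0, 1, 2}"
  by auto

lemma graph_eq: "graph c = {(Some 0, c 0), (Some 1, c 1), (Some 2, c 2)}"
  by (simp add: graph_def lessThan_3)

lemma third_index:
  assumes "i < 3" "j < 3" "i \<noteq> j"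
  obtains k :: nat where "k < 3" "k \<noteq> i" "k \<noteq> j" "{..<3} = {i, j, k}"
proof (rule that)
  show "3 - i - j < 3" "3 - i - j \<noteq> i" "3 - i - j \<noteq> j" "{..<3} = {i, j, 3 - i - j}"
    using assms by (auto simp: less_Suc_eq numeral_3_eq_3)
qed

lemma layer_coordinate:
  assumes "c \<in> layer g \<sigma>" "i < 3"
  shows "c i \<in> {0..<int g}"
proof -
  have "c \<in> {..<3} \<rightarrow>\<^sub>E {0..<int g}" using assms(1) by (simp add: layer_def)
  then show ?thesis by (rule PiE_mem) (use assms(2) in simp)
qed

lemma card_layer_le: "finite (layer g \<sigma>)" "card (layer g \<sigma>) \<le> g\<^sup>2"
proof -
  show "finite (layer g \<sigma>)" unfolding layer_def by (simp add: finite_PiE)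
  have "inj_on (\<lambda>c. (c 0, c 1)) (layer g \<sigma>)"
  proof (rule inj_onI)
    fix c c' assume c: "c \<in> layer g \<sigma>" "c' \<in> layer g \<sigma>" "(c 0, c 1) = (c' 0, c' 1)"
    have third: "c 2 = (\<sigma> - c 0 - c 1) mod int g" if "c \<in> layer g \<sigma>" for c
    proof -
      have "c 2 \<in> {0..<int g}" by (rule layer_coordinate[OF that]) simp
      then have "c 2 = ((\<Sum>i<3. c i) - (c 0 + c 1)) mod int g" by (simp add: lessThan_3)
      also have "\<dots> = ((\<Sum>i<3. c i) mod int g - (c 0 + c 1)) mod int g" by (rule mod_diff_left_eq[symmetric])
      finally show ?thesis using that by (simp add: layer_def algebra_simps)
    qed
    have "c 0 = c' 0" "c 1 = c' 1" using c(3) by simp_all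
    moreover from this have "c 2 = c' 2" using third[OF c(1)] third[OF c(2)] by simp
    ultimately have "c i = c' i" if "i < 3" for i using that by (cases "i = 0 \<or> i = 1 \<or> i = 2") auto
    then show "c = c'" using c(1,2) by (intro PiE_ext) (auto simp: layer_def)
  qed
  moreover have "(\<lambda>c. (c 0, c 1)) ` layer g \<sigma> \<subseteq> {0..<int g} \<times> {0..<int g}"
    using layer_coordinate by (intro image_subsetI SigmaI) simp_all
  ultimately have "card (layer g \<sigma>) \<le> card ({0..<int g} \<times> {0..<int g})" by (rule card_inj_on_le) simp
  then show "card (layer g \<sigma>) \<le> g\<^sup>2" by (simp add: card_cartesian_product power2_eq_square)
qed

lemma layer_completion:
  assumes "i < 3" "j < 3" "i \<noteq> j" "x \<in> {0..<int g}" "y \<in> {0..<int g}" "\<sigma> \<in> {0..<int g}"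
  obtains c where "c \<in> layer g \<sigma>" "c i = x" "c j = y"
proof -
  obtain k where k: "k < 3" "k \<noteq> i" "k \<noteq> j" "{..<3} = {i, j, k}" using assms(1-3) by (rule third_index)
  define c where "c = (\<lambda>l\<in>{..<3}. if l = i then x else if l = j then y else (\<sigma> - x - y) mod int g)"
  have "(\<Sum>l<3. c l) = c i + c j + c k" using k assms(3) by simp
  also have "\<dots> = x + y + (\<sigma> - x - y) mod int g" using k assms(1-3) by (simp add: c_def)
  also have "\<dots> mod int g = \<sigma>" using assms(6) by (simp add: mod_add_right_eq)
  finally have "(\<Sum>l<3. c l) mod int g = \<sigma>" .
  moreover have "c \<in> {..<3} \<rightarrow>\<^sub>E {0..<int g}" using assms(4-6) by (auto simp: c_def)
  ultimately show thesis using that[of c] assms by (simp add: layer_def c_def)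
qed

definition mate_blocks :: "nat \<Rightarrow> nat \<Rightarrow> (nat \<Rightarrow> int \<Rightarrow> int \<Rightarrow> bool) \<Rightarrow> (nat \<Rightarrow> int \<Rightarrow> int \<Rightarrow> nat) \<Rightarrow> (nat option \<times> int) set set" where
  "mate_blocks g n E \<kappa> = (\<Union>(i, j)\<in>{(0, 1), (0, 2), (1, 2)}. (\<lambda>(F, G). {Some i} \<times> F \<union> {Some j} \<times> G) `
     (\<Union>c<n. colour_class {0..<int g} (E i) (\<kappa> i) c \<times> colour_class {0..<int g} (E j) (\<kappa> j) c))"

lemma card_mate_blocks_le:
  assumes "\<And>i. i < 3 \<Longrightarrow> one_factorization {0..<int g} (E i) {..<n} (\<kappa> i)"
  shows "finite (mate_blocks g n E \<kappa>)" "4 * card (mate_blocks g n E \<kappa>) \<le> 3 * n * g\<^sup>2"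
    "b \<in> mate_blocks g n E \<kappa> \<Longrightarrow> finite b \<and> card b \<le> 4"
proof -
  let ?F = "\<lambda>i c. colour_class {0..<int g} (E i) (\<kappa> i) c"
  let ?M = "\<lambda>i j. (\<lambda>(F, G). {Some i} \<times> F \<union> {Some j} \<times> G) ` (\<Union>c<n. ?F i c \<times> ?F j c)"
  have fin: "finite (?F i c)" for i c by (rule finite_colour_class) simp
  then show "finite (mate_blocks g n E \<kappa>)" unfolding mate_blocks_def by auto
  have "4 * card (?M i j) \<le> n * g\<^sup>2" if "i < 3" "j < 3" for i j
  proof -
    have "card (?M i j) \<le> card (\<Union>c<n. ?F i c \<times> ?F j c)" using fin by (intro card_image_le) auto
    also have "4 * \<dots> \<le> card {..<n} * g\<^sup>2"
      by (rule card_same_colour_le) (use card_colour_class[OF assms] that in simp_all)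
    finally show ?thesis by simp
  qed
  from this[of 0 1] this[of 0 2] this[of 1 2] show "4 * card (mate_blocks g n E \<kappa>) \<le> 3 * n * g\<^sup>2"
    unfolding mate_blocks_def
    using card_Un_le[of "?M 0 1" "?M 0 2 \<union> ?M 1 2"] card_Un_le[of "?M 0 2" "?M 1 2"] by simp
  assume "b \<in> mate_blocks g n E \<kappa>"
  then obtain i j c F G where b: "b = {Some i} \<times> F \<union> {Some j} \<times> G" "F \<in> ?F i c" "G \<in> ?F j c" "i < 3" "j < 3"
    unfolding mate_blocks_def by auto
  then have "F \<in> [{0..<int g}]\<^bsup>2\<^esup>" "G \<in> [{0..<int g}]\<^bsup>2\<^esup>" using colour_class_subset_nsets[OF assms] by blast+
  then show "finite b \<and> card b \<le> 4"
    using card_Un_le[of "{Some i} \<times> F" "{Some j} \<times> G"] b(1) by (simp add: nsets_def card_cartesian_product)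
qed

lemma mate_blocks_cover:
  assumes fac: "\<And>i. i < 3 \<Longrightarrow> one_factorization {0..<int g} (E i) {..<n} (\<kappa> i)"
    and ij: "i < 3" "j < 3" "i \<noteq> j" and xy: "x \<in> {0..<int g}" "x' \<in> {0..<int g}" "y \<in> {0..<int g}" and E: "E i x x'"
  shows "\<exists>b\<in>mate_blocks g n E \<kappa>. {(Some i, x), (Some i, x'), (Some j, y)} \<subseteq> b"
proof -
  let ?F = "\<lambda>i c. colour_class {0..<int g} (E i) (\<kappa> i) c"
  define c where "c = \<kappa> i x x'"
  have F: "c < n" "{x, x'} \<in> ?F i c"
    using one_factorization_colour[OF fac[OF ij(1)]] xy E by (auto simp: c_def colour_class_def)
  then obtain G where G: "G \<in> ?F j c" "y \<in> G" using colour_class_obtain_mate[OF fac[OF ij(2)] xy(3)] by blast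
  have block: "{Some i} \<times> F \<union> {Some j} \<times> G \<in> mate_blocks g n E \<kappa>"
    if "(i, j) \<in> {(0, 1), (0, 2), (1, 2)}" "F \<in> ?F i c" "G \<in> ?F j c" for i j F G
    unfolding mate_blocks_def using that F(1) by (intro UN_I[OF that(1)]) auto
  show ?thesis
  proof (cases "i < j")
    case True
    then have "(i, j) \<in> {(0, 1), (0, 2), (1, 2)}" using ij by auto
    from block[OF this F(2) G(1)] show ?thesis using G(2) by (intro bexI) auto
  next
    case False
    then have "(j, i) \<in> {(0, 1), (0, 2), (1, 2)}" using ij by auto
    from block[OF this G(1) F(2)] show ?thesis using G(2) by (intro bexI) auto
  qed
qed

text \<open>The pairs joined by an edge are covered by blocks with two points in each of two groups; the remaining triples
  are left to the blocks in \<open>Y\<close>.\<close>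

lemma has_CQS_3_by_counting:
  assumes fac: "\<And>i. i < 3 \<Longrightarrow> one_factorization {0..<int g} (E i) {..<n} (\<kappa> i)"
    and Y: "finite Y" "\<And>b. b \<in> Y \<Longrightarrow> finite b \<and> card b \<le> 4"
    and count: "3 * int n * (int g)\<^sup>2 + 4 * int (card Y) \<le> (4 * int g + 3 * int s - 3) * (int g)\<^sup>2"
    and transversal: "\<And>c. c \<in> {..<3} \<rightarrow>\<^sub>E {0..<int g} \<Longrightarrow> \<exists>b\<in>Y. graph c \<subseteq> b"
    and stem: "\<And>a i j x y. a \<in> {0..<int s} \<Longrightarrow> i < 3 \<Longrightarrow> j < 3 \<Longrightarrow> i \<noteq> j \<Longrightarrow> x \<in> {0..<int g} \<Longrightarrow> y \<in> {0..<int g} \<Longrightarrow>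
      \<exists>b\<in>Y. {(None, a), (Some i, x), (Some j, y)} \<subseteq> b"
    and pair: "\<And>i j x x' y. i < 3 \<Longrightarrow> j < 3 \<Longrightarrow> i \<noteq> j \<Longrightarrow> x \<in> {0..<int g} \<Longrightarrow> x' \<in> {0..<int g} \<Longrightarrow> x \<noteq> x' \<Longrightarrow>
      y \<in> {0..<int g} \<Longrightarrow> \<not> E i x x' \<Longrightarrow> \<exists>b\<in>Y. {(Some i, x), (Some i, x'), (Some j, y)} \<subseteq> b"
  shows "has_CQS g 3 s"
proof (rule has_CQS_by_counting[where I = "{..<3 :: nat}" and \<B> = "mate_blocks g n E \<kappa> \<union> Y"])
  note mates = card_mate_blocks_le[where E = E and \<kappa> = \<kappa>, OF fac]
  show "finite (mate_blocks g n E \<kappa> \<union> Y)" using mates(1) Y(1) by simp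
  show "finite b \<and> card b \<le> 4" if "b \<in> mate_blocks g n E \<kappa> \<union> Y" for b using that mates(3) Y(2) by blast
  have "4 * int (card (mate_blocks g n E \<kappa>)) \<le> 3 * int n * (int g)\<^sup>2"
    using of_nat_mono[OF mates(2), where 'a = int] by simp
  moreover have "int (card (mate_blocks g n E \<kappa> \<union> Y)) \<le> int (card (mate_blocks g n E \<kappa>)) + int (card Y)"
    using card_Un_le[of "mate_blocks g n E \<kappa>" Y] by linarith
  ultimately show "24 * int (card (mate_blocks g n E \<kappa> \<union> Y)) \<le> int 3 * (int 3 - 1) * (int g)\<^sup>2 * ((int 3 + 1) * int g + 3 * int s - 3)"
    using count by (simp add: algebra_simps)
next
  fix T assume "T \<in> crossing (candelabrum {..<3 :: nat} g s)"
  then show "\<exists>b\<in>mate_blocks g n E \<kappa> \<union> Y. T \<subseteq> b"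
  proof (cases rule: crossing_cases)
    case (stem a i x j y)
    then show ?thesis using assms(6)[of a i j x y] by auto
  next
    case (pair i x x' j y)
    then show ?thesis
      using assms(7)[of i j x x' y] mate_blocks_cover[of g E n \<kappa> i j x x' y, OF fac] by (cases "E i x x'") auto
  next
    case (transversal i x j y k z)
    define c where "c = (\<lambda>l\<in>{..<3}. if l = i then x else if l = j then y else z)"
    have "{..<3} = {i, j, k}" using transversal(2,3) by auto
    then have "graph c = T" using transversal(1-3) by (auto simp: graph_def c_def)
    moreover have "c \<in> {..<3} \<rightarrow>\<^sub>E {0..<int g}" using transversal(4) by (auto simp: c_def)
    ultimately show ?thesis using assms(5) by blast
  qed
qed simp_all

definition transversal_blocks ::
    "nat \<Rightarrow> 'm set \<Rightarrow> ('m \<Rightarrow> int) \<Rightarrow> ('m \<Rightarrow> (nat \<Rightarrow> int) \<Rightarrow> nat option \<times> int) \<Rightarrow> (nat option \<times> int) set set" where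
  "transversal_blocks g M \<sigma> w = (\<Union>m\<in>M. (\<lambda>c. insert (w m c) (graph c)) ` layer g (\<sigma> m))"

lemma transversal_blocks:
  assumes "finite M"
  shows "finite (transversal_blocks g M \<sigma> w)" "card (transversal_blocks g M \<sigma> w) \<le> card M * g\<^sup>2"
    "b \<in> transversal_blocks g M \<sigma> w \<Longrightarrow> finite b \<and> card b \<le> 4"
proof -
  show "finite (transversal_blocks g M \<sigma> w)"
    unfolding transversal_blocks_def using assms card_layer_le(1) by simp
  have "card ((\<lambda>c. insert (w m c) (graph c)) ` layer g (\<sigma> m)) \<le> g\<^sup>2" for m
    using card_image_le[OF card_layer_le(1)] card_layer_le(2) by (rule order_trans)
  then have "(\<Sum>m\<in>M. card ((\<lambda>c. insert (w m c) (graph c)) ` layer g (\<sigma> m))) \<le> card M * g\<^sup>2"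
    using sum_bounded_above[of M _ "g\<^sup>2"] by simp
  then show "card (transversal_blocks g M \<sigma> w) \<le> card M * g\<^sup>2"
    unfolding transversal_blocks_def using card_UN_le[OF assms] by (rule order_trans[rotated])
  assume "b \<in> transversal_blocks g M \<sigma> w"
  then show "finite b \<and> card b \<le> 4"
    unfolding transversal_blocks_def graph_eq by (auto simp: card_insert_if)
qed

lemma transversal_block:
  assumes "m \<in> M" "c \<in> layer g (\<sigma> m)" "T \<subseteq> insert (w m c) (graph c)"
  shows "\<exists>b\<in>transversal_blocks g M \<sigma> w. T \<subseteq> b"
  using assms unfolding transversal_blocks_def by blast

lemma transversal_blocks_cover_completion:
  assumes "m \<in> M" "\<sigma> m \<in> {0..<int g}"
    and ij: "i < 3" "j < 3" "i \<noteq> j" "x \<in> {0..<int g}" "y \<in> {0..<int g}"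
    and w: "\<And>c. c \<in> layer g (\<sigma> m) \<Longrightarrow> c i = x \<Longrightarrow> c j = y \<Longrightarrow> w m c = p"
  shows "\<exists>b\<in>transversal_blocks g M \<sigma> w. {p, (Some i, x), (Some j, y)} \<subseteq> b"
proof -
  obtain c where c: "c \<in> layer g (\<sigma> m)" "c i = x" "c j = y" using ij assms(2) by (rule layer_completion)
  have "{p, (Some i, x), (Some j, y)} \<subseteq> insert (w m c) (graph c)"
    using w[OF c] c(2,3) ij(1,2) by (auto simp: graph_def)
  then show ?thesis by (rule transversal_block[of m M c g \<sigma>, OF assms(1) c(1)])
qed

lemma layer_shift:
  assumes "c \<in> layer g \<sigma>" "i < 3" "g > 0"
  shows "c(i := (c i - d) mod int g) \<in> layer g ((\<sigma> - d) mod int g)"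
proof -
  let ?c = "c(i := (c i - d) mod int g)"
  have rest: "(\<Sum>l\<in>{..<3} - {i}. ?c l) = (\<Sum>l\<in>{..<3} - {i}. c l)" by (rule sum.cong) auto
  have "(\<Sum>l<3. ?c l) = (c i - d) mod int g + (\<Sum>l\<in>{..<3} - {i}. c l)"
    using sum.remove[of "{..<3}" i ?c] assms(2) rest by simp
  then have "(\<Sum>l<3. ?c l) mod int g = (c i + (\<Sum>l\<in>{..<3} - {i}. c l) - d) mod int g"
    by (simp add: mod_add_left_eq algebra_simps)
  also have "\<dots> = ((\<Sum>l<3. c l) mod int g - d) mod int g"
    using sum.remove[of "{..<3}" i c] assms(2) by (simp add: mod_diff_left_eq)
  also have "\<dots> = (\<sigma> - d) mod int g" using assms(1) by (simp add: layer_def)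
  finally have "(\<Sum>l<3. ?c l) mod int g = (\<sigma> - d) mod int g" .
  moreover have "?c \<in> {..<3} \<rightarrow>\<^sub>E {0..<int g}"
    using assms by (auto simp: layer_def PiE_iff extensional_def)
  ultimately show ?thesis by (simp add: layer_def)
qed

lemma transversal_blocks_cover_shift:
  assumes "c \<in> layer g \<tau>" "i < 3" "g > 0" "m \<in> M" "\<sigma> m = (\<tau> - d) mod int g"
    and w: "w m (c(i := (c i - d) mod int g)) = (Some i, c i)"
  shows "\<exists>b\<in>transversal_blocks g M \<sigma> w. graph c \<subseteq> b"
proof -
  let ?c = "c(i := (c i - d) mod int g)"
  have "?c \<in> layer g (\<sigma> m)" using layer_shift[OF assms(1-3)] assms(5) by simp
  moreover have "graph c \<subseteq> insert (w m ?c) (graph ?c)" unfolding w by (auto simp: graph_def)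
  ultimately show ?thesis by (rule transversal_block[of m M ?c g \<sigma>, OF assms(4)])
qed

lemma mod_diff_add: "x \<in> {0..<g} \<Longrightarrow> ((x - d) mod g + d) mod g = x" for x d g :: int
  by (simp add: mod_add_left_eq)

locale standard_tripling =
  fixes g s :: nat and L :: int
  assumes L: "L > 0"
    and g: "even L \<and> int g = 3 * L + 2 \<and> s = 2 \<or> odd L \<and> int g = 3 * L + 1 \<and> s = 4"
begin

definition short :: "int set" where
  "short = {d. 0 < d \<and> d < L \<and> odd (L + d)}"

definition long :: "int set" where
  "long = {d. 0 < d \<and> d < int g \<and> d \<notin> short \<and> int g - d \<notin> short}"

definition "half = nat (L div 2)"

lemma g_bounds: "3 * L < int g" "int g > 0" "even (int g)" "int s + 6 * int half = int g"
proof -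
  show "3 * L < int g" "int g > 0" using g L by auto
  show "even (int g)" using g by presburger
  have "int half = L div 2" using L by (simp add: half_def)
  moreover have "even L \<Longrightarrow> 2 * (L div 2) = L" "odd L \<Longrightarrow> 2 * (L div 2) = L - 1" by presburger+
  ultimately show "int s + 6 * int half = int g" using g by auto
qed

lemma shortE:
  assumes "d \<in> short"
  obtains r where "r \<in> {0..<int half}" "d = L - 1 - 2 * r"
proof -
  have d: "0 < d" "d < L" "odd (L + d)" using assms by (auto simp: short_def)
  then have "2 * ((L - 1 - d) div 2) = L - 1 - d" by presburger
  moreover have "(L - 1 - d) div 2 < L div 2" using d by presburger
  ultimately show thesis using that[of "(L - 1 - d) div 2"] d by (simp add: half_def)
qed

lemma shortI: "r \<in> {0..<int half} \<Longrightarrow> L - 1 - 2 * r \<in> short"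
  unfolding short_def half_def using L by auto

lemma card_long: "int (card long) = int g - 1 - 2 * int half"
proof -
  have "short = (\<lambda>r. L - 1 - 2 * r) ` {0..<int half}" using shortE shortI by blast
  moreover have "inj_on (\<lambda>r. L - 1 - 2 * r) {0..<int half}" by (simp add: inj_on_def)
  ultimately have "card short = half" by (simp add: card_image)
  moreover have "card ((-) (int g) ` short) = card short" by (rule card_image) (simp add: inj_on_def)
  moreover have "finite short" by (rule finite_subset[of _ "{0..<L}"]) (auto simp: short_def)
  moreover have "short \<inter> (-) (int g) ` short = {}" using g_bounds(1) by (auto simp: short_def)
  ultimately have "card (short \<union> (-) (int g) ` short) = 2 * half" by (simp add: card_Un_disjoint)
  moreover have "long = {0<..<int g} - (short \<union> (-) (int g) ` short)" by (force simp: long_def)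
  moreover have "short \<union> (-) (int g) ` short \<subseteq> {0<..<int g}" using g_bounds(1) L by (auto simp: short_def)
  moreover have "2 * half \<le> g - 1" using g_bounds(4) g by auto
  ultimately show ?thesis using finite_subset[of _ "{0<..<int g}"] g_bounds(2) by (simp add: card_Diff_subset)
qed

definition sum_of :: "nat option \<times> int \<Rightarrow> int" where
  "sum_of = (\<lambda>(l, r). case l of
     None \<Rightarrow> if even L then 3 * L + r else if r = 3 then 3 * L else r * L + int half
   | Some i \<Rightarrow> int i * L + r)"

definition fourth :: "nat option \<times> int \<Rightarrow> (nat \<Rightarrow> int) \<Rightarrow> nat option \<times> int" where
  "fourth = (\<lambda>(l, r) c. (l, case l of None \<Rightarrow> r | Some i \<Rightarrow> (c i + (L - 1 - 2 * r)) mod int g))"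

abbreviation "blocks \<equiv> transversal_blocks g (candelabrum {..<3} half s) sum_of fourth"

lemma sum_of_range:
  assumes "m \<in> candelabrum {..<3} half s"
  shows "sum_of m \<in> {0..<int g}"
proof -
  have half: "2 * int half \<le> L" using L by (simp add: half_def)
  from assms consider a where "m = (None, a)" "a \<in> {0..<int s}"
    | i r where "m = (Some i, r)" "i \<in> {0, 1, 2}" "r \<in> {0..<int half}"
    by (auto simp: candelabrum_def lessThan_3)
  then show ?thesis
  proof cases
    case 1
    then consider "even L" "a \<in> {0, 1}" "int g = 3 * L + 2" | "odd L" "a \<in> {0, 1, 2, 3}" "int g = 3 * L + 1" using g by fastforce
    then show ?thesis using 1(1) half L by cases (auto simp: sum_of_def)
  next
    case 2
    then show ?thesis using half L g_bounds(1) by (auto simp: sum_of_def)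
  qed
qed

lemma stem_covered:
  assumes "a \<in> {0..<int s}" "i < 3" "j < 3" "i \<noteq> j" "x \<in> {0..<int g}" "y \<in> {0..<int g}"
  shows "\<exists>b\<in>blocks. {(None, a), (Some i, x), (Some j, y)} \<subseteq> b"
proof (rule transversal_blocks_cover_completion)
  show "(None, a) \<in> candelabrum {..<3} half s" using assms(1) by (simp add: candelabrum_def)
  then show "sum_of (None, a) \<in> {0..<int g}" by (rule sum_of_range)
qed (use assms in \<open>simp_all add: fourth_def\<close>)

lemma pair_covered:
  assumes "i < 3" "j < 3" "i \<noteq> j" and xy: "x \<in> {0..<int g}" "x' \<in> {0..<int g}" "y \<in> {0..<int g}"
    and "x \<noteq> x'" "(x' - x) mod int g \<notin> long"
  shows "\<exists>b\<in>blocks. {(Some i, x), (Some i, x'), (Some j, y)} \<subseteq> b"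
proof -
  have covered: "\<exists>b\<in>blocks. {(Some i, x'), (Some i, x), (Some j, y)} \<subseteq> b"
    if short: "(x' - x) mod int g \<in> short" and xy: "x \<in> {0..<int g}" "x' \<in> {0..<int g}" for x x'
  proof -
    obtain r where r: "r \<in> {0..<int half}" "(x' - x) mod int g = L - 1 - 2 * r" using short by (rule shortE)
    have "(x + (x' - x) mod int g) mod int g = x'" using xy by (simp add: mod_add_right_eq)
    then have x': "(x + (L - 1 - 2 * r)) mod int g = x'" unfolding r(2) .
    show ?thesis
    proof (rule transversal_blocks_cover_completion)
      show "(Some i, r) \<in> candelabrum {..<3} half s" using assms(1) r(1) by (simp add: candelabrum_def)
      then show "sum_of (Some i, r) \<in> {0..<int g}" by (rule sum_of_range)
    qed (use assms xy x' in \<open>simp_all add: fourth_def\<close>)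
  qed
  define d where "d = (x' - x) mod int g"
  have d: "0 < d" "d < int g"
    using mod_diff_eq_0_iff[OF xy(1,2)] assms(7) pos_mod_sign[OF g_bounds(2), of "x' - x"] pos_mod_bound[OF g_bounds(2), of "x' - x"]
    unfolding d_def by linarith+
  then have "d \<in> short \<or> int g - d \<in> short" using assms(8) by (auto simp: long_def d_def)
  moreover have "(x - x') mod int g = int g - d" using mod_diff_flip[of "int g - d" "int g" x' x] d by (simp add: d_def)
  ultimately show ?thesis using covered[of x' x] covered[of x x'] xy by (auto simp: insert_commute d_def)
qed

lemma sum_of_cases:
  assumes \<sigma>: "\<sigma> \<in> {0..<int g}"
  obtains (sum) m where "m \<in> candelabrum {..<3} half s" "sum_of m = \<sigma>"
  | (shifted) i r where "i < 3" "r \<in> {0..<int half}" "sum_of (Some i, r) = \<sigma> - (L - 1 - 2 * r)"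
proof (cases "\<sigma> < 3 * L")
  case False
  define a where "a = (if even L then \<sigma> - 3 * L else 3)"
  have "a \<in> {0..<int s}" "sum_of (None, a) = \<sigma>" using g False \<sigma> by (auto simp: a_def sum_of_def)
  then show thesis using sum[of "(None, a)"] by (simp add: candelabrum_def)
next
  case True
  define i where "i = nat (\<sigma> div L)"
  define r where "r = \<sigma> mod L"
  have "0 \<le> \<sigma> div L" using \<sigma> L by (simp add: pos_imp_zdiv_nonneg_iff)
  moreover have "L * (\<sigma> div L) < L * 3" using True pos_mod_sign[OF L, of \<sigma>] mult_div_mod_eq[of L \<sigma>] by linarith
  then have "\<sigma> div L < 3" using L by simp
  ultimately have i: "i < 3" "int i = \<sigma> div L" by (auto simp: i_def)
  have r: "0 \<le> r" "r < L" "\<sigma> = int i * L + r" using L by (simp_all add: r_def i(2))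
  consider "r < int half" | "r = int half" "odd L" | "L - 1 - r \<in> {0..<int half}" using r by (force simp: half_def)
  then show thesis
  proof cases
    case 1
    then show ?thesis using sum[of "(Some i, r)"] r i(1) by (simp add: candelabrum_def sum_of_def)
  next
    case 2
    then have "int i \<in> {0..<int s}" "sum_of (None, int i) = \<sigma>" using g i(1) r(3) by (auto simp: sum_of_def)
    then show ?thesis using sum[of "(None, int i)"] by (simp add: candelabrum_def)
  next
    case 3
    then show ?thesis using shifted[of i "L - 1 - r"] i(1) r(3) by (simp add: sum_of_def)
  qed
qed

lemma transversal_covered:
  assumes "c \<in> {..<3} \<rightarrow>\<^sub>E {0..<int g}"
  shows "\<exists>b\<in>blocks. graph c \<subseteq> b"
proof -
  define \<sigma> where "\<sigma> = (\<Sum>i<3. c i) mod int g"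
  have c: "c \<in> layer g \<sigma>" using assms by (simp add: layer_def \<sigma>_def)
  have "\<sigma> \<in> {0..<int g}" using g_bounds(2) by (simp add: \<sigma>_def)
  then show ?thesis
  proof (cases rule: sum_of_cases)
    case (sum m)
    show ?thesis by (rule transversal_block[of m _ c, OF sum(1)]) (use c sum(2) in auto)
  next
    case (shifted i r)
    let ?d = "L - 1 - 2 * r"
    have m: "(Some i, r) \<in> candelabrum {..<3} half s" using shifted(1,2) by (simp add: candelabrum_def)
    then have "sum_of (Some i, r) = (\<sigma> - ?d) mod int g" using sum_of_range[OF m] shifted(3) by simp
    moreover have "c i \<in> {0..<int g}" using c shifted(1) by (rule layer_coordinate)
    ultimately show ?thesis
      using c shifted(1) g_bounds(2) m mod_diff_add[of "c i" "int g" ?d]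
      by (intro transversal_blocks_cover_shift[where i = i and d = ?d and m = "(Some i, r)"]) (simp_all add: fourth_def)
  qed
qed

theorem has_CQS_3_standard:
  assumes "one_factorization {0..<int g} (\<lambda>x y. (y - x) mod int g \<in> long) {..<card long} \<kappa>"
  shows "has_CQS g 3 s"
proof (rule has_CQS_3_by_counting[where Y = blocks])
  show "one_factorization {0..<int g} (\<lambda>x y. (y - x) mod int g \<in> long) {..<card long} \<kappa>" by (rule assms)
  have fin: "finite (candelabrum {..<3 :: nat} half s)" by (rule finite_candelabrum) simp
  show "finite blocks" "\<And>b. b \<in> blocks \<Longrightarrow> finite b \<and> card b \<le> 4" using transversal_blocks[OF fin] by auto
  have "card blocks \<le> (3 * half + s) * g\<^sup>2"
    using transversal_blocks(2)[OF fin, of g sum_of fourth] by (simp add: card_candelabrum)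
  then have "int (card blocks) \<le> (3 * int half + int s) * (int g)\<^sup>2"
    using of_nat_mono[of "card blocks" "(3 * half + s) * g\<^sup>2", where 'a = int] by simp
  moreover have "4 * int g + 3 * int s - 3 = 3 * int (card long) + 4 * (3 * int half + int s)"
    using card_long g_bounds(4) by simp
  then have "(4 * int g + 3 * int s - 3) * (int g)\<^sup>2
      = 3 * int (card long) * (int g)\<^sup>2 + 4 * ((3 * int half + int s) * (int g)\<^sup>2)"
    by (simp add: algebra_simps)
  ultimately show "3 * int (card long) * (int g)\<^sup>2 + 4 * int (card blocks) \<le> (4 * int g + 3 * int s - 3) * (int g)\<^sup>2"
    by linarith
qed (use transversal_covered stem_covered pair_covered in auto)

end

theorem has_CQS_triple_2: "has_CQS (12 * k + 8) 3 2"
proof -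
  let ?L = "4 * int k + 2" and ?g = "12 * k + 8"
  interpret standard_tripling ?g 2 ?L by unfold_locales auto
  interpret circulant_pairing "int ?g" long "{e. 4 dvd e \<and> 0 < e \<and> 2 * e < int ?g}" "\<lambda>e. ?L + 1 + e div 2"
  proof
    fix e assume e: "e \<in> {e. 4 dvd e \<and> 0 < e \<and> 2 * e < int ?g}"
    then obtain m where "e = 4 * m" by (auto elim: dvdE)
    then show "e \<in> long \<and> even e \<and> 2 * e < int ?g \<and> ?L + 1 + e div 2 \<in> long \<and> odd (?L + 1 + e div 2)"
      using e by (auto simp: long_def short_def)
  next
    show "inj_on (\<lambda>e. ?L + 1 + e div 2) {e. 4 dvd e \<and> 0 < e \<and> 2 * e < int ?g}" by (auto simp: inj_on_def elim!: dvdE)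
  next
    fix e assume "e \<in> long" "even e" "2 * e < int ?g" "e \<notin> {e. 4 dvd e \<and> 0 < e \<and> 2 * e < int ?g}"
    then have "\<not> 4 dvd e" by (auto simp: long_def)
    then have "e mod 4 = 2" using \<open>even e\<close> by presburger
    then show "e mod 4 = 2 \<and> 4 dvd int ?g" by simp
  qed (auto simp: long_def)
  show ?thesis using circulant_one_factorization has_CQS_3_standard by blast
qed

theorem has_CQS_triple_4: "has_CQS (12 * k + 10) 3 4"
proof -
  let ?L = "4 * int k + 3" and ?g = "12 * k + 10"
  interpret standard_tripling ?g 4 ?L by unfold_locales auto
  interpret circulant_pairing "int ?g" long "{e. even e \<and> ?L < e \<and> 2 * e < int ?g}" "\<lambda>e. e + 1"
    by unfold_locales (auto simp: long_def short_def)
  show ?thesis using circulant_one_factorization has_CQS_3_standard by blast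
qed

subsection \<open>The type (12^3:2)\<close>

definition long_12 :: "nat \<Rightarrow> int set" where
  "long_12 i = (if i = 2 then {1, 4, 5, 6, 7, 8, 11} else {2, 4, 5, 6, 7, 8, 10})"

definition fourth_12 :: "int \<Rightarrow> (nat \<Rightarrow> int) \<Rightarrow> nat option \<times> int" where
  "fourth_12 \<sigma> c = (let t = nat ((c 1 - c 0) mod 3); move = (\<lambda>i d. (Some i, (c i + d) mod 12)) in
     if \<sigma> = 9 then (None, 0) else if \<sigma> = 11 then (None, 1)
     else if \<sigma> = 1 then move 0 1 else if \<sigma> = 5 then move 1 1 else if \<sigma> = 8 then move 2 2
     else if \<sigma> = 0 then move (2 - t) 3 else move ((t + 2) mod 3) 3)"

abbreviation "transversal_blocks_12 \<equiv> transversal_blocks 12 {0, 1, 4, 5, 8, 9, 11} id fourth_12"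

text \<open>For each pair of groups \<open>i < j\<close>, the blocks \<open>residue_blocks_12\<close> cover the pairs of difference \<open>3\<close> with a point of the
  other group at one of the three differences modulo \<open>3\<close>; the other two are covered by the sums \<open>0\<close> and \<open>4\<close>.\<close>

definition residue_block_12 :: "nat \<Rightarrow> nat \<Rightarrow> int \<Rightarrow> int \<Rightarrow> (nat option \<times> int) set" where
  "residue_block_12 i j x y = {(Some i, x), (Some i, (x + 3) mod 12), (Some j, y), (Some j, (y + 3) mod 12)}"

definition residues_12 :: "(nat \<times> nat \<times> int) set" where
  "residues_12 = {(0, 1, 0), (0, 2, 2), (1, 2, 2)}"

definition residue_blocks_12 :: "(nat option \<times> int) set set" where
  "residue_blocks_12 = (\<lambda>((i, j, r), x, u). residue_block_12 i j x ((x + r + u) mod 12)) ` (residues_12 \<times> {0..<12} \<times> {0, 6})"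

abbreviation "blocks_12 \<equiv> transversal_blocks_12 \<union> residue_blocks_12"

lemma residue_blocks_12: "finite residue_blocks_12" "card residue_blocks_12 \<le> 72"
  "b \<in> residue_blocks_12 \<Longrightarrow> finite b \<and> card b \<le> 4"
proof -
  have fin: "finite (residues_12 \<times> {0..<12 :: int} \<times> {0, 6 :: int})" by (simp add: residues_12_def)
  then show "finite residue_blocks_12" unfolding residue_blocks_12_def by (rule finite_imageI)
  have "card (residues_12 \<times> {0..<12 :: int} \<times> {0, 6 :: int}) = 72"
    by (simp add: residues_12_def card_cartesian_product)
  then show "card residue_blocks_12 \<le> 72" unfolding residue_blocks_12_def using card_image_le[OF fin] by metis
  assume "b \<in> residue_blocks_12"
  then obtain p q u v where "b = {p, q, u, v}" unfolding residue_blocks_12_def residue_block_12_def by clarsimp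
  then show "finite b \<and> card b \<le> 4" using card_length[of "[p, q, u, v]"] by simp
qed

lemma residue_block_12_in:
  assumes "(i, j, r) \<in> residues_12" "x \<in> {0..<12}" "y \<in> {0..<12}" "u \<in> {0, 6}" "(y - x) mod 12 = r + u"
  shows "residue_block_12 i j x y \<in> residue_blocks_12"
proof -
  have "y = (x + (y - x) mod 12) mod 12" using assms(3) by (simp add: mod_add_right_eq)
  then have "y = (x + r + u) mod 12" using assms(5) by (simp add: add.assoc)
  then show ?thesis unfolding residue_blocks_12_def using assms(1,2,4) by (intro image_eqI[of _ _ "((i, j, r), x, u)"]) simp_all
qed

lemma mod_3_range: "k mod 3 \<in> {0, 1, 2}" for k :: int
  by (simp, presburger)

lemma mod_12_range: "k mod 12 \<in> {0, 1, 2, 3, 4, 5, 6, 7, 8, 9, 10, 11}" for k :: int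
proof -
  have "0 \<le> k mod 12" "k mod 12 < 12" by simp_all
  then show ?thesis by (simp, presburger)
qed

lemma residue_blocks_12_cover:
  assumes "(i, j, r) \<in> residues_12" and xy: "x \<in> {0..<12}" "y \<in> {0..<12}" and residue: "(y - x) mod 3 = r"
  shows "\<exists>b\<in>residue_blocks_12. {(Some i, x), (Some i, (x + 3) mod 12), (Some j, y)} \<subseteq> b" (is "?first")
    and "\<exists>b\<in>residue_blocks_12. {(Some j, y), (Some j, (y + 3) mod 12), (Some i, x)} \<subseteq> b" (is "?second")
proof -
  let ?x = "(x - 3) mod 12" and ?y = "(y - 3) mod 12"
  have unshift: "(?x + 3) mod 12 = x" "(?y + 3) mod 12 = y" using mod_diff_add[of _ 12] xy by auto
  have r: "r = 0 \<or> r = 2" using assms(1) by (auto simp: residues_12_def)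
  define d where "d = (y - x) mod 12"
  have "d mod 3 = r" using residue by (simp add: d_def mod_mod_cancel)
  moreover have "d \<in> {0, 1, 2, 3, 4, 5, 6, 7, 8, 9, 10, 11}" unfolding d_def by (rule mod_12_range)
  ultimately have "(d = r + 0 \<or> d = r + 6) \<or> (d = r + 3 + 0 \<or> d = r + 3 + 6)" using r by (elim disjE insertE emptyE; simp)
  then consider u where "u \<in> {0, 6 :: int}" "d = r + u" | u where "u \<in> {0, 6 :: int}" "d = r + 3 + u" by blast
  then have "?first \<and> ?second"
  proof cases
    case (1 u)
    note block = residue_block_12_in[OF assms(1) xy 1[unfolded d_def]]
    have "?first" by (rule bexI[OF _ block]) (simp add: residue_block_12_def)
    moreover have "?second" by (rule bexI[OF _ block]) (simp add: residue_block_12_def)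
    ultimately show ?thesis ..
  next
    case (2 u)
    have "(?y - x) mod 12 = (y - x - 3) mod 12" unfolding mod_diff_left_eq by (simp add: algebra_simps)
    also have "\<dots> = (d - 3) mod 12" unfolding d_def by (simp only: mod_diff_left_eq)
    finally have left: "(?y - x) mod 12 = r + u" using 2 r by auto
    have "(y - ?x) mod 12 = (y - x + 3) mod 12" unfolding mod_diff_right_eq by (simp add: algebra_simps)
    also have "\<dots> = (d + 3) mod 12" unfolding d_def by (simp only: mod_add_left_eq)
    finally have right: "(y - ?x) mod 12 = r + (6 - u)" using 2 r by auto
    have "?first"
      by (rule bexI[OF _ residue_block_12_in[OF assms(1) xy(1) _ 2(1) left]]) (simp_all add: residue_block_12_def unshift)
    moreover have "6 - u \<in> {0, 6}" using 2(1) by auto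
    then have "?second"
      by (intro bexI[OF _ residue_block_12_in[OF assms(1) _ xy(2) _ right]]) (simp_all add: residue_block_12_def unshift)
    ultimately show ?thesis ..
  qed
  then show ?first ?second by blast+
qed

lemma stem_covered_12:
  assumes "a \<in> {0, 1}" "i < 3" "j < 3" "i \<noteq> j" "x \<in> {0..<12}" "y \<in> {0..<12}"
  shows "\<exists>b\<in>transversal_blocks_12. {(None, a), (Some i, x), (Some j, y)} \<subseteq> b"
  by (rule transversal_blocks_cover_completion[where m = "if a = 0 then 9 else 11"]) (use assms in \<open>auto simp: fourth_12_def\<close>)

lemma fourth_12_0:
  assumes "i < 3" "(c 1 - c 0) mod 3 = 2 - int i"
  shows "fourth_12 0 c = (Some i, (c i + 3) mod 12)"
proof -
  have "2 - nat (2 - int i) = i" using assms(1) by simp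
  then show ?thesis unfolding fourth_12_def assms(2) by simp
qed

lemma fourth_12_4:
  assumes "i < 3" "(c 1 - c 0) mod 3 = (int i + 1) mod 3"
  shows "fourth_12 4 c = (Some i, (c i + 3) mod 12)"
proof -
  have "i = 0 \<or> i = 1 \<or> i = 2" using assms(1) by auto
  then have "(nat ((int i + 1) mod 3) + 2) mod 3 = i" by auto
  then show ?thesis unfolding fourth_12_def assms(2) by simp
qed

definition residue_12 :: "nat \<Rightarrow> nat \<Rightarrow> int" where
  "residue_12 i j = (if i = 2 then 1 else if j = 2 then 2 else 0)"

lemma distinct_groups_12:
  fixes i j :: nat
  assumes "i < 3" "j < 3" "i \<noteq> j"
  shows "(i, j) \<in> {(0, 1), (0, 2), (1, 2), (1, 0), (2, 0), (2, 1)}"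
  using assms by auto

lemma layer_12_residue:
  assumes ij: "i < 3" "j < 3" "i \<noteq> j"
  shows "c \<in> layer 12 0 \<Longrightarrow> (c j - c i) mod 3 = (residue_12 i j + 2) mod 3 \<Longrightarrow> (c 1 - c 0) mod 3 = 2 - int i"
    and "c \<in> layer 12 4 \<Longrightarrow> (c j - c i) mod 3 = (residue_12 i j + 1) mod 3 \<Longrightarrow> (c 1 - c 0) mod 3 = (int i + 1) mod 3"
proof -
  have sum: "(c 0 + c 1 + c 2) mod 3 = \<sigma> mod 3" if "c \<in> layer 12 \<sigma>" for \<sigma>
  proof -
    have "(c 0 + c 1 + c 2) mod 12 = \<sigma>" using that by (simp add: layer_def lessThan_3 add.assoc)
    then have "\<sigma> mod 3 = ((c 0 + c 1 + c 2) mod 12) mod 3" by simp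
    also have "\<dots> = (c 0 + c 1 + c 2) mod 3" by (simp add: mod_mod_cancel)
    finally show ?thesis ..
  qed
  show "(c 1 - c 0) mod 3 = 2 - int i"
    if "c \<in> layer 12 0" "(c j - c i) mod 3 = (residue_12 i j + 2) mod 3"
    using distinct_groups_12[OF ij]
    by (elim insertE emptyE; use that(2) sum[OF that(1)] in \<open>simp add: residue_12_def\<close>; presburger)
  show "(c 1 - c 0) mod 3 = (int i + 1) mod 3"
    if "c \<in> layer 12 4" "(c j - c i) mod 3 = (residue_12 i j + 1) mod 3"
    using distinct_groups_12[OF ij]
    by (elim insertE emptyE; use that(2) sum[OF that(1)] in \<open>simp add: residue_12_def\<close>; presburger)
qed

lemma residue_blocks_12_cover_pair:
  assumes ij: "i < 3" "j < 3" "i \<noteq> j" and xy: "x \<in> {0..<12}" "y \<in> {0..<12}" and residue: "(y - x) mod 3 = residue_12 i j"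
  shows "\<exists>b\<in>residue_blocks_12. {(Some i, (x + 3) mod 12), (Some i, x), (Some j, y)} \<subseteq> b"
proof (cases "i < j")
  case True
  then have "(i, j, residue_12 i j) \<in> residues_12"
    using distinct_groups_12[OF ij] by (auto simp: residues_12_def residue_12_def)
  from residue_blocks_12_cover(1)[OF this xy residue] show ?thesis by (simp add: insert_commute)
next
  case False
  then have "(j, i, (- residue_12 i j) mod 3) \<in> residues_12"
    using distinct_groups_12[OF ij] by (auto simp: residues_12_def residue_12_def)
  moreover have "(x - y) mod 3 = (- residue_12 i j) mod 3" using mod_minus_eq[of "y - x" 3] residue by simp
  ultimately show ?thesis
    using residue_blocks_12_cover(2)[OF _ xy(2,1), of j i] by (simp add: insert_commute)
qed

lemma pair_3_covered_12:
  assumes ij: "i < 3" "j < 3" "i \<noteq> j" and xy: "x \<in> {0..<12}" "y \<in> {0..<12}"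
  shows "\<exists>b\<in>blocks_12. {(Some i, (x + 3) mod 12), (Some i, x), (Some j, y)} \<subseteq> b"
proof -
  let ?r = "residue_12 i j"
  have covered: ?thesis
    if "\<sigma> \<in> {0, 4}" "\<And>c. c \<in> layer 12 \<sigma> \<Longrightarrow> c i = x \<Longrightarrow> c j = y \<Longrightarrow> fourth_12 \<sigma> c = (Some i, (x + 3) mod 12)" for \<sigma>
  proof -
    have "\<exists>b\<in>transversal_blocks_12. {(Some i, (x + 3) mod 12), (Some i, x), (Some j, y)} \<subseteq> b"
      by (rule transversal_blocks_cover_completion[where m = \<sigma>]) (use that ij xy in auto)
    then show ?thesis by blast
  qed
  have "?r = 0 \<or> ?r = 1 \<or> ?r = 2" by (simp add: residue_12_def)
  moreover have "(y - x) mod 3 \<in> {0, 1, 2}" by (rule mod_3_range)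
  ultimately have "(y - x) mod 3 = (?r + 2) mod 3 \<or> (y - x) mod 3 = (?r + 1) mod 3 \<or> (y - x) mod 3 = ?r" by auto
  then consider (sum_0) "(y - x) mod 3 = (?r + 2) mod 3" | (sum_4) "(y - x) mod 3 = (?r + 1) mod 3"
    | (residue) "(y - x) mod 3 = ?r" by blast
  then show ?thesis
  proof cases
    case sum_0
    show ?thesis
    proof (rule covered[of 0])
      fix c assume c: "c \<in> layer 12 0" "c i = x" "c j = y"
      then have "(c 1 - c 0) mod 3 = 2 - int i" by (intro layer_12_residue(1)[OF ij]) (simp_all add: sum_0)
      from fourth_12_0[OF ij(1) this] show "fourth_12 0 c = (Some i, (x + 3) mod 12)" using c(2) by simp
    qed simp
  next
    case sum_4
    show ?thesis
    proof (rule covered[of 4])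
      fix c assume c: "c \<in> layer 12 4" "c i = x" "c j = y"
      then have "(c 1 - c 0) mod 3 = (int i + 1) mod 3" by (intro layer_12_residue(2)[OF ij]) (simp_all add: sum_4)
      from fourth_12_4[OF ij(1) this] show "fourth_12 4 c = (Some i, (x + 3) mod 12)" using c(2) by simp
    qed simp
  next
    case residue
    then show ?thesis using residue_blocks_12_cover_pair[OF ij xy] by blast
  qed
qed

lemma pair_covered_12:
  assumes ij: "i < 3" "j < 3" "i \<noteq> j" and xy: "x \<in> {0..<12}" "x' \<in> {0..<12}" "y \<in> {0..<12}"
    and d: "x \<noteq> x'" "(x' - x) mod 12 \<notin> long_12 i"
  shows "\<exists>b\<in>blocks_12. {(Some i, x), (Some i, x'), (Some j, y)} \<subseteq> b"
proof -
  have short: "\<exists>b\<in>blocks_12. {(Some i, (x + e) mod 12), (Some i, x), (Some j, y)} \<subseteq> b"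
    if x: "x \<in> {0..<12}" and e: "e = 3 \<or> e = (if i = 2 then 2 else 1)" for x e
  proof (cases "e = 3")
    case True
    then show ?thesis using pair_3_covered_12[OF ij x xy(3)] by simp
  next
    case False
    have "i = 0 \<or> i = 1 \<or> i = 2" using ij by auto
    then have "\<exists>b\<in>transversal_blocks_12. {(Some i, (x + e) mod 12), (Some i, x), (Some j, y)} \<subseteq> b"
      by (intro transversal_blocks_cover_completion[where m = "if i = 0 then 1 else if i = 1 then 5 else 8"])
        (use ij x xy e False in \<open>auto simp: fourth_12_def\<close>)
    then show ?thesis by blast
  qed
  have "(x + (x' - x) mod 12) mod 12 = x'" "(x' + (x - x') mod 12) mod 12 = x" using xy by (simp_all add: mod_add_right_eq)
  moreover have "(x' - x) mod 12 \<in> {3, if i = 2 then 2 else 1} \<or> (x - x') mod 12 \<in> {3, if i = 2 then 2 else 1}"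
  proof -
    define e where "e = (x' - x) mod 12"
    have "e \<noteq> 0" using mod_diff_eq_0_iff[OF xy(1,2)] d(1) by (simp add: e_def)
    moreover have "e \<in> {0, 1, 2, 3, 4, 5, 6, 7, 8, 9, 10, 11}" unfolding e_def by (rule mod_12_range)
    moreover from calculation have "(x - x') mod 12 = 12 - e" using mod_diff_flip[of "12 - e" 12 x' x] by (auto simp: e_def)
    moreover have "e \<notin> long_12 i" using d(2) by (simp add: e_def)
    ultimately show ?thesis unfolding long_12_def e_def[symmetric] by (auto split: if_splits)
  qed
  ultimately show ?thesis using short[OF xy(1), of "(x' - x) mod 12"] short[OF xy(2), of "(x - x') mod 12"]
    by (auto simp: insert_commute)
qed

lemma transversal_covered_by_shift_12:
  assumes c: "c \<in> layer 12 \<sigma>" and i: "i < 3" and m: "m \<in> {0, 1, 4, 5, 8, 9, 11}" "m = (\<sigma> - d) mod 12"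
    and fourth: "fourth_12 m (c(i := (c i - d) mod 12)) = (Some i, ((c i - d) mod 12 + d) mod 12)"
  shows "\<exists>b\<in>transversal_blocks_12. graph c \<subseteq> b"
proof -
  have "c i \<in> {0..<12}" using layer_coordinate[OF c i] by simp
  then have "fourth_12 m (c(i := (c i - d) mod 12)) = (Some i, c i)" using fourth mod_diff_add[of "c i" 12 d] by simp
  then show ?thesis by (intro transversal_blocks_cover_shift[of c 12 \<sigma> i m _ id d]) (use c i m in simp_all)
qed

text \<open>A shift by \<open>3\<close> does not change the residue that selects the group.\<close>

lemma transversal_covered_by_shift_3_12:
  assumes c: "c \<in> layer 12 \<sigma>" and \<sigma>: "\<sigma> \<in> {3, 7}"
  shows "\<exists>b\<in>transversal_blocks_12. graph c \<subseteq> b"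
proof -
  let ?t = "(c 1 - c 0) mod 3" and ?c = "\<lambda>i. c(i := (c i - 3) mod 12)"
  have "?c i l mod 3 = c l mod 3" for i l by (simp add: mod_mod_cancel)
  then have shifted: "(?c i 1 - ?c i 0) mod 3 = ?t" for i by (metis mod_diff_eq)
  have t: "?t \<in> {0, 1, 2}" by (rule mod_3_range)
  from \<sigma> consider "\<sigma> = 3" | "\<sigma> = 7" by blast
  then show ?thesis
  proof cases
    case 1
    define i where "i = nat (2 - ?t)"
    have i: "i < 3" "?t = 2 - int i" using t by (auto simp: i_def)
    have "fourth_12 0 (?c i) = (Some i, (?c i i + 3) mod 12)" by (rule fourth_12_0[OF i(1)]) (simp only: shifted i(2))
    then show ?thesis using 1 by (intro transversal_covered_by_shift_12[OF c i(1), of 0 3]) simp_all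
  next
    case 2
    define i where "i = nat ((?t + 2) mod 3)"
    have i: "i < 3" "?t = (int i + 1) mod 3" using t by (auto simp: i_def)
    have "fourth_12 4 (?c i) = (Some i, (?c i i + 3) mod 12)" by (rule fourth_12_4[OF i(1)]) (simp only: shifted i(2))
    then show ?thesis using 2 by (intro transversal_covered_by_shift_12[OF c i(1), of 4 3]) simp_all
  qed
qed

lemma transversal_covered_12:
  assumes "c \<in> {..<3} \<rightarrow>\<^sub>E {0..<12}"
  shows "\<exists>b\<in>transversal_blocks_12. graph c \<subseteq> b"
proof -
  define \<sigma> where "\<sigma> = (\<Sum>i<3. c i) mod 12"
  have c: "c \<in> layer 12 \<sigma>" using assms by (simp add: layer_def \<sigma>_def)
  have "\<sigma> \<in> {0, 1, 2, 3, 4, 5, 6, 7, 8, 9, 10, 11}" unfolding \<sigma>_def by (rule mod_12_range)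
  then consider (own) "\<sigma> \<in> {0, 1, 4, 5, 8, 9, 11}" | (shift_3) "\<sigma> \<in> {3, 7}"
    | (two) "\<sigma> = 2" | (six) "\<sigma> = 6" | (ten) "\<sigma> = 10" by blast
  then show ?thesis
  proof cases
    case own
    then show ?thesis by (rule transversal_block) (use c in auto)
  next
    case shift_3
    then show ?thesis by (rule transversal_covered_by_shift_3_12[OF c])
  next
    case two
    then show ?thesis by (intro transversal_covered_by_shift_12[OF c, of 0 1 1]) (simp_all add: fourth_12_def)
  next
    case six
    then show ?thesis by (intro transversal_covered_by_shift_12[OF c, of 1 5 1]) (simp_all add: fourth_12_def)
  next
    case ten
    then show ?thesis by (intro transversal_covered_by_shift_12[OF c, of 2 8 2]) (simp_all add: fourth_12_def)
  qed
qed

lemma long_12_one_factorization: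
  "\<exists>\<kappa>. one_factorization {0..<12} (\<lambda>x y. (y - x) mod 12 \<in> long_12 i) {..<7 :: nat} \<kappa>"
proof -
  interpret circulant_pairing 12 "long_12 i" "{4}" "\<lambda>_. 5" by unfold_locales (auto simp: long_12_def split: if_splits)
  have "card (long_12 i) = 7" by (simp add: long_12_def)
  then show ?thesis using circulant_one_factorization by simp
qed

theorem has_CQS_12_3_2: "has_CQS 12 3 2"
proof -
  have "\<forall>i. \<exists>\<kappa>. one_factorization {0..<12} (\<lambda>x y. (y - x) mod 12 \<in> long_12 i) {..<7 :: nat} \<kappa>"
    by (intro allI long_12_one_factorization)
  from choice[OF this] obtain \<kappa> where
    fac: "\<And>i. one_factorization {0..<12} (\<lambda>x y. (y - x) mod 12 \<in> long_12 i) {..<7 :: nat} (\<kappa> i)" by blast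
  note tb = transversal_blocks[where M = "{0, 1, 4, 5, 8, 9, 11 :: int}" and g = 12 and \<sigma> = id and w = fourth_12]
  show ?thesis
  proof (rule has_CQS_3_by_counting[where Y = blocks_12 and n = 7])
    show "one_factorization {0..<int 12} (\<lambda>x y. (y - x) mod 12 \<in> long_12 i) {..<7} (\<kappa> i)" for i using fac by simp
    show "finite blocks_12" using tb(1) residue_blocks_12(1) by simp
    show "finite b \<and> card b \<le> 4" if "b \<in> blocks_12" for b using that tb(3) residue_blocks_12(3) by auto
    have "card transversal_blocks_12 \<le> 7 * 144" using tb(2) by simp
    then have "card blocks_12 \<le> 7 * 144 + 72"
      using card_Un_le[of transversal_blocks_12 residue_blocks_12] residue_blocks_12(2) by linarith
    then show "3 * int 7 * (int 12)\<^sup>2 + 4 * int (card blocks_12) \<le> (4 * int 12 + 3 * int 2 - 3) * (int 12)\<^sup>2" by simp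
  next
    show "\<exists>b\<in>blocks_12. graph c \<subseteq> b" if "c \<in> {..<3} \<rightarrow>\<^sub>E {0..<int 12}" for c
      using transversal_covered_12[of c] that by auto
  next
    show "\<exists>b\<in>blocks_12. {(None, a), (Some i, x), (Some j, y)} \<subseteq> b" 
      if "a \<in> {0..<int 2}" "i < 3" "j < 3" "i \<noteq> j" "x \<in> {0..<int 12}" "y \<in> {0..<int 12}" for a i j x y
    proof -
      have "a \<in> {0, 1}" using that(1) by auto
      then show ?thesis using stem_covered_12[of a i j x y] that by auto
    qed
  qed (rule pair_covered_12; simp)
qed

section \<open>Two small designs\<close>

fun covers_subsets :: "nat \<Rightarrow> 'a list list \<Rightarrow> 'a list \<Rightarrow> bool" where
  "covers_subsets 0 bs xs \<longleftrightarrow> bs \<noteq> []"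
| "covers_subsets (Suc n) bs [] \<longleftrightarrow> True"
| "covers_subsets (Suc n) bs (x # xs) \<longleftrightarrow> covers_subsets n (filter (\<lambda>b. x \<in> set b) bs) xs \<and> covers_subsets (Suc n) bs xs"

lemma covers_subsetsD:
  assumes "covers_subsets n bs xs" "T \<subseteq> set xs" "card T = n"
  shows "\<exists>b\<in>set bs. T \<subseteq> set b"
  using assms
proof (induction n bs xs arbitrary: T rule: covers_subsets.induct)
  case (1 bs xs)
  then have "T = {}" using finite_subset by fastforce
  then show ?case using 1(1) by (cases bs) auto
next
  case (2 n bs)
  then show ?case by simp
next
  case (3 n bs x xs)
  show ?case
  proof (cases "x \<in> T")
    case True
    then have "T - {x} \<subseteq> set xs" "card (T - {x}) = n" using 3(4,5) by auto
    then obtain b where "b \<in> set (filter (\<lambda>b. x \<in> set b) bs)" "T - {x} \<subseteq> set b"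
      using 3(1)[of "T - {x}"] 3(3) unfolding covers_subsets.simps by blast
    then show ?thesis by auto
  next
    case False
    then show ?thesis using 3(2-5) by auto
  qed
qed

lemma card_list_blocks_le:
  fixes f :: "'a \<Rightarrow> 'b"
  assumes "list_all (\<lambda>b. length b = 4) bs"
  shows "card ((\<lambda>b. f ` set b) ` set bs) \<le> length bs"
    "B \<in> (\<lambda>b. f ` set b) ` set bs \<Longrightarrow> finite B \<and> card B \<le> 4"
proof -
  show "card ((\<lambda>b. f ` set b) ` set bs) \<le> length bs"
    using card_image_le[of "set bs" "\<lambda>b. f ` set b"] card_length[of bs] by simp
  assume "B \<in> (\<lambda>b. f ` set b) ` set bs"
  then obtain b where "B = f ` set b" "b \<in> set bs" by blast
  moreover from this have "length b = 4" using assms by (simp add: list_all_iff)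
  ultimately show "finite B \<and> card B \<le> 4"
    using card_image_le[of "set b" f] card_length[of b] by simp
qed

definition blocks14 :: "int list list" where
  "blocks14 =
    [[0, 1, 2, 5], [0, 1, 3, 13], [0, 1, 4, 6], [0, 1, 7, 8], [0, 1, 9, 10], [0, 1, 11, 12], [0, 2, 3, 4], [0, 2, 6, 12],
     [0, 2, 7, 9], [0, 2, 8, 10], [0, 2, 11, 13], [0, 3, 5, 6], [0, 3, 7, 10], [0, 3, 8, 11], [0, 3, 9, 12], [0, 4, 5, 10],
     [0, 4, 7, 11], [0, 4, 8, 12], [0, 4, 9, 13], [0, 5, 7, 12], [0, 5, 8, 13], [0, 5, 9, 11], [0, 6, 7, 13], [0, 6, 8, 9],
     [0, 6, 10, 11], [0, 10, 12, 13], [1, 2, 3, 6], [1, 2, 4, 7], [1, 2, 8, 9], [1, 2, 10, 11], [1, 2, 12, 13], [1, 3, 4, 5],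
     [1, 3, 7, 12], [1, 3, 8, 10], [1, 3, 9, 11], [1, 4, 8, 11], [1, 4, 9, 12], [1, 4, 10, 13], [1, 5, 6, 11], [1, 5, 7, 10],
     [1, 5, 8, 12], [1, 5, 9, 13], [1, 6, 7, 9], [1, 6, 8, 13], [1, 6, 10, 12], [1, 7, 11, 13], [2, 3, 5, 8], [2, 3, 7, 13],
     [2, 3, 9, 10], [2, 3, 11, 12], [2, 4, 5, 6], [2, 4, 8, 13], [2, 4, 9, 11], [2, 4, 10, 12], [2, 5, 7, 11], [2, 5, 9, 12],
     [2, 5, 10, 13], [2, 6, 7, 10], [2, 6, 8, 11], [2, 6, 9, 13], [2, 7, 8, 12], [3, 4, 6, 9], [3, 4, 7, 8], [3, 4, 10, 11],
     [3, 4, 12, 13], [3, 5, 7, 9], [3, 5, 10, 12], [3, 5, 11, 13], [3, 6, 7, 11], [3, 6, 8, 12], [3, 6, 10, 13], [3, 8, 9, 13],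
     [4, 5, 7, 13], [4, 5, 8, 9], [4, 5, 11, 12], [4, 6, 7, 12], [4, 6, 8, 10], [4, 6, 11, 13], [4, 7, 9, 10], [5, 6, 7, 8],
     [5, 6, 9, 10], [5, 6, 12, 13], [5, 8, 10, 11], [6, 9, 11, 12], [7, 8, 9, 11], [7, 8, 10, 13], [7, 9, 12, 13], [7, 10, 11, 12],
     [8, 9, 10, 12], [8, 11, 12, 13], [9, 10, 11, 13]]"


lemma has_SQS_14: "has_SQS 14"
proof -
  have "covers_subsets 3 blocks14 [0..13]" by code_simp
  then have cover: "\<exists>b\<in>set ` set blocks14. T \<subseteq> b" if "T \<in> [{0..13}]\<^bsup>3\<^esup>" for T
    using covers_subsetsD[of 3 blocks14 "[0..13]" T] that by (auto simp: nsets_def)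
  have "list_all (\<lambda>b. length b = 4) blocks14" by code_simp
  note bounds = card_list_blocks_le[OF this, where f = "\<lambda>x. x", unfolded image_ident]
  moreover have "length blocks14 = 91" by code_simp
  then have "4 * card (set ` set blocks14) \<le> card {0..13 :: int} choose 3" using bounds(1) by (simp add: eval_nat_numeral)
  ultimately have "is_SQS {0..13} (set ` set blocks14)" using cover by (intro is_SQS_by_counting) simp_all
  then show ?thesis using has_SQS_iff[of "{0..13 :: int}" 14] by auto
qed

definition blocks22 :: "int list list" where
  "blocks22 =
    [[0, 1, 6, 7], [0, 1, 8, 11], [0, 1, 9, 10], [0, 1, 12, 13], [0, 1, 14, 17], [0, 1, 15, 16], [0, 2, 6, 8], [0, 2, 7, 9],
     [0, 2, 10, 16], [0, 2, 11, 15], [0, 2, 12, 14], [0, 2, 13, 17], [0, 3, 6, 9], [0, 3, 7, 8], [0, 3, 10, 11], [0, 3, 12, 15],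
     [0, 3, 13, 14], [0, 3, 16, 17], [0, 4, 6, 10], [0, 4, 7, 11], [0, 4, 8, 14], [0, 4, 9, 13], [0, 4, 12, 16], [0, 4, 15, 17],
     [0, 5, 6, 11], [0, 5, 7, 10], [0, 5, 8, 9], [0, 5, 12, 17], [0, 5, 13, 16], [0, 5, 14, 15], [0, 6, 12, 19], [0, 6, 13, 20],
     [0, 6, 14, 16], [0, 6, 15, 18], [0, 6, 17, 21], [0, 7, 12, 20], [0, 7, 13, 15], [0, 7, 14, 19], [0, 7, 16, 21], [0, 7, 17, 18],
     [0, 8, 10, 12], [0, 8, 13, 19], [0, 8, 15, 21], [0, 8, 16, 18], [0, 8, 17, 20], [0, 9, 11, 17], [0, 9, 12, 18], [0, 9, 14, 21],
     [0, 9, 15, 19], [0, 9, 16, 20], [0, 10, 13, 21], [0, 10, 14, 18], [0, 10, 15, 20], [0, 10, 17, 19], [0, 11, 12, 21], [0, 11, 13, 18],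
     [0, 11, 14, 20], [0, 11, 16, 19], [1, 2, 6, 9], [1, 2, 7, 8], [1, 2, 10, 11], [1, 2, 12, 15], [1, 2, 13, 14], [1, 2, 16, 17],
     [1, 3, 6, 13], [1, 3, 7, 11], [1, 3, 8, 10], [1, 3, 9, 16], [1, 3, 12, 14], [1, 3, 15, 17], [1, 4, 6, 11], [1, 4, 7, 10],
     [1, 4, 8, 9], [1, 4, 12, 17], [1, 4, 13, 16], [1, 4, 14, 15], [1, 5, 6, 8], [1, 5, 7, 14], [1, 5, 9, 11], [1, 5, 10, 17],
     [1, 5, 12, 16], [1, 5, 13, 15], [1, 6, 10, 15], [1, 6, 12, 20], [1, 6, 14, 19], [1, 6, 16, 21], [1, 6, 17, 18], [1, 7, 9, 12],
     [1, 7, 13, 18], [1, 7, 15, 21], [1, 7, 16, 19], [1, 7, 17, 20], [1, 8, 12, 19], [1, 8, 13, 17], [1, 8, 14, 21], [1, 8, 15, 18],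
     [1, 8, 16, 20], [1, 9, 13, 21], [1, 9, 14, 18], [1, 9, 15, 20], [1, 9, 17, 19], [1, 10, 12, 21], [1, 10, 13, 19], [1, 10, 14, 20],
     [1, 10, 16, 18], [1, 11, 12, 18], [1, 11, 13, 20], [1, 11, 14, 16], [1, 11, 15, 19], [1, 11, 17, 21], [2, 3, 6, 11], [2, 3, 7, 10],
     [2, 3, 8, 9], [2, 3, 12, 17], [2, 3, 13, 16], [2, 3, 14, 15], [2, 4, 6, 12], [2, 4, 7, 17], [2, 4, 8, 10], [2, 4, 9, 11],
     [2, 4, 13, 15], [2, 4, 14, 16], [2, 5, 6, 7], [2, 5, 8, 11], [2, 5, 9, 10], [2, 5, 12, 13], [2, 5, 14, 17], [2, 5, 15, 16],
     [2, 6, 10, 14], [2, 6, 13, 19], [2, 6, 15, 21], [2, 6, 16, 18], [2, 6, 17, 20], [2, 7, 11, 13], [2, 7, 12, 19], [2, 7, 14, 21],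
     [2, 7, 15, 18], [2, 7, 16, 20], [2, 8, 12, 16], [2, 8, 13, 21], [2, 8, 14, 19], [2, 8, 15, 20], [2, 8, 17, 18], [2, 9, 12, 21],
     [2, 9, 13, 18], [2, 9, 14, 20], [2, 9, 15, 17], [2, 9, 16, 19], [2, 10, 12, 18], [2, 10, 13, 20], [2, 10, 15, 19], [2, 10, 17, 21],
     [2, 11, 12, 20], [2, 11, 14, 18], [2, 11, 16, 21], [2, 11, 17, 19], [3, 4, 6, 7], [3, 4, 8, 11], [3, 4, 9, 10], [3, 4, 12, 13],
     [3, 4, 14, 17], [3, 4, 15, 16], [3, 5, 6, 10], [3, 5, 7, 9], [3, 5, 8, 15], [3, 5, 11, 12], [3, 5, 13, 17], [3, 5, 14, 16],
     [3, 6, 8, 17], [3, 6, 12, 18], [3, 6, 14, 21], [3, 6, 15, 19], [3, 6, 16, 20], [3, 7, 12, 16], [3, 7, 13, 21], [3, 7, 14, 18],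
     [3, 7, 15, 20], [3, 7, 17, 19], [3, 8, 12, 21], [3, 8, 13, 18], [3, 8, 14, 20], [3, 8, 16, 19], [3, 9, 11, 14], [3, 9, 12, 19],
     [3, 9, 13, 20], [3, 9, 15, 18], [3, 9, 17, 21], [3, 10, 12, 20], [3, 10, 13, 15], [3, 10, 14, 19], [3, 10, 16, 21], [3, 10, 17, 18],
     [3, 11, 13, 19], [3, 11, 15, 21], [3, 11, 16, 18], [3, 11, 17, 20], [4, 5, 6, 9], [4, 5, 7, 8], [4, 5, 10, 11], [4, 5, 12, 15],
     [4, 5, 13, 14], [4, 5, 16, 17], [4, 6, 8, 16], [4, 6, 13, 21], [4, 6, 14, 18], [4, 6, 15, 20], [4, 6, 17, 19], [4, 7, 9, 15],
     [4, 7, 12, 21], [4, 7, 13, 19], [4, 7, 14, 20], [4, 7, 16, 18], [4, 8, 12, 18], [4, 8, 13, 20], [4, 8, 15, 19], [4, 8, 17, 21],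
     [4, 9, 12, 20], [4, 9, 14, 19], [4, 9, 16, 21], [4, 9, 17, 18], [4, 10, 12, 14], [4, 10, 13, 18], [4, 10, 15, 21], [4, 10, 16, 19],
     [4, 10, 17, 20], [4, 11, 12, 19], [4, 11, 13, 17], [4, 11, 14, 21], [4, 11, 15, 18], [4, 11, 16, 20], [5, 6, 12, 21], [5, 6, 13, 18],
     [5, 6, 14, 20], [5, 6, 15, 17], [5, 6, 16, 19], [5, 7, 11, 16], [5, 7, 12, 18], [5, 7, 13, 20], [5, 7, 15, 19], [5, 7, 17, 21],
     [5, 8, 10, 13], [5, 8, 12, 20], [5, 8, 14, 18], [5, 8, 16, 21], [5, 8, 17, 19], [5, 9, 12, 14], [5, 9, 13, 19], [5, 9, 15, 21],
     [5, 9, 16, 18], [5, 9, 17, 20], [5, 10, 12, 19], [5, 10, 14, 21], [5, 10, 15, 18], [5, 10, 16, 20], [5, 11, 13, 21], [5, 11, 14, 19],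
     [5, 11, 15, 20], [5, 11, 17, 18], [6, 7, 12, 13], [6, 7, 14, 17], [6, 7, 15, 16], [6, 8, 12, 14], [6, 8, 13, 15], [6, 9, 12, 15],
     [6, 9, 13, 14], [6, 9, 16, 17], [6, 10, 12, 16], [6, 10, 13, 17], [6, 11, 12, 17], [6, 11, 13, 16], [6, 11, 14, 15], [7, 8, 12, 15],
     [7, 8, 13, 14], [7, 8, 16, 17], [7, 9, 13, 17], [7, 9, 14, 16], [7, 10, 12, 17], [7, 10, 13, 16], [7, 10, 14, 15], [7, 11, 12, 14],
     [7, 11, 15, 17], [8, 9, 12, 17], [8, 9, 13, 16], [8, 9, 14, 15], [8, 10, 14, 16], [8, 10, 15, 17], [8, 11, 12, 13], [8, 11, 14, 17],
     [8, 11, 15, 16], [9, 10, 12, 13], [9, 10, 14, 17], [9, 10, 15, 16], [9, 11, 12, 16], [9, 11, 13, 15], [10, 11, 12, 15], [10, 11, 13, 14],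
     [10, 11, 16, 17]]"

definition holes22 :: "int list list" where
  "holes22 = [[0..5] @ [18..21], [6..11] @ [18..21], [12..21]]"

definition point_22 :: "int \<Rightarrow> nat option \<times> int" where
  "point_22 p = (if p < 18 then (Some (nat (p div 6)), p mod 6) else (None, p - 18))"

lemma candelabrum_subset_point_22: "candelabrum {..<3} 6 4 \<subseteq> point_22 ` {0..21}"
proof
  fix p :: "nat option \<times> int" assume "p \<in> candelabrum {..<3} 6 4"
  then consider i x where "p = (Some i, x)" "i < 3" "0 \<le> x" "x < 6" | a where "p = (None, a)" "0 \<le> a" "a < 4"
    by (auto simp: candelabrum_def)
  then show "p \<in> point_22 ` {0..21}"
  proof cases
    case (1 i x)
    then show ?thesis by (intro image_eqI[of _ _ "6 * int i + x"]) (auto simp: point_22_def)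
  next
    case (2 a)
    then show ?thesis by (intro image_eqI[of _ _ "18 + a"]) (auto simp: point_22_def)
  qed
qed

lemma has_CQS_6_3_4: "has_CQS 6 3 4"
proof (rule has_CQS_by_counting[where I = "{..<3 :: nat}" and \<B> = "(\<lambda>b. point_22 ` set b) ` set blocks22"])
  have "list_all (\<lambda>b. length b = 4) blocks22" by code_simp
  note bounds = card_list_blocks_le[OF this, where f = point_22]
  have "length blocks22 = 297" by code_simp
  then show "24 * int (card ((\<lambda>b. point_22 ` set b) ` set blocks22))
      \<le> int 3 * (int 3 - 1) * (int 6)\<^sup>2 * ((int 3 + 1) * int 6 + 3 * int 4 - 3)" using bounds(1) by simp
  show "finite B \<and> card B \<le> 4" if "B \<in> (\<lambda>b. point_22 ` set b) ` set blocks22" for B using that by (rule bounds(2))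
  have covers: "covers_subsets 3 (blocks22 @ holes22) [0..21]" by code_simp
  fix T assume T: "T \<in> crossing (candelabrum {..<3 :: nat} 6 4)"
  have "T \<subseteq> point_22 ` {0..21}"
    using T unfolding crossing_iff by (intro subset_trans[OF _ candelabrum_subset_point_22]) simp
  then obtain U where U: "U \<subseteq> {0..21}" "inj_on point_22 U" "T = point_22 ` U"
    unfolding subset_image_inj by blast
  then have "card U = 3" using T by (simp add: crossing_iff card_image)
  moreover have "U \<subseteq> set [0..21]" using U(1) by simp
  ultimately obtain b where b: "b \<in> set (blocks22 @ holes22)" "U \<subseteq> set b"
    using covers_subsetsD[OF covers] by blast
  have "b \<notin> set holes22"
  proof
    assume "b \<in> set holes22"
    then have "\<exists>i. fst ` point_22 ` set b \<subseteq> {Some i, None}" by (auto simp: point_22_def holes22_def)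
    then show False using T b(2) unfolding U(3) crossing_iff two_groups_def by blast
  qed
  then show "\<exists>B\<in>(\<lambda>b. point_22 ` set b) ` set blocks22. T \<subseteq> B" using b U(3) by auto
qed simp_all

section \<open>Hanani's theorem\<close>

lemma has_SQS_quadruple:
  assumes "has_SQS (g + 2)" "even g" "g > 0"
  shows "has_SQS (4 * g + 2)"
  using has_CQS_fill[OF has_CQS_quadruple] assms by simp

lemma has_SQS_10: "has_SQS 10"
  using has_SQS_quadruple[of 2] has_SQS_4 by simp

lemma has_SQS_triple_2:
  assumes "has_SQS (12 * k + 10)"
  shows "has_SQS (36 * k + 26)"
  using has_CQS_fill[OF has_CQS_triple_2[of k]] assms by (simp add: algebra_simps)

lemma has_SQS_triple_4:
  assumes "has_SQS (12 * k + 14)"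
  shows "has_SQS (36 * k + 34)"
  using has_CQS_fill[OF has_CQS_triple_4[of k]] assms by (simp add: algebra_simps)

lemma has_SQS_inflate_fill:
  assumes "has_CQS g 3 s" "has_SQS (g + s)" "s = 2 \<or> s = 4" "g > 0" "has_SQS v" "v \<ge> 2"
  shows "has_SQS ((v - 1) * g + s)"
  using has_CQS_fill[OF has_CQS_inflate] assms by simp

definition admissible :: "nat \<Rightarrow> bool" where
  "admissible v \<longleftrightarrow> v mod 6 = 2 \<or> v mod 6 = 4"

lemma admissibleI: "v = 6 * k + 2 \<or> v = 6 * k + 4 \<Longrightarrow> admissible v"
  unfolding admissible_def by presburger

lemma admissibleE:
  assumes "admissible w"
  obtains k where "w = 12 * k + 2" | k where "w = 12 * k + 4" | k where "w = 12 * k + 8" | k where "w = 12 * k + 10"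
proof -
  define u where "u = w div 6"
  have "w = 6 * u + 2 \<or> w = 6 * u + 4" using assms unfolding admissible_def u_def by presburger
  then show thesis using that by (cases "even u") (auto elim!: evenE oddE)
qed

lemma mod_3_cases:
  obtains h :: nat where "i = 3 * h" | h where "i = 3 * h + 1" | h where "i = 3 * h + 2"
proof -
  have "i = 3 * (i div 3) \<or> i = 3 * (i div 3) + 1 \<or> i = 3 * (i div 3) + 2" by presburger
  then show thesis using that by blast
qed

lemma order_24_14_cases:
  obtains (fourteen) "24 * i + 14 = (14 :: nat)"
  | (inflate) v where "24 * i + 14 = (v - 1) * 12 + 2" "admissible v" "v > 2"
  | (triple) k where "24 * i + 14 = 36 * k + 26"
proof (cases i rule: mod_3_cases)
  case (1 h)
  have "admissible (6 * h + 2)" by (rule admissibleI) blast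
  then show thesis using 1 fourteen inflate[of "6 * h + 2"] by (cases "h = 0") simp_all
next
  case (2 h)
  have "admissible (6 * h + 4)" by (rule admissibleI) blast
  then show thesis using 2 inflate[of "6 * h + 4"] by simp
next
  case (3 h)
  then show thesis using triple[of "2 * h + 1"] by simp
qed

lemma order_24_22_cases:
  obtains (inflate) v where "24 * i + 22 = (v - 1) * 6 + 4" "admissible v" "v > 2"
  | (triple) k where "24 * i + 22 = 36 * k + (34 :: nat)"
proof (cases i rule: mod_3_cases)
  case (1 h)
  have "admissible (12 * h + 4)" by (rule admissibleI[of _ "2 * h"]) simp
  then show thesis using 1 inflate[of "12 * h + 4"] by simp
next
  case (2 h)
  have "admissible (12 * h + 8)" by (rule admissibleI[of _ "2 * h + 1"]) simp
  then show thesis using 2 inflate[of "12 * h + 8"] by simp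
next
  case (3 h)
  then show thesis using triple[of "2 * h + 1"] by simp
qed

lemma admissible_cases:
  assumes "admissible w"
  obtains (two) "w = 2"
  | (fourteen) "w = 14"
  | (double) v where "w = 2 * v" "admissible v"
  | (quadruple) g where "w = 4 * g + 2" "even g" "g > 0" "admissible (g + 2)"
  | (triple_2) k where "w = 36 * k + 26"
  | (triple_4) k where "w = 36 * k + 34"
  | (inflate_12) v where "w = (v - 1) * 12 + 2" "admissible v" "v > 2"
  | (inflate_6) v where "w = (v - 1) * 6 + 4" "admissible v" "v > 2"
  using assms
proof (cases rule: admissibleE)
  case (1 k)
  show thesis
  proof (cases "even k")
    case True
    then obtain i where i: "k = 2 * i" by (rule evenE)
    have "admissible (6 * i + 2)" by (rule admissibleI) blast
    then show thesis using 1 i two quadruple[of "6 * i"] by (cases "i = 0") simp_all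
  next
    case False
    then obtain i where "k = 2 * i + 1" by (rule oddE)
    then have w: "w = 24 * i + 14" using 1 by simp
    show thesis by (rule order_24_14_cases[of i]) (use w fourteen inflate_12 triple_2 in simp_all)
  qed
next
  case (2 k)
  have "admissible (6 * k + 2)" by (rule admissibleI) blast
  then show thesis using 2 double[of "6 * k + 2"] by simp
next
  case (3 k)
  have "admissible (6 * k + 4)" by (rule admissibleI) blast
  then show thesis using 3 double[of "6 * k + 4"] by simp
next
  case (4 k)
  show thesis
  proof (cases "even k")
    case True
    then obtain i where i: "k = 2 * i" by (rule evenE)
    have "admissible (6 * i + 2 + 2)" by (rule admissibleI[of _ i]) simp
    then show thesis using 4 i quadruple[of "6 * i + 2"] by simp
  next
    case False
    then obtain i where "k = 2 * i + 1" by (rule oddE)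
    then have w: "w = 24 * i + 22" using 4 by simp
    show thesis by (rule order_24_22_cases[of i]) (use w inflate_6 triple_4 in simp_all)
  qed
qed

theorem has_SQS_if_admissible:
  assumes "admissible w"
  shows "has_SQS w"
  using assms
proof (induction w rule: less_induct)
  case (less w)
  from less.prems show ?case
  proof (cases rule: admissible_cases)
    case two
    then show ?thesis by (simp add: has_SQS_2)
  next
    case fourteen
    then show ?thesis by (simp add: has_SQS_14)
  next
    case (double v)
    then have "v > 0" "even v" by (auto simp: admissible_def) presburger+
    then show ?thesis using has_SQS_double less.IH[of v] double by simp
  next
    case (quadruple g)
    then show ?thesis using has_SQS_quadruple[of g] less.IH[of "g + 2"] by simp
  next
    case (triple_2 k)
    have "admissible (12 * k + 10)" by (rule admissibleI[of _ "2 * k + 1"]) simp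
    then show ?thesis using has_SQS_triple_2[of k] less.IH[of "12 * k + 10"] triple_2 by simp
  next
    case (triple_4 k)
    have "admissible (12 * k + 14)" by (rule admissibleI[of _ "2 * k + 2"]) simp
    then show ?thesis using has_SQS_triple_4[of k] less.IH[of "12 * k + 14"] triple_4 by simp
  next
    case (inflate_12 v)
    then show ?thesis using has_SQS_inflate_fill[OF has_CQS_12_3_2, of v] has_SQS_14 less.IH[of v] by simp
  next
    case (inflate_6 v)
    then show ?thesis using has_SQS_inflate_fill[OF has_CQS_6_3_4, of v] has_SQS_10 less.IH[of v] by simp
  qed
qed

section \<open>A near-invariant one-factorization\<close>

definition vertices :: "int \<Rightarrow> (int \<times> bool) set" where
  "vertices n = {0..<n} \<times> UNIV"

lemma finite_vertices: "finite (vertices n)"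
  by (simp add: vertices_def)

lemma card_vertices: "card (vertices (int n)) = 2 * n"
  by (simp add: vertices_def card_cartesian_product card_UNIV_bool)

definition label :: "int \<Rightarrow> int \<times> bool \<Rightarrow> int \<times> bool \<Rightarrow> int" where
  "label n = (\<lambda>(x, l) (y, m). if l = m then 2 * (min ((y - x) mod n) ((x - y) mod n) - 1) else (x + y) mod n)"

definition label_colours :: "int \<Rightarrow> int \<Rightarrow> int set" where
  "label_colours n a = (if odd a then {2 * a + 1} else if a = n - 1 then {2 * a} else {2 * a, 2 * a + 1, 2 * a + 2})"

lemma min_mod_diff_eq_iff:
  fixes n x y d :: int
  assumes xy: "x \<in> {0..<n}" "y \<in> {0..<n}" and d: "0 < d" "2 * d < n"
  shows "min ((y - x) mod n) ((x - y) mod n) = d \<longleftrightarrow> y = (x + d) mod n \<or> x = (y + d) mod n"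
proof -
  have "(y - x) mod n = d \<longleftrightarrow> (x - y) mod n = n - d" "(x - y) mod n = d \<longleftrightarrow> (y - x) mod n = n - d"
    using mod_diff_flip[of d n] d by auto
  then have "min ((y - x) mod n) ((x - y) mod n) = d \<longleftrightarrow> (y - x) mod n = d \<or> (x - y) mod n = d"
    using d by (auto simp: min_def)
  then show ?thesis using mod_diff_eq_iff[of x n y d] mod_diff_eq_iff[of y n x d] xy d by simp
qed

lemma label_same_level:
  assumes n: "odd n" and "x \<in> {0..<n}" "y \<in> {0..<n}" "x \<noteq> y"
  shows "even (label n (x, l) (y, l))" "0 \<le> label n (x, l) (y, l)" "label n (x, l) (y, l) < n - 1"
proof -
  define m where "m = (y - x) mod n"
  have "0 < n" using assms(2) by auto
  then have m: "0 < m" "m < n"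
    using mod_diff_eq_0_iff[OF assms(2,3)] assms(4) pos_mod_sign[of n "y - x"] pos_mod_bound[of n "y - x"]
    unfolding m_def by linarith+
  moreover have "(x - y) mod n = n - m" using mod_diff_flip[of "n - m" n y x] m by (simp add: m_def)
  then have "label n (x, l) (y, l) = 2 * (min m (n - m) - 1)" by (simp add: label_def m_def)
  ultimately show "even (label n (x, l) (y, l))" "0 \<le> label n (x, l) (y, l)" "label n (x, l) (y, l) < n - 1"
    using n by (auto simp: min_def)
qed

lemma label_range:
  assumes "odd n" "p \<in> vertices n" "q \<in> vertices n" "p \<noteq> q"
  shows "label n p q \<in> {0..<n}"
proof -
  obtain x l y m where p: "p = (x, l)" "q = (y, m)" by (cases p, cases q)
  then show ?thesis using assms label_same_level[of n x y l] by (cases "l = m") (auto simp: vertices_def label_def)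
qed

lemma cross_label_iff:
  fixes x y a n :: int
  assumes "x \<in> {0..<n}" "y \<in> {0..<n}" "a \<in> {0..<n}"
  shows "(x + y) mod n = a \<longleftrightarrow> y = (a - x) mod n"
  using assms by (auto simp: mod_diff_left_eq mod_add_right_eq)

lemma matching_label_one_factorization:
  assumes n: "odd n" and a: "a \<in> {0..<n}" "odd a \<or> a = n - 1"
  shows "one_factorization (vertices n) (\<lambda>p q. p \<noteq> q \<and> label n p q = a) {c} (\<lambda>_ _. c)"
proof -
  define \<pi> where "\<pi> = (\<lambda>(x, l). ((a - x) mod n, \<not> l))"
  have "one_factorization (vertices n) (\<lambda>p q. q = \<pi> p) {c} (\<lambda>_ _. c)"
    by (rule one_factorization_matching) (auto simp: \<pi>_def vertices_def mod_diff_right_eq)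
  then show ?thesis
  proof (rule one_factorization_cong)
    fix p q assume "p \<in> vertices n" "q \<in> vertices n"
    then obtain x l y m where p: "p = (x, l)" "q = (y, m)" "x \<in> {0..<n}" "y \<in> {0..<n}"
      by (cases p, cases q) (auto simp: vertices_def)
    show "q = \<pi> p \<longleftrightarrow> p \<noteq> q \<and> label n p q = a"
    proof (cases "l = m")
      case True
      then show ?thesis using label_same_level[OF n p(3,4), of l] n a(2) p by (auto simp: \<pi>_def)
    next
      case False
      then show ?thesis using cross_label_iff[OF p(3,4) a(1)] p by (auto simp: \<pi>_def label_def)
    qed
  qed
qed

lemma prism_label_one_factorization:
  assumes n: "odd n" and a: "a \<in> {0..<n}" "even a" "a \<noteq> n - 1"
  shows "\<exists>\<kappa>. one_factorization (vertices n) (\<lambda>p q. p \<noteq> q \<and> label n p q = a) {0, 1, 2 :: int} \<kappa>"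
proof -
  define d where "d = a div 2 + 1"
  define \<pi> where "\<pi> = (\<lambda>(x, l). ((a - x) mod n, \<not> l))"
  define \<sigma> where "\<sigma> = (\<lambda>(x, l). ((if l then x - d else x + d) mod n, l))"
  define pos where "pos = (\<lambda>(x, l). if l then (a - x) mod n else x)"
  have d: "0 < d" "2 * d < n" "a = 2 * (d - 1)" using n a unfolding d_def by auto presburger+
  have "\<exists>\<kappa>. one_factorization (vertices n) (\<lambda>p q. q = \<sigma> p \<or> p = \<sigma> q \<or> q = \<pi> p) {0, 1, 2 :: int} \<kappa>"
  proof (rule one_factorization_cyclic_prism[where pos = pos, OF d(1,2)])
    show "bij_betw \<sigma> (vertices n) (vertices n)"
      by (rule bij_betw_byWitness[where f' = "\<lambda>(x, l). ((if l then x + d else x - d) mod n, l)"])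
        (auto simp: \<sigma>_def vertices_def mod_diff_left_eq mod_add_left_eq)
    fix p assume "p \<in> vertices n"
    then obtain x l where p: "p = (x, l)" "x \<in> {0..<n}" by (auto simp: vertices_def)
    show "pos p \<in> {0..<n}" using p by (simp add: pos_def)
    have "(a - (x - d)) mod n = ((a - x) mod n + d) mod n" unfolding mod_add_left_eq by (simp add: algebra_simps)
    then show "pos (\<sigma> p) = (pos p + d) mod n"
      unfolding p(1) by (cases l) (simp_all add: pos_def \<sigma>_def mod_diff_right_eq del: diff_diff_eq2)
    show "\<pi> p \<in> vertices n \<and> \<pi> (\<pi> p) = p \<and> \<pi> p \<noteq> p \<and> pos (\<pi> p) = pos p"
      using p by (simp add: \<pi>_def pos_def vertices_def mod_diff_right_eq)
  qed
  then obtain \<kappa> where "one_factorization (vertices n) (\<lambda>p q. q = \<sigma> p \<or> p = \<sigma> q \<or> q = \<pi> p) {0, 1, 2 :: int} \<kappa>" by blast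
  then have "one_factorization (vertices n) (\<lambda>p q. p \<noteq> q \<and> label n p q = a) {0, 1, 2 :: int} \<kappa>"
  proof (rule one_factorization_cong)
    fix p q assume "p \<in> vertices n" "q \<in> vertices n"
    then obtain x l y m where p: "p = (x, l)" "q = (y, m)" "x \<in> {0..<n}" "y \<in> {0..<n}"
      by (cases p, cases q) (auto simp: vertices_def)
    show "q = \<sigma> p \<or> p = \<sigma> q \<or> q = \<pi> p \<longleftrightarrow> p \<noteq> q \<and> label n p q = a"
    proof (cases "l = m")
      case True
      have "y = (x - d) mod n \<longleftrightarrow> x = (y + d) mod n" "x = (y - d) mod n \<longleftrightarrow> y = (x + d) mod n"
        using p(3,4) by (auto simp: mod_diff_left_eq mod_add_left_eq)
      then have "q = \<sigma> p \<or> p = \<sigma> q \<longleftrightarrow> y = (x + d) mod n \<or> x = (y + d) mod n"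
        using True p(1,2) by (cases m) (auto simp: \<sigma>_def)
      then show ?thesis using min_mod_diff_eq_iff[OF p(3,4) d(1,2)] p True d by (auto simp: \<pi>_def label_def)
    next
      case False
      then show ?thesis using cross_label_iff[OF p(3,4) a(1)] p by (auto simp: \<pi>_def \<sigma>_def label_def)
    qed
  qed
  then show ?thesis by blast
qed

lemma label_one_factorization:
  assumes n: "odd n" and a: "a \<in> {0..<n}"
  shows "\<exists>\<kappa>. one_factorization (vertices n) (\<lambda>p q. p \<noteq> q \<and> label n p q = a) (label_colours n a) \<kappa>"
proof (cases "odd a \<or> a = n - 1")
  case True
  then have "label_colours n a = {if odd a then 2 * a + 1 else 2 * a}" by (simp add: label_colours_def)
  then show ?thesis using matching_label_one_factorization[OF n a True] by (intro exI) (simp only:)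
next
  case False
  then have "bij_betw (\<lambda>k. 2 * a + k) {0, 1, 2} (label_colours n a)"
    by (auto simp: label_colours_def bij_betw_def)
  then show ?thesis using one_factorization_recolour prism_label_one_factorization[OF n a] False by blast
qed

lemma label_colours_disjoint: "odd n \<Longrightarrow> disjoint_family_on (label_colours n) {0..<n}"
  unfolding disjoint_family_on_def label_colours_def by (auto; presburger)

lemma UN_label_colours:
  assumes "odd n" "n > 0"
  shows "(\<Union>a\<in>{0..<n}. label_colours n a) = {0..<2 * n - 1}"
proof
  show "(\<Union>a\<in>{0..<n}. label_colours n a) \<subseteq> {0..<2 * n - 1}"
    using assms by (auto simp: label_colours_def split: if_splits; presburger)
  show "{0..<2 * n - 1} \<subseteq> (\<Union>a\<in>{0..<n}. label_colours n a)"
  proof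
    fix c assume c: "c \<in> {0..<2 * n - 1}"
    define a where "a = (if c mod 4 = 3 then c div 2 else 2 * (c div 4))"
    have "a \<in> {0..<n}" "c \<in> label_colours n a"
      using c assms unfolding a_def label_colours_def by (auto; presburger)+
    then show "c \<in> (\<Union>a\<in>{0..<n}. label_colours n a)" by blast
  qed
qed

theorem near_invariant_one_factorization:
  assumes n: "odd n" "n > 0"
  obtains \<kappa> where "one_factorization (vertices n) (\<noteq>) {0..<2 * n - 1} \<kappa>"
    "\<And>p q. p \<in> vertices n \<Longrightarrow> q \<in> vertices n \<Longrightarrow> p \<noteq> q \<Longrightarrow> \<kappa> p q \<in> label_colours n (label n p q)"
proof -
  have "\<forall>a\<in>{0..<n}. \<exists>\<kappa>. one_factorization (vertices n) (\<lambda>p q. p \<noteq> q \<and> label n p q = a) (label_colours n a) \<kappa>"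
    using label_one_factorization[OF n(1)] by (rule ballI)
  then obtain K where
    K: "\<forall>a\<in>{0..<n}. one_factorization (vertices n) (\<lambda>p q. p \<noteq> q \<and> label n p q = a) (label_colours n a) (K a)"
    by (rule bchoice[THEN exE])
  obtain \<kappa> where \<kappa>:
    "one_factorization (vertices n) (\<lambda>p q. \<exists>a\<in>{0..<n}. p \<noteq> q \<and> label n p q = a) (\<Union>a\<in>{0..<n}. label_colours n a) \<kappa>"
    "\<And>a p q. a \<in> {0..<n} \<Longrightarrow> p \<in> vertices n \<Longrightarrow> q \<in> vertices n \<Longrightarrow> p \<noteq> q \<and> label n p q = a \<Longrightarrow> \<kappa> p q \<in> label_colours n a"
    by (rule one_factorization_UN[OF bspec[OF K]]) (use label_colours_disjoint[OF n(1)] in auto)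
  have "one_factorization (vertices n) (\<noteq>) {0..<2 * n - 1} \<kappa>"
    using one_factorization_cong[OF \<kappa>(1), of "(\<noteq>)"] label_range[OF n(1)] unfolding UN_label_colours[OF n] by blast
  then show thesis using that \<kappa>(2) label_range[OF n(1)] by blast
qed

section \<open>Shift permutations\<close>

definition offset :: "int \<times> bool \<Rightarrow> bool \<Rightarrow> int" where
  "offset = (\<lambda>(t, e) l. if l then of_bool (\<not> e) - t else t)"

definition shift_perm :: "int \<Rightarrow> int \<times> bool \<Rightarrow> int \<times> bool \<Rightarrow> int \<times> bool" where
  "shift_perm n i = (\<lambda>(x, l). ((x + offset i l) mod n, l \<noteq> snd i))"

lemma shift_perm_bij: "bij_betw (shift_perm n i) (vertices n) (vertices n)"
proof (rule bij_betw_byWitness[where f' = "\<lambda>(x, l). ((x - offset i (l \<noteq> snd i)) mod n, l \<noteq> snd i)"])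
  have "((l = (\<not> e)) = (\<not> e)) = l" for l e by auto
  then show "\<forall>p\<in>vertices n. (\<lambda>(x, l). ((x - offset i (l \<noteq> snd i)) mod n, l \<noteq> snd i)) (shift_perm n i p) = p"
    by (auto simp: shift_perm_def vertices_def mod_diff_left_eq)
qed (auto simp: shift_perm_def vertices_def mod_add_left_eq)

lemma shift_perm_latin:
  assumes i: "i \<in> vertices n" "j \<in> vertices n" and eq: "shift_perm n i p = shift_perm n j p"
  shows "i = j"
proof -
  obtain t e u f x l where ij: "i = (t, e)" "j = (u, f)" "p = (x, l)" by (cases i, cases j, cases p)
  have "e = f" using eq ij by (auto simp: shift_perm_def)
  moreover have "n dvd t - u"
  proof -
    have "n dvd offset i l - offset j l" using eq unfolding ij(3) shift_perm_def by (simp add: mod_eq_dvd_iff)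
    then show ?thesis using ij \<open>e = f\<close> dvd_diff_commute[of n t u] by (cases l) (auto simp: offset_def)
  qed
  then have "t mod n = u mod n" by (simp add: mod_eq_dvd_iff)
  ultimately show ?thesis using i ij by (auto simp: vertices_def)
qed

lemma shift_perm_no_swap:
  assumes n: "odd n" "n > 1" and pq: "p \<in> vertices n" "q \<in> vertices n" "p \<noteq> q"
    and eq: "shift_perm n i p = shift_perm n j q" "shift_perm n i q = shift_perm n j p"
  shows False
proof -
  obtain x l y m where p: "p = (x, l)" "q = (y, m)" "x \<in> {0..<n}" "y \<in> {0..<n}"
    using pq by (cases p, cases q) (auto simp: vertices_def)
  obtain t e u f where ij: "i = (t, e)" "j = (u, f)" by (cases i, cases j)
  have levels: "(l \<noteq> e) = (m \<noteq> f)" using eq(1) by (simp add: p ij shift_perm_def)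
  have "n dvd (x + offset i l) - (y + offset j m)" "n dvd (y + offset i m) - (x + offset j l)"
    using eq by (simp_all add: p shift_perm_def mod_eq_dvd_iff)
  note sum_diff = dvd_add[OF this] dvd_diff[OF this]
  show False
  proof (cases "l = m")
    case True
    then have "n dvd 2 * (x - y)" using sum_diff(2) by (simp add: algebra_simps)
    moreover have "coprime n 2" using n(1) by simp
    ultimately have "n dvd x - y" using coprime_dvd_mult_right_iff by blast
    then have "x mod n = y mod n" by (simp add: mod_eq_dvd_iff)
    then show False using pq(3) p True by simp
  next
    case False
    then have "n dvd 1" using sum_diff(1) levels ij by (auto simp: offset_def)
    then show False using n(2) by simp
  qed
qed

lemma shift_perm_doubleton:
  assumes n: "odd n" "n > 1" and ij: "i \<in> vertices n" "j \<in> vertices n" and E: "E \<in> [vertices n]\<^bsup>2\<^esup>"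
    and eq: "shift_perm n i ` E = shift_perm n j ` E"
  shows "i = j"
proof -
  obtain p q where pq: "E = {p, q}" "p \<in> vertices n" "q \<in> vertices n" "p \<noteq> q" using E by (rule doubleton_of_nsets_2)
  then have "shift_perm n i p = shift_perm n j p \<or> shift_perm n i p = shift_perm n j q \<and> shift_perm n i q = shift_perm n j p"
    using eq by (auto simp: doubleton_eq_iff)
  then show ?thesis using shift_perm_latin[OF ij] shift_perm_no_swap[OF n pq(2-4)] by blast
qed

lemma label_shift_perm:
  "label n (shift_perm n i p) (shift_perm n i q) = label n p q \<or>
    label n (shift_perm n i p) (shift_perm n i q) = (label n p q + 1) mod n"
proof -
  obtain x l y m where p: "p = (x, l)" "q = (y, m)" by (cases p, cases q)
  show ?thesis
  proof (cases "l = m")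
    case True
    have "((y + c) mod n - (x + c) mod n) mod n = (y - x) mod n" for x y c :: int by (simp add: mod_diff_eq)
    then show ?thesis using True by (simp add: p shift_perm_def label_def)
  next
    case False
    have "((x + offset i l) mod n + (y + offset i m) mod n) mod n = (x + y + (offset i l + offset i m)) mod n"
      unfolding mod_add_eq by (simp add: algebra_simps)
    moreover have "offset i l + offset i m = of_bool (\<not> snd i)" using False by (cases i) (auto simp: offset_def)
    ultimately show ?thesis using False by (cases "snd i") (auto simp: p shift_perm_def label_def mod_add_left_eq)
  qed
qed

lemma label_colours_shift:
  assumes "odd n" "a \<in> {0..<n}" "a' = a \<or> a' = (a + 1) mod n" "c \<in> label_colours n a" "c' \<in> label_colours n a'"
    and j: "4 \<le> j" "j \<le> 2 * n - 4"
  shows "c' \<noteq> (c + j) mod (2 * n - 1)"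
proof -
  have c: "2 * a \<le> c" "c \<le> 2 * a + 2" "a = n - 1 \<Longrightarrow> c = 2 * a" "odd a \<Longrightarrow> c = 2 * a + 1"
    using assms(4) assms(1) by (auto simp: label_colours_def split: if_splits)
  have c': "2 * a' \<le> c'" "c' \<le> 2 * a' + 2" "odd a' \<Longrightarrow> c' = 2 * a' + 1"
    using assms(5) by (auto simp: label_colours_def split: if_splits)
  consider "a' = a" | "a' = a + 1" "a \<noteq> n - 1" | "a' = 0" "a = n - 1"
    using assms(2,3) by (cases "a = n - 1") auto
  then have diff: "- 2 \<le> c' - c \<and> c' - c \<le> 3 \<or> - 2 \<le> c' - c + (2 * n - 1) \<and> c' - c + (2 * n - 1) \<le> 3"
    using c c' by cases (auto; presburger)+
  moreover have "c \<le> 2 * n - 2" using c(2,3) assms(2) by (cases "a = n - 1") auto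
  then have "(c + j) mod (2 * n - 1) \<in> {c + j, c + j - (2 * n - 1)}"
    using c(1) assms(2) j minus_mod_self2[of "c + j" "2 * n - 1"]
      mod_pos_pos_trivial[of "c + j" "2 * n - 1"] mod_pos_pos_trivial[of "c + j - (2 * n - 1)" "2 * n - 1"]
    by (cases "c + j < 2 * n - 1") auto
  ultimately show ?thesis using j by auto
qed

theorem shift_avoiding_one_factorization:
  assumes n: "odd n" "n > 1"
  obtains \<kappa> where "one_factorization (vertices n) (\<noteq>) {0..<2 * n - 1} \<kappa>"
    "\<And>i j p q. p \<in> vertices n \<Longrightarrow> q \<in> vertices n \<Longrightarrow> p \<noteq> q \<Longrightarrow> 4 \<le> j \<Longrightarrow> j \<le> 2 * n - 4 \<Longrightarrow>
      \<kappa> (shift_perm n i p) (shift_perm n i q) \<noteq> (\<kappa> p q + j) mod (2 * n - 1)"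
proof -
  have "n > 0" using n(2) by simp
  obtain \<kappa> where \<kappa>: "one_factorization (vertices n) (\<noteq>) {0..<2 * n - 1} \<kappa>"
    "\<And>p q. p \<in> vertices n \<Longrightarrow> q \<in> vertices n \<Longrightarrow> p \<noteq> q \<Longrightarrow> \<kappa> p q \<in> label_colours n (label n p q)"
    using near_invariant_one_factorization[OF n(1) \<open>n > 0\<close>] by blast
  have "\<kappa> (shift_perm n i p) (shift_perm n i q) \<noteq> (\<kappa> p q + j) mod (2 * n - 1)"
    if pq: "p \<in> vertices n" "q \<in> vertices n" "p \<noteq> q" and j: "4 \<le> j" "j \<le> 2 * n - 4" for i j p q
  proof -
    have "shift_perm n i p \<in> vertices n" "shift_perm n i q \<in> vertices n" "shift_perm n i p \<noteq> shift_perm n i q"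
      using pq shift_perm_bij[of n i] by (auto simp: bij_betw_def inj_on_eq_iff)
    then show ?thesis
      using label_colours_shift[OF n(1) label_range[OF n(1) pq] label_shift_perm \<kappa>(2)[OF pq] \<kappa>(2) j] by blast
  qed
  then show thesis using that \<kappa>(1) by blast
qed

section \<open>Large sets of disjoint systems\<close>

lemma disjoint_SQS_family_subset: "disjoint_SQS_family P F \<Longrightarrow> F \<subseteq> Pow (Pow P)"
  unfolding disjoint_SQS_family_def is_SQS_def by blast

lemma disjoint_SQS_family_image:
  assumes F: "disjoint_SQS_family P F" and h: "inj_on h P"
  shows "disjoint_SQS_family (h ` P) ((`) ((`) h) ` F)" "card ((`) ((`) h) ` F) = card F"
proof -
  have sub: "F \<subseteq> Pow (Pow P)" using F by (rule disjoint_SQS_family_subset)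
  have inj: "inj_on ((`) h) (Pow P)" using h by (rule inj_on_image_Pow)
  then show "card ((`) ((`) h) ` F) = card F"
    using inj_on_subset[OF inj_on_image_Pow[OF inj] sub] by (intro card_image)
  have "is_SQS (h ` P) ((`) h ` B)" if "B \<in> F" for B
    using F that h is_SQS_image unfolding disjoint_SQS_family_def by blast
  moreover have "(`) h ` B\<^sub>1 \<inter> (`) h ` B\<^sub>2 = {}" if "B\<^sub>1 \<in> F" "B\<^sub>2 \<in> F" "(`) h ` B\<^sub>1 \<noteq> (`) h ` B\<^sub>2" for B\<^sub>1 B\<^sub>2
  proof -
    have "B\<^sub>1 \<inter> B\<^sub>2 = {}" using F that unfolding disjoint_SQS_family_def by blast
    moreover have "B\<^sub>1 \<subseteq> Pow P" "B\<^sub>2 \<subseteq> Pow P" using that(1,2) sub by auto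
    ultimately show ?thesis using inj_on_image_Int[OF inj, of B\<^sub>1 B\<^sub>2] by simp
  qed
  ultimately show "disjoint_SQS_family (h ` P) ((`) ((`) h) ` F)" unfolding disjoint_SQS_family_def by simp
qed

lemma finite_disjoint_SQS_family_cards: "finite {card F | F. disjoint_SQS_family {..<m} F}" for m :: nat
proof (rule finite_subset)
  show "{card F | F. disjoint_SQS_family {..<m} F} \<subseteq> card ` Pow (Pow (Pow {..<m}))"
    using disjoint_SQS_family_subset by blast
qed simp

lemma card_disjoint_SQS_family_le_D:
  assumes F: "disjoint_SQS_family P F" and P: "finite P" "card P = m"
  shows "card F \<le> D m"
proof -
  obtain h where "bij_betw h P {..<m}" using ex_bij_betw_finite_nat[OF P(1)] P(2) by (auto simp: atLeast0LessThan)
  then have h: "inj_on h P" "h ` P = {..<m}" by (auto simp: bij_betw_def)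
  have "card F \<in> {card F | F. disjoint_SQS_family {..<m} F}"
    using disjoint_SQS_family_image[OF F h(1)] unfolding h(2) by (metis (mono_tags, lifting) mem_Collect_eq)
  then show ?thesis unfolding D_def by (rule Max_ge[OF finite_disjoint_SQS_family_cards])
qed

lemma D_attained:
  assumes P: "finite P" "card P = m"
  obtains F where "disjoint_SQS_family P F" "card F = D m" "finite F"
proof -
  have "disjoint_SQS_family {..<m} {}" by (simp add: disjoint_SQS_family_def)
  then have "D m \<in> {card F | F. disjoint_SQS_family {..<m} F}"
    unfolding D_def by (intro Max_in finite_disjoint_SQS_family_cards) blast
  then obtain F where F: "disjoint_SQS_family {..<m} F" "card F = D m" by auto
  obtain h where "bij_betw h {..<m} P" using ex_bij_betw_nat_finite[OF P(1)] P(2) by (auto simp: atLeast0LessThan)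
  then have h: "inj_on h {..<m}" "h ` {..<m} = P" by (auto simp: bij_betw_def)
  note image = disjoint_SQS_family_image[OF F(1) h(1), unfolded h(2)]
  have "finite ((`) ((`) h) ` F)"
    using finite_subset[OF disjoint_SQS_family_subset[OF image(1)]] P(1) by simp
  then show thesis using that image F(2) by simp
qed

lemma card_disjoint_systems_le_D:
  assumes P: "finite P" "card P = m" "m \<ge> 3"
    and B: "\<And>u. u \<in> U \<Longrightarrow> is_SQS P (B u)" "disjoint_family_on B U"
  shows "card U \<le> D m"
proof -
  obtain T where "T \<subseteq> P" "card T = 3" using obtain_subset_with_card_n[of 3 P] P by auto
  then have nonempty: "B u \<noteq> {}" if "u \<in> U" for u using B(1)[OF that] unfolding is_SQS_def by blast
  have "inj_on B U"
  proof (rule inj_onI, rule ccontr)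
    fix u w assume u: "u \<in> U" "w \<in> U" "B u = B w" "u \<noteq> w"
    then have "B u \<inter> B w = {}" by (intro disjoint_family_onD[OF B(2)])
    then show False using u(3) nonempty[OF u(1)] by simp
  qed
  moreover have "disjoint_SQS_family P (B ` U)"
    unfolding disjoint_SQS_family_def
  proof (intro conjI ballI impI)
    fix B\<^sub>1 B\<^sub>2 assume "B\<^sub>1 \<in> B ` U" "B\<^sub>2 \<in> B ` U" "B\<^sub>1 \<noteq> B\<^sub>2"
    then obtain u w where "u \<in> U" "w \<in> U" "B\<^sub>1 = B u" "B\<^sub>2 = B w" "u \<noteq> w" by blast
    then show "B\<^sub>1 \<inter> B\<^sub>2 = {}" using disjoint_family_onD[OF B(2)] by simp
  qed (use B(1) in blast)
  ultimately show ?thesis using card_disjoint_SQS_family_le_D[OF _ P(1,2), of "B ` U"] by (simp add: card_image)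
qed

theorem card_add_le_D_double:
  assumes Q: "finite Q" "card Q = v" "v \<ge> 2" "has_SQS v"
    and I: "finite I" "\<And>i. i \<in> I \<Longrightarrow> bij_betw (\<alpha> i) Q Q"
    and points: "\<And>i j x. i \<in> I \<Longrightarrow> j \<in> I \<Longrightarrow> i \<noteq> j \<Longrightarrow> x \<in> Q \<Longrightarrow> \<alpha> i x \<noteq> \<alpha> j x"
    and pairs: "\<And>i j E. i \<in> I \<Longrightarrow> j \<in> I \<Longrightarrow> i \<noteq> j \<Longrightarrow> E \<in> [Q]\<^bsup>2\<^esup> \<Longrightarrow> \<alpha> i ` E \<noteq> \<alpha> j ` E"
    and fac: "one_factorization Q (\<noteq>) C \<kappa>" "finite C"
    and J: "finite J" "card J \<le> D v" "\<And>j. j \<in> J \<Longrightarrow> bij_betw (\<rho> j) C C"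
    and colours: "\<And>j k c. j \<in> J \<Longrightarrow> k \<in> J \<Longrightarrow> j \<noteq> k \<Longrightarrow> c \<in> C \<Longrightarrow> \<rho> j c \<noteq> \<rho> k c"
    and avoid: "\<And>i j x y. i \<in> I \<Longrightarrow> j \<in> J \<Longrightarrow> x \<in> Q \<Longrightarrow> y \<in> Q \<Longrightarrow> x \<noteq> y \<Longrightarrow> \<kappa> (\<alpha> i x) (\<alpha> i y) \<noteq> \<rho> j (\<kappa> x y)"
  shows "card I + card J \<le> D (2 * v)"
proof -
  obtain B where B: "is_SQS Q B" using Q(4) has_SQS_iff[OF Q(1,2)] by blast
  obtain F where F: "disjoint_SQS_family Q F" "card F = D v" "finite F" using Q(1,2) by (rule D_attained)
  obtain A where A: "A ` J \<subseteq> F" "inj_on A J" using card_le_inj[OF J(1) F(3)] J(2) F(2) by auto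
  then have A_SQS: "is_SQS Q (A j)" if "j \<in> J" for j using F(1) that unfolding disjoint_SQS_family_def by blast
  have A_disjoint: "A j \<inter> A k = {}" if "j \<in> J" "k \<in> J" "j \<noteq> k" for j k
  proof -
    have "A j \<noteq> A k" "A j \<in> F" "A k \<in> F" using A that by (auto simp: inj_on_eq_iff)
    then show ?thesis using F(1) unfolding disjoint_SQS_family_def by simp
  qed
  define S where "S = case_sum (\<lambda>i. lindner Q B (\<alpha> i)) (\<lambda>j. doubling Q (A j) C \<kappa> (\<rho> j))"
  have "is_SQS (Q <+> Q) (S u)" if "u \<in> I <+> J" for u
    using that is_SQS_lindner[OF B I(2)] is_SQS_doubling[OF A_SQS fac J(3)] by (auto simp: S_def)
  moreover have "disjoint_family_on S (I <+> J)"
  proof -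
    have twisted: "S (Inl i) \<inter> S (Inl j) = {}" if "i \<in> I" "j \<in> I" "i \<noteq> j" for i j
      unfolding S_def sum.case by (rule lindner_disjoint[where \<alpha> = "\<alpha> i" and \<beta> = "\<alpha> j", OF B points[OF that] pairs[OF that]])
    moreover have doubled: "S (Inr j) \<inter> S (Inr k) = {}" if "j \<in> J" "k \<in> J" "j \<noteq> k" for j k
      unfolding S_def sum.case
      by (rule doubling_disjoint[where \<rho> = "\<rho> j" and \<rho>' = "\<rho> k", OF A_SQS[OF that(1)] A_SQS[OF that(2)] fac(1)
        A_disjoint[OF that] colours[OF that]])
    moreover have mixed: "S (Inl i) \<inter> S (Inr j) = {}" if "i \<in> I" "j \<in> J" for i j
      unfolding S_def sum.case
      by (rule lindner_doubling_disjoint[where \<alpha> = "\<alpha> i" and \<rho> = "\<rho> j", OF B A_SQS[OF that(2)] I(2)[OF that(1)] fac(1)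
        avoid[OF that]])
    then have "S (Inr j) \<inter> S (Inl i) = {}" if "i \<in> I" "j \<in> J" for i j using that by (simp add: Int_commute)
    with twisted doubled mixed show ?thesis
      unfolding disjoint_family_on_def by (intro ballI impI) (elim PlusE; simp)
  qed
  moreover have "finite (Q <+> Q)" "card (Q <+> Q) = 2 * v" using Q(1,2) by (simp_all add: card_Plus)
  ultimately have "card (I <+> J) \<le> D (2 * v)" using Q(3) by (intro card_disjoint_systems_le_D[of "Q <+> Q" _ _ S]) auto
  then show ?thesis using I(1) J(1) by (simp add: card_Plus)
qed

lemma mod_add_left_cancel:
  fixes j k c N :: int
  assumes "j \<in> {0..<N}" "k \<in> {0..<N}" "(c + j) mod N = (c + k) mod N"
  shows "j = k"
proof -
  have "j mod N = k mod N" using assms(3) by (simp add: mod_eq_dvd_iff)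
  then show ?thesis using assms(1,2) by simp
qed

theorem theorem1:
  fixes n :: nat
  assumes "n \<ge> 7" and "n mod 6 = 1 \<or> n mod 6 = 5"
  shows "D (4 * n) \<ge> 2 * n + min (D (2 * n)) (2 * n - 7)"
proof -
  let ?n = "int n"
  define J where "J = {4..<4 + int (min (D (2 * n)) (2 * n - 7))}"
  have J: "4 \<le> j \<and> j \<le> 2 * ?n - 4" if "j \<in> J" for j using that assms(1) unfolding J_def by auto
  have n: "odd ?n" "?n > 1" using assms by (simp_all, presburger)
  obtain \<kappa> where \<kappa>: "one_factorization (vertices ?n) (\<noteq>) {0..<2 * ?n - 1} \<kappa>"
    "\<And>i j p q. p \<in> vertices ?n \<Longrightarrow> q \<in> vertices ?n \<Longrightarrow> p \<noteq> q \<Longrightarrow> 4 \<le> j \<Longrightarrow> j \<le> 2 * ?n - 4 \<Longrightarrow>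
      \<kappa> (shift_perm ?n i p) (shift_perm ?n i q) \<noteq> (\<kappa> p q + j) mod (2 * ?n - 1)"
    using shift_avoiding_one_factorization[OF n] by blast
  have "card (vertices ?n) + card J \<le> D (2 * (2 * n))"
  proof (rule card_add_le_D_double[where \<rho> = "\<lambda>j c. (c + j) mod (2 * ?n - 1)"])
    show "one_factorization (vertices ?n) (\<noteq>) {0..<2 * ?n - 1} \<kappa>" by (rule \<kappa>(1))
    show "bij_betw (shift_perm ?n i) (vertices ?n) (vertices ?n)" for i by (rule shift_perm_bij)
    show "bij_betw (\<lambda>c. (c + j) mod (2 * ?n - 1)) {0..<2 * ?n - 1} {0..<2 * ?n - 1}" for j by (rule shift_mod_bij)
    show "card (vertices ?n) = 2 * n" by (simp add: card_vertices)
    show "has_SQS (2 * n)" by (rule has_SQS_if_admissible) (use assms(2) in \<open>unfold admissible_def, presburger\<close>)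
    show "shift_perm ?n i p \<noteq> shift_perm ?n j p" if "i \<in> vertices ?n" "j \<in> vertices ?n" "i \<noteq> j" for i j p
      using shift_perm_latin that by blast
    show "shift_perm ?n i ` E \<noteq> shift_perm ?n j ` E"
      if "i \<in> vertices ?n" "j \<in> vertices ?n" "i \<noteq> j" "E \<in> [vertices ?n]\<^bsup>2\<^esup>" for i j E
      using shift_perm_doubleton[OF n] that by blast
    show "(c + j) mod (2 * ?n - 1) \<noteq> (c + k) mod (2 * ?n - 1)" if "j \<in> J" "k \<in> J" "j \<noteq> k" for j k c
      using mod_add_left_cancel[of j "2 * ?n - 1" k c] J[OF that(1)] J[OF that(2)] that(3) by auto
    show "\<kappa> (shift_perm ?n i p) (shift_perm ?n i q) \<noteq> (\<kappa> p q + j) mod (2 * ?n - 1)"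
      if "j \<in> J" "p \<in> vertices ?n" "q \<in> vertices ?n" "p \<noteq> q" for i j p q using that J \<kappa>(2) by blast
  qed (use assms(1) in \<open>simp_all add: finite_vertices J_def\<close>)
  then show ?thesis by (simp add: card_vertices J_def)
qed

end
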